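(* Let $n\ge2$ and $2\le k\le n$. Let $\tilde M$ be the manifold $\mathbb R^n$ equipped with a smooth Riemannian metric $\tilde g$ such that, in polar coordinates $(r,\theta)\in(0,\infty)\times\mathbb S^{n-1}$, one has $\tilde g=dr^2+e^{-2r}h$ for all large enough $r$, where $h$ is the standard metric on the sphere $\mathbb S^{n-1}$. Let $1\le\tilde q,\tilde p\le\infty$. If $\tilde q<\frac{n-1}{k-1}<\tilde p$, then $H^k_{\tilde q,\tilde p}(\tilde M)=0$.
   Context: For an oriented $n$-dimensional Riemannian manifold $M$, $L^p(M,\Lambda^k)$ is the Banach space of (locally integrable) $k$-forms $\theta$ whose pointwise norm $|\theta|$ lies in $L^p(M)$ with respect to the Riemannian volume. For locally integrable forms $\phi$ (degree $k-1$) and $\theta$ (degree $k$), $d\phi=\theta$ in the weak sense means $\int_M\theta\wedge\omega=(-1)^k\int_M\phi\wedge d\omega$ for all smooth compactly supported $(n-k)$-forms $\omega$. Put $Z^k_p(M)=L^p(M,\Lambda^k)\cap\ker d$ and $B^k_{q,p}(M)=d(L^q(M,\Lambda^{k-1}))\cap L^p(M,\Lambda^k)$ (forms in $L^p$ that are weak differentials of a form in $L^q$). The $L_{q,p}$-cohomology is $H^k_{q,p}(M)=Z^k_p(M)/B^k_{q,p}(M)$, $1\le p,q\le\infty$. *)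

theory Defs
  imports "HOL-Analysis.Analysis"
begin

fun C_diff :: "nat \<Rightarrow> ('a::real_normed_vector \<Rightarrow> real) \<Rightarrow> bool" where
  "C_diff 0 f \<longleftrightarrow> continuous_on UNIV f"
| "C_diff (Suc m) f \<longleftrightarrow>
     (\<forall>x. f differentiable at x) \<and> (\<forall>v. C_diff m (\<lambda>x. frechet_derivative f (at x) v))"

definition smooth :: "('a::real_normed_vector \<Rightarrow> real) \<Rightarrow> bool" where
  "smooth f \<longleftrightarrow> (\<forall>m. C_diff m f)"

text \<open>
  The degree of a form cannot be part of its type. A covector of degree \<open>k\<close> is a function of a
  sequence of vectors that only looks at the entries \<open>v 0, \<dots>, v (k - 1)\<close>, so that it is the same
  thing as an alternating \<open>k\<close>-linear form.
\<close>

type_synonym 'n covector = "(nat \<Rightarrow> real^'n) \<Rightarrow> real"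
type_synonym 'n form = "real^'n \<Rightarrow> 'n covector"

definition alternating :: "nat \<Rightarrow> 'n::finite covector \<Rightarrow> bool" where
  "alternating k \<alpha> \<longleftrightarrow>
     (\<forall>v w. (\<forall>i<k. v i = w i) \<longrightarrow> \<alpha> v = \<alpha> w) \<and>
     (\<forall>v. \<forall>i<k. linear (\<lambda>a. \<alpha> (v(i := a)))) \<and>
     (\<forall>v i j. i < j \<and> j < k \<and> v i = v j \<longrightarrow> \<alpha> v = 0)"

text \<open>Normalised so that \<open>dx\<^sub>1 \<and> \<dots> \<and> dx\<^sub>n\<close> is the determinant.\<close>

definition wedge :: "nat \<Rightarrow> nat \<Rightarrow> 'n::finite covector \<Rightarrow> 'n covector \<Rightarrow> 'n covector" where
  "wedge k l \<alpha> \<beta> v =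
     (\<Sum>\<sigma> | \<sigma> permutes {..<k + l}.
        of_int (sign \<sigma>) * \<alpha> (\<lambda>i. v (\<sigma> i)) * \<beta> (\<lambda>i. v (\<sigma> (k + i)))) / (fact k * fact l)"

definition ext_deriv :: "nat \<Rightarrow> 'n::finite form \<Rightarrow> 'n form" where
  "ext_deriv k \<omega> x v =
     (\<Sum>i\<le>k. (-1) ^ i *
        frechet_derivative (\<lambda>y. \<omega> y (\<lambda>j. if j < i then v j else v (Suc j))) (at x) (v i))"

definition loc_integrable_form :: "nat \<Rightarrow> 'n::finite form \<Rightarrow> bool" where
  "loc_integrable_form k \<theta> \<longleftrightarrow>
     (\<forall>x. alternating k (\<theta> x)) \<and>
     (\<forall>v K. compact K \<longrightarrow> (\<lambda>x. \<theta> x v) absolutely_integrable_on K)"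

definition test_form :: "nat \<Rightarrow> 'n::finite form \<Rightarrow> bool" where
  "test_form k \<omega> \<longleftrightarrow>
     (\<forall>x. alternating k (\<omega> x)) \<and>
     (\<forall>v. smooth (\<lambda>x. \<omega> x v)) \<and>
     (\<exists>K. compact K \<and> (\<forall>x. x \<notin> K \<longrightarrow> \<omega> x = (\<lambda>v. 0)))"

text \<open>
  Integration of a top-degree form. The index type carries no order, so the orientation is the one
  of some fixed enumeration of the standard basis. The opposite orientation changes the sign of all
  integrals, which does not affect the weak differential defined below.
\<close>

definition std_frame :: "nat \<Rightarrow> real^'n::finite" where
  "std_frame i = axis (from_nat_into UNIV i) 1"

definition form_integral :: "'n::finite form \<Rightarrow> real" where
  "form_integral \<eta> = (LINT x|lebesgue. \<eta> x std_frame)"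

text \<open>
  \<open>d\<phi> = \<theta>\<close> in the weak sense, for \<open>\<theta>\<close> of degree \<open>k \<ge> 1\<close>. If \<open>k\<close> exceeds the dimension there are no
  test forms and the condition is vacuous.
\<close>

definition weak_diff :: "nat \<Rightarrow> 'n::finite form \<Rightarrow> 'n form \<Rightarrow> bool" where
  "weak_diff k \<phi> \<theta> \<longleftrightarrow>
     loc_integrable_form (k - 1) \<phi> \<and> loc_integrable_form k \<theta> \<and>
     (\<forall>l \<omega>. k + l = CARD('n) \<and> test_form l \<omega> \<longrightarrow>
        form_integral (\<lambda>x. wedge k l (\<theta> x) (\<omega> x)) =
        (-1) ^ k * form_integral (\<lambda>x. wedge (k - 1) (l + 1) (\<phi> x) (ext_deriv l \<omega> x)))"

type_synonym 'n metric = "real^'n \<Rightarrow> real^'n \<Rightarrow> real^'n \<Rightarrow> real"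

definition riemannian_metric :: "'n::finite metric \<Rightarrow> bool" where
  "riemannian_metric g \<longleftrightarrow>
     (\<forall>x. bilinear (g x) \<and> (\<forall>v w. g x v w = g x w v) \<and> (\<forall>v. v \<noteq> 0 \<longrightarrow> g x v v > 0)) \<and>
     (\<forall>v w. smooth (\<lambda>x. g x v w))"

definition gram :: "'n::finite metric \<Rightarrow> real^'n \<Rightarrow> real^'n^'n" where
  "gram g x = (\<chi> i j. g x (axis i 1) (axis j 1))"

definition vol :: "'n::finite metric \<Rightarrow> (real^'n) measure" where
  "vol g = density lebesgue (\<lambda>x. ennreal (sqrt (det (gram g x))))"

text \<open>
  The pointwise norm at \<open>x\<close>:
  \<open>|\<alpha>|\<^sup>2 = (1/k!) \<Sum> g\<^sup>i\<^sup>1\<^sup>j\<^sup>1 \<cdots> g\<^sup>i\<^sup>k\<^sup>j\<^sup>k \<alpha>(e\<^sub>i\<^sub>1, \<dots>, e\<^sub>i\<^sub>k) \<alpha>(e\<^sub>j\<^sub>1, \<dots>, e\<^sub>j\<^sub>k)\<close>, which makes the wedge products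
  of an orthonormal coframe orthonormal.
\<close>

definition covector_norm :: "'n::finite metric \<Rightarrow> nat \<Rightarrow> real^'n \<Rightarrow> 'n covector \<Rightarrow> real" where
  "covector_norm g k x \<alpha> =
     sqrt ((\<Sum>I \<in> {..<k} \<rightarrow>\<^sub>E UNIV. \<Sum>J \<in> {..<k} \<rightarrow>\<^sub>E UNIV.
        (\<Prod>a<k. matrix_inv (gram g x) $ I a $ J a) *
        \<alpha> (\<lambda>a. axis (I a) 1) * \<alpha> (\<lambda>a. axis (J a) 1)) / fact k)"

text \<open>
  In polar coordinates \<open>x = r\<theta>\<close> the differential of \<open>(r, \<theta>) \<mapsto> r\<theta>\<close> sends a tangent vector
  \<open>(a, \<xi>)\<close> of \<open>(0, \<infinity>) \<times> S\<close>, where \<open>\<xi> \<bullet> \<theta> = 0\<close>, to \<open>a\<theta> + r\<xi>\<close>, and the standard metric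
  of the sphere is the restricted inner product. The equation says that the pullback of \<open>g\<close> is
  \<open>dr\<^sup>2 + e\<^sup>-\<^sup>2\<^sup>r h\<close>.
\<close>

definition cusp_end :: "'n::finite metric \<Rightarrow> bool" where
  "cusp_end g \<longleftrightarrow>
     (\<exists>R>0. \<forall>r>R. \<forall>\<theta>\<in>sphere 0 1. \<forall>a b \<xi> \<eta>. \<xi> \<bullet> \<theta> = 0 \<and> \<eta> \<bullet> \<theta> = 0 \<longrightarrow>
        g (r *\<^sub>R \<theta>) (a *\<^sub>R \<theta> + r *\<^sub>R \<xi>) (b *\<^sub>R \<theta> + r *\<^sub>R \<eta>) = a * b + exp (- 2 * r) * (\<xi> \<bullet> \<eta>))"

definition Lp_forms :: "'n::finite metric \<Rightarrow> nat \<Rightarrow> ennreal \<Rightarrow> 'n form set" where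
  "Lp_forms g k p = {\<theta>. loc_integrable_form k \<theta> \<and>
     (if p = \<infinity> then \<exists>C. AE x in vol g. covector_norm g k x (\<theta> x) \<le> C
      else integrable (vol g) (\<lambda>x. covector_norm g k x (\<theta> x) powr enn2real p))}"

definition Z_forms :: "'n::finite metric \<Rightarrow> nat \<Rightarrow> ennreal \<Rightarrow> 'n form set" where
  "Z_forms g k p = {\<theta> \<in> Lp_forms g k p. weak_diff (k + 1) \<theta> (\<lambda>x v. 0)}"

definition B_forms :: "'n::finite metric \<Rightarrow> nat \<Rightarrow> ennreal \<Rightarrow> ennreal \<Rightarrow> 'n form set" where
  "B_forms g k q p = {\<theta> \<in> Lp_forms g k p. \<exists>\<phi> \<in> Lp_forms g (k - 1) q. weak_diff k \<phi> \<theta>}"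

text \<open>
  The quotient of \<open>Z_forms\<close> by \<open>B_forms\<close> as the set of cosets, for \<open>k \<ge> 1\<close>; its zero element is the
  coset \<open>B_forms\<close>. Forms are not identified when they agree almost everywhere: the forms that vanish
  almost everywhere belong to \<open>B_forms\<close>, so the quotient is the same.
\<close>

definition cohomology :: "'n::finite metric \<Rightarrow> nat \<Rightarrow> ennreal \<Rightarrow> ennreal \<Rightarrow> 'n form set set" where
  "cohomology g k q p =
     (\<lambda>\<alpha>. {(\<lambda>x v. \<alpha> x v + \<beta> x v) | \<beta>. \<beta> \<in> B_forms g k q p}) ` Z_forms g k p"

end

theory Submission
  imports Defs
begin

text \<open>
  In polar coordinates write \<open>\<theta> = dr \<and> \<beta> + \<gamma>\<close>. The cone operator \<open>\<phi> = \<integral>\<^sub>0\<^sup>r \<beta> ds\<close> based at the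
  origin solves \<open>d\<phi> = \<theta>\<close> for every closed \<open>\<theta>\<close> in \<open>L\<^sup>p\<close>. Put \<open>f r = min r (exp (- r))\<close>. Up to bounded
  factors, the norm of a tangential form of degree \<open>k - 1\<close> is its norm on the unit sphere times
  \<open>f\<close> to the power \<open>1 - k\<close>, and the volume density is \<open>f\<close> to the power \<open>n - 1\<close>. Since
  \<open>p > (n - 1) / (k - 1)\<close>, the integral of \<open>\<beta>\<close> over a whole ray is controlled by the \<open>L\<^sup>p\<close> norm of
  \<open>\<theta>\<close> on that ray, and since \<open>q < (n - 1) / (k - 1)\<close>, a form of degree \<open>k - 1\<close> that is bounded in \<open>r\<close>
  is in \<open>L\<^sup>q\<close>. The singularity of the cone operator at the origin does no harm, because
  \<open>(n - 1) / (k - 1) \<ge> n / k\<close>. For \<open>k = n\<close> there is no admissible \<open>q\<close>.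
\<close>

section \<open>Alternating forms\<close>

text \<open>The form \<theta> is merely integrable, so d\<phi> = \<theta> cannot be checked by
  differentiating the cone. Polar coordinates are replaced throughout by Fubini in (t, x) together
  with the dilations x -> t x: \<open>radial_weight\<close> cancels the polar Jacobian, and an
  integral over rays becomes an integral over space. For the weak equation, the derivative in the
  dilation parameter is put on the test form, and a substitution carries the dilation back to
  \<theta>. What remains is the boundary term t^k times the integral of \<theta>(t x) \<and>
  \<omega>, which has to vanish as t -> 0; by scaling this asks for p > n / k, and this is the only
  condition that comes from the origin in the equation itself. The metric is prescribed only far
  out. In the remaining ball it is compared with the Euclidean metric by compactness, which costs
  constants. The cone may be based at the origin, although the cusp is at infinity, because the
  integral of \<beta> over the full ray is finite and so bounds the cone at every radius.\<close>

lemma alternating_cong: "alternating k \<alpha> \<Longrightarrow> (\<And>i. i < k \<Longrightarrow> v i = w i) \<Longrightarrow> \<alpha> v = \<alpha> w"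
  unfolding alternating_def by blast

lemma alternating_linear: "alternating k \<alpha> \<Longrightarrow> i < k \<Longrightarrow> linear (\<lambda>a. \<alpha> (v(i := a)))"
  unfolding alternating_def by blast

lemma alternating_repeat: "alternating k \<alpha> \<Longrightarrow> i < k \<Longrightarrow> j < k \<Longrightarrow> i \<noteq> j \<Longrightarrow> v i = v j \<Longrightarrow> \<alpha> v = 0"
  unfolding alternating_def by (metis linorder_neqE_nat)

lemma alternating_zero: "alternating k (\<lambda>v. 0)"
  unfolding alternating_def by (auto intro: linear_zero)

lemma alternating_linear_combination:
  assumes "alternating k \<alpha>" "alternating k \<beta>"
  shows "alternating k (\<lambda>v. a * \<alpha> v + b * \<beta> v)"
  unfolding alternating_def
proof (intro conjI allI impI)
  fix v w :: "nat \<Rightarrow> real^'a" assume "\<forall>i<k. v i = w i"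
  then show "a * \<alpha> v + b * \<beta> v = a * \<alpha> w + b * \<beta> w"
    using alternating_cong[OF assms(1)] alternating_cong[OF assms(2)] by metis
next
  fix v :: "nat \<Rightarrow> real^'a" and i assume "i < k"
  from alternating_linear[OF assms(1) this, of v] alternating_linear[OF assms(2) this, of v]
  show "linear (\<lambda>x. a * \<alpha> (v(i := x)) + b * \<beta> (v(i := x)))"
    by (auto simp: linear_iff algebra_simps)
next
  fix v :: "nat \<Rightarrow> real^'a" and i j assume "i < j \<and> j < k \<and> v i = v j"
  then show "a * \<alpha> v + b * \<beta> v = 0"
    using assms unfolding alternating_def by (metis add_0 mult_zero_right)
qed

text \<open>\<open>case_nat y v\<close> puts y in front of the sequence v, so this covector is the
  interior product of \<alpha> with y. All contractions, with the position vector or with a frame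
  vector, are written in this way.\<close>

lemma alternating_interior:
  assumes "alternating (Suc k) \<alpha>"
  shows "alternating k (\<lambda>v. \<alpha> (case_nat y v))"
  unfolding alternating_def
proof (intro conjI allI impI)
  fix v w :: "nat \<Rightarrow> real^'a" assume "\<forall>i<k. v i = w i"
  then show "\<alpha> (case_nat y v) = \<alpha> (case_nat y w)"
    by (intro alternating_cong[OF assms]) (auto split: nat.split)
next
  fix v :: "nat \<Rightarrow> real^'a" and i assume "i < k"
  have "case_nat y (v(i := a)) = (case_nat y v)(Suc i := a)" for a
    by (auto simp: fun_eq_iff split: nat.split)
  then show "linear (\<lambda>a. \<alpha> (case_nat y (v(i := a))))"
    using alternating_linear[OF assms, of "Suc i" "case_nat y v"] \<open>i < k\<close> by simp
next
  fix v :: "nat \<Rightarrow> real^'a" and i j assume "i < j \<and> j < k \<and> v i = v j"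
  then show "\<alpha> (case_nat y v) = 0"
    by (intro alternating_repeat[OF assms, of "Suc i" "Suc j"]) auto
qed

lemma alternating_interior_linear:
  assumes "alternating (Suc k) \<alpha>"
  shows "linear (\<lambda>y. \<alpha> (case_nat y v))"
proof -
  have "case_nat y v = (case_nat 0 v)(0 := y)" for y
    by (auto simp: fun_eq_iff split: nat.split)
  then have "(\<lambda>y. \<alpha> (case_nat y v)) = (\<lambda>y. \<alpha> ((case_nat 0 v)(0 := y)))" by (metis (no_types))
  then show ?thesis
    using alternating_linear[OF assms, of 0 "case_nat 0 v"] by (metis zero_less_Suc)
qed

text \<open>Polarisation: with \<open>A a b\<close> the value on a in slot i and b in slot j,
  expanding \<open>A (a + b) (a + b) = 0\<close> leaves \<open>A a b + A b a = 0\<close>. The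
  definition of \<open>alternating\<close> only speaks of repeated arguments.\<close>

lemma alternating_swap:
  assumes "alternating k \<alpha>" "i < k" "j < k" "i \<noteq> j"
  shows "\<alpha> (\<lambda>m. v (Transposition.transpose i j m)) = - \<alpha> v"
proof -
  define A where "A a b = \<alpha> (v(i := a, j := b))" for a b
  have l1: "linear (\<lambda>b. A a b)" for a
    unfolding A_def using alternating_linear[OF assms(1,3), of "v(i := a)"] by simp
  have l2: "linear (\<lambda>a. A a b)" for b
  proof -
    have "v(i := a, j := b) = (v(j := b))(i := a)" for a using assms(4) by (simp add: fun_upd_twist)
    then show ?thesis unfolding A_def using alternating_linear[OF assms(1,2), of "v(j := b)"] by simp
  qed
  have d: "A a a = 0" for a
    unfolding A_def by (rule alternating_repeat[OF assms]) (use assms(4) in auto)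
  have "A (v i + v j) (v i + v j) = A (v i) (v i) + A (v i) (v j) + A (v j) (v i) + A (v j) (v j)"
    by (simp add: linear_add[OF l1] linear_add[OF l2])
  then have "A (v j) (v i) = - A (v i) (v j)" by (simp add: d)
  moreover have "v(i := v j, j := v i) = (\<lambda>m. v (Transposition.transpose i j m))"
    by (auto simp: Transposition.transpose_def fun_eq_iff)
  ultimately show ?thesis unfolding A_def by simp
qed

text \<open>Entry i reaches the front by i adjacent transpositions, one for each induction step,
  each of which costs a sign. The inner function deletes entry i, as in
  \<open>ext_deriv\<close>.\<close>

lemma alternating_move_front:
  assumes "alternating k \<alpha>" "i < k"
  shows "\<alpha> (case_nat (v i) (\<lambda>j. if j < i then v j else v (Suc j))) = (-1) ^ i * \<alpha> v"
  using assms(2)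
proof (induction i arbitrary: v)
  case 0
  have "case_nat (v 0) (\<lambda>j. if j < 0 then v j else v (Suc j)) = v"
    by (auto simp: fun_eq_iff split: nat.split)
  then show ?case by (metis mult_1 power_0)
next
  case (Suc i)
  let ?w = "\<lambda>m. v (Transposition.transpose i (Suc i) m)"
  have "case_nat (v (Suc i)) (\<lambda>j. if j < Suc i then v j else v (Suc j))
      = case_nat (?w i) (\<lambda>j. if j < i then ?w j else ?w (Suc j))"
    by (auto simp: Transposition.transpose_def fun_eq_iff less_Suc_eq split: nat.split)
  moreover have "\<alpha> (case_nat (?w i) (\<lambda>j. if j < i then ?w j else ?w (Suc j))) = (-1) ^ i * \<alpha> ?w"
    by (rule Suc.IH) (use Suc.prems in simp)
  moreover have "\<alpha> ?w = - \<alpha> v"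
    by (rule alternating_swap[OF assms(1)]) (use Suc.prems in auto)
  ultimately show ?case by simp
qed

text \<open>The arguments are expanded one slot at a time: j counts the slots already expanded, and
  a choice function on the first j + 1 slots is one on the first j slots together with an index for
  slot j.\<close>

lemma alternating_expand_aux:
  assumes "alternating k \<alpha>" "finite S" "j \<le> k"
  shows "\<alpha> (\<lambda>a. if a < j then \<Sum>m\<in>S. c a m *\<^sub>R u m else v a)
       = (\<Sum>M\<in>{..<j} \<rightarrow>\<^sub>E S. (\<Prod>a<j. c a (M a)) * \<alpha> (\<lambda>a. if a < j then u (M a) else v a))"
  using assms(3)
proof (induction j arbitrary: v)
  case 0
  then show ?case by simp
next
  case (Suc j)
  define w where "w = (\<lambda>M x a. if a < j then u (M a) else if a = j then x else v a)"
  have lin: "linear (\<lambda>x. \<alpha> (w M x))" for M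
  proof -
    have "w M x = (w M 0)(j := x)" for x unfolding w_def by auto
    then have "(\<lambda>x. \<alpha> (w M x)) = (\<lambda>x. \<alpha> ((w M 0)(j := x)))" by (metis (no_types))
    then show ?thesis using alternating_linear[OF assms(1), of j "w M 0"] Suc.prems by (metis Suc_le_lessD)
  qed
  let ?x = "\<Sum>m\<in>S. c j m *\<^sub>R u m"
  have "(\<lambda>a. if a < Suc j then \<Sum>m\<in>S. c a m *\<^sub>R u m else v a)
      = (\<lambda>a. if a < j then \<Sum>m\<in>S. c a m *\<^sub>R u m else if a = j then ?x else v a)"
    by (auto simp: less_Suc_eq)
  then have "\<alpha> (\<lambda>a. if a < Suc j then \<Sum>m\<in>S. c a m *\<^sub>R u m else v a)
     = (\<Sum>M\<in>{..<j} \<rightarrow>\<^sub>E S. (\<Prod>a<j. c a (M a)) * \<alpha> (w M ?x))"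
    using Suc.IH[of "\<lambda>a. if a = j then ?x else v a"] Suc.prems by (simp add: w_def)
  also have "\<dots> = (\<Sum>M\<in>{..<j} \<rightarrow>\<^sub>E S. \<Sum>m\<in>S. (\<Prod>a<j. c a (M a)) * c j m * \<alpha> (w M (u m)))"
    by (simp add: linear_sum[OF lin] linear_scale[OF lin] sum_distrib_left mult.assoc)
  also have "\<dots> = (\<Sum>(m, M)\<in>S \<times> ({..<j} \<rightarrow>\<^sub>E S). (\<Prod>a<j. c a (M a)) * c j m * \<alpha> (w M (u m)))"
    by (subst sum.swap) (simp add: sum.cartesian_product)
  also have "\<dots> = (\<Sum>M\<in>{..<Suc j} \<rightarrow>\<^sub>E S. (\<Prod>a<Suc j. c a (M a)) * \<alpha> (\<lambda>a. if a < Suc j then u (M a) else v a))"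
  proof -
    have eq: "{..<Suc j} \<rightarrow>\<^sub>E S = (\<lambda>(m, M). M(j := m)) ` (S \<times> ({..<j} \<rightarrow>\<^sub>E S))"
      unfolding lessThan_Suc by (rule PiE_insert_eq)
    have inj: "inj_on (\<lambda>(m, M). M(j := m)) (S \<times> ({..<j} \<rightarrow>\<^sub>E S))"
      using inj_combinator[of j "{..<j}" "\<lambda>_. S"] by simp
    show ?thesis
      unfolding eq sum.reindex[OF inj]
    proof (intro sum.cong refl)
      fix x assume "x \<in> S \<times> ({..<j} \<rightarrow>\<^sub>E S)"
      obtain m M where x: "x = (m, M)" by (cases x)
      have "w M (u m) = (\<lambda>a. if a < Suc j then u ((M(j := m)) a) else v a)"
        unfolding w_def by (auto simp: less_Suc_eq fun_eq_iff)
      then show "(case x of (m, M) \<Rightarrow> (\<Prod>a<j. c a (M a)) * c j m * \<alpha> (w M (u m))) =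
        ((\<lambda>M. (\<Prod>a<Suc j. c a (M a)) * \<alpha> (\<lambda>a. if a < Suc j then u (M a) else v a)) \<circ>
          (\<lambda>(m, M). M(j := m))) x"
        unfolding x comp_def prod.case by simp
    qed
  qed
  finally show ?case .
qed

lemma alternating_expand:
  assumes "alternating k \<alpha>" "finite S" "\<And>a. a < k \<Longrightarrow> v a = (\<Sum>m\<in>S. c a m *\<^sub>R u m)"
  shows "\<alpha> v = (\<Sum>M\<in>{..<k} \<rightarrow>\<^sub>E S. (\<Prod>a<k. c a (M a)) * \<alpha> (\<lambda>a. u (M a)))"
proof -
  have "\<alpha> v = \<alpha> (\<lambda>a. if a < k then \<Sum>m\<in>S. c a m *\<^sub>R u m else v a)"
    by (rule alternating_cong[OF assms(1)]) (simp add: assms(3))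
  also have "\<dots> = (\<Sum>M\<in>{..<k} \<rightarrow>\<^sub>E S. (\<Prod>a<k. c a (M a)) * \<alpha> (\<lambda>a. if a < k then u (M a) else v a))"
    by (rule alternating_expand_aux[OF assms(1,2)]) simp
  also have "\<dots> = (\<Sum>M\<in>{..<k} \<rightarrow>\<^sub>E S. (\<Prod>a<k. c a (M a)) * \<alpha> (\<lambda>a. u (M a)))"
    by (intro sum.cong refl arg_cong2[where f="(*)"] alternating_cong[OF assms(1)]) auto
  finally show ?thesis .
qed

text \<open>The coefficient bound is asked only for tuples on which \<alpha> does not vanish. In
  \<open>cusp_bounds\<close> this excludes the radial direction, whose coefficient need not be
  small.\<close>

lemma alternating_expand_bound:
  assumes "alternating k \<alpha>" "finite S" "\<And>a. a < k \<Longrightarrow> v a = (\<Sum>m\<in>S. c a m *\<^sub>R u m)"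
    and "\<And>M a. M \<in> {..<k} \<rightarrow>\<^sub>E S \<Longrightarrow> \<alpha> (\<lambda>a. u (M a)) \<noteq> 0 \<Longrightarrow> a < k \<Longrightarrow> \<bar>c a (M a)\<bar> \<le> C"
  shows "\<bar>\<alpha> v\<bar> \<le> C ^ k * (\<Sum>M\<in>{..<k} \<rightarrow>\<^sub>E S. \<bar>\<alpha> (\<lambda>a. u (M a))\<bar>)"
proof -
  have "\<bar>\<alpha> v\<bar> \<le> (\<Sum>M\<in>{..<k} \<rightarrow>\<^sub>E S. \<bar>(\<Prod>a<k. c a (M a)) * \<alpha> (\<lambda>a. u (M a))\<bar>)"
    by (subst alternating_expand[OF assms(1-3)]) (auto intro: sum_abs)
  also have "\<dots> \<le> (\<Sum>M\<in>{..<k} \<rightarrow>\<^sub>E S. C ^ k * \<bar>\<alpha> (\<lambda>a. u (M a))\<bar>)"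
  proof (intro sum_mono)
    fix M assume M: "M \<in> {..<k} \<rightarrow>\<^sub>E S"
    show "\<bar>(\<Prod>a<k. c a (M a)) * \<alpha> (\<lambda>a. u (M a))\<bar> \<le> C ^ k * \<bar>\<alpha> (\<lambda>a. u (M a))\<bar>"
    proof (cases "\<alpha> (\<lambda>a. u (M a)) = 0")
      case False
      then have "(\<Prod>a<k. \<bar>c a (M a)\<bar>) \<le> (\<Prod>a<k. C)"
        by (intro prod_mono) (auto intro: assms(4)[OF M])
      then show ?thesis
        by (auto simp: abs_mult abs_prod intro!: mult_right_mono)
    qed simp
  qed
  finally show ?thesis by (simp add: sum_distrib_left)
qed

section \<open>Moving an interior product across a wedge product\<close>

text \<open>The permutations are sorted by the position m at which they take the value j. Positions
  outside M contribute nothing. For m in M, composition with the transposition of c and m carries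
  the class of m to the class of c without changing F, so all these classes contribute
  equally.\<close>

lemma sum_permutations_orbit:
  fixes F :: "(nat \<Rightarrow> nat) \<Rightarrow> real"
  assumes "j < N" "c \<in> M" "M \<subseteq> {..<N}"
    and inv: "\<And>\<sigma> m. \<sigma> permutes {..<N} \<Longrightarrow> m \<in> M \<Longrightarrow> F (\<sigma> \<circ> Transposition.transpose c m) = F \<sigma>"
    and zero: "\<And>\<sigma> m. \<sigma> permutes {..<N} \<Longrightarrow> m < N \<Longrightarrow> m \<notin> M \<Longrightarrow> \<sigma> m = j \<Longrightarrow> F \<sigma> = 0"
  shows "(\<Sum>\<sigma> | \<sigma> permutes {..<N}. F \<sigma>) = card M * (\<Sum>\<sigma> | \<sigma> permutes {..<N} \<and> \<sigma> c = j. F \<sigma>)"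
proof -
  have fin: "finite {\<sigma>. \<sigma> permutes {..<N}}" by (rule finite_permutations) simp
  have finM: "finite M" using assms(3) finite_subset by blast
  have eq: "{\<sigma>. \<sigma> permutes {..<N}} = (\<Union>m\<in>{..<N}. {\<sigma>. \<sigma> permutes {..<N} \<and> \<sigma> m = j})"
  proof (intro subset_antisym subsetI)
    fix \<sigma> assume "\<sigma> \<in> {\<sigma>. \<sigma> permutes {..<N}}"
    then have s: "\<sigma> permutes {..<N}" by simp
    from permutes_image[OF s] assms(1) obtain m where "m < N" "\<sigma> m = j" by (metis imageE lessThan_iff)
    then show "\<sigma> \<in> (\<Union>m\<in>{..<N}. {\<sigma>. \<sigma> permutes {..<N} \<and> \<sigma> m = j})" using s by auto
  qed auto
  have "(\<Sum>\<sigma> | \<sigma> permutes {..<N}. F \<sigma>) = (\<Sum>m<N. \<Sum>\<sigma> | \<sigma> permutes {..<N} \<and> \<sigma> m = j. F \<sigma>)"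
    unfolding eq
  proof (rule sum.UNION_disjoint)
    show "\<forall>m\<in>{..<N}. finite {\<sigma>. \<sigma> permutes {..<N} \<and> \<sigma> m = j}"
      using fin by (auto intro: finite_subset)
    show "\<forall>m\<in>{..<N}. \<forall>m'\<in>{..<N}. m \<noteq> m' \<longrightarrow>
        {\<sigma>. \<sigma> permutes {..<N} \<and> \<sigma> m = j} \<inter> {\<sigma>. \<sigma> permutes {..<N} \<and> \<sigma> m' = j} = {}"
      by (auto dest: permutes_inj simp: inj_eq)
  qed simp
  also have "\<dots> = (\<Sum>m\<in>M. \<Sum>\<sigma> | \<sigma> permutes {..<N} \<and> \<sigma> m = j. F \<sigma>)"
    using assms(3) zero by (intro sum.mono_neutral_right) (auto intro!: sum.neutral)
  also have "\<dots> = (\<Sum>m\<in>M. \<Sum>\<sigma> | \<sigma> permutes {..<N} \<and> \<sigma> c = j. F \<sigma>)"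
  proof (rule sum.cong[OF refl])
    fix m assume m: "m \<in> M"
    have mc: "m \<in> {..<N}" "c \<in> {..<N}" using m assms by auto
    have tp: "Transposition.transpose c m permutes {..<N}" by (rule permutes_swap_id) (use mc in auto)
    show "(\<Sum>\<sigma> | \<sigma> permutes {..<N} \<and> \<sigma> m = j. F \<sigma>) = (\<Sum>\<sigma> | \<sigma> permutes {..<N} \<and> \<sigma> c = j. F \<sigma>)"
      by (rule sum.reindex_bij_witness[of _ "\<lambda>\<sigma>. \<sigma> \<circ> Transposition.transpose c m" "\<lambda>\<sigma>. \<sigma> \<circ> Transposition.transpose c m"])
        (auto simp: comp_assoc intro: permutes_compose[OF tp] inv[OF _ m])
  qed
  finally show ?thesis by simp
qed

lemma bij_betw_std_index: "bij_betw (from_nat_into (UNIV :: 'n::finite set)) {..<CARD('n)} UNIV"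
  using bij_betw_from_nat_into_finite[of "UNIV :: 'n set"] by (simp add: lessThan_atLeast0)

lemma vec_expand: "(v :: real^'n::finite) = (\<Sum>i\<in>UNIV. (v $ i) *\<^sub>R axis i 1)"
  by (simp add: vec_eq_iff axis_def if_distrib cong: if_cong)

lemma std_frame_expand:
  fixes y :: "real^'n::finite"
  shows "y = (\<Sum>j<CARD('n). (y $ from_nat_into UNIV j) *\<^sub>R std_frame j)"
proof -
  have "y = (\<Sum>i\<in>UNIV. (y $ i) *\<^sub>R axis i 1)" by (rule vec_expand)
  also have "\<dots> = (\<Sum>j<CARD('n). (y $ from_nat_into UNIV j) *\<^sub>R axis (from_nat_into UNIV j) 1)"
    by (rule sum.reindex_bij_betw[OF bij_betw_std_index, symmetric])
  finally show ?thesis unfolding std_frame_def .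
qed

lemma wedge_linear_left_sum:
  "wedge k l (\<lambda>v. \<Sum>j\<in>S. c j * \<alpha> j v) \<beta> v = (\<Sum>j\<in>S. c j * wedge k l (\<alpha> j) \<beta> v)"
  unfolding wedge_def
  by (simp add: sum_distrib_left sum_distrib_right sum_divide_distrib mult_ac) (subst sum.swap, simp add: mult_ac)

lemma wedge_linear_right_sum:
  "wedge k l \<alpha> (\<lambda>v. \<Sum>j\<in>S. c j * \<beta> j v) v = (\<Sum>j\<in>S. c j * wedge k l \<alpha> (\<beta> j) v)"
  unfolding wedge_def
  by (simp add: sum_distrib_left sum_distrib_right sum_divide_distrib mult_ac) (subst sum.swap, simp add: mult_ac)

text \<open>Both sides are sums over permutations, sorted by the position of the index j. On the
  left j must lie in the block of \<beta>, otherwise \<open>e j\<close> occurs twice in \<alpha>; on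
  the right it must lie in the block of \<alpha>. Each sum reduces to the class with \<sigma> k = j,
  and the multiplicities l + 1 and k + 1 turn both denominators into k! l!. On that class the sign
  comes from moving \<open>e j\<close> from slot k of \<alpha> to the front.\<close>

lemma wedge_interior_frame:
  fixes \<alpha> \<beta> :: "'n::finite covector"
  assumes \<alpha>: "alternating (Suc k) \<alpha>" and \<beta>: "alternating (Suc l) \<beta>" and j: "j < Suc (k + l)"
  shows "wedge k (Suc l) (\<lambda>v. \<alpha> (case_nat (e j) v)) \<beta> e
       = (-1) ^ k * wedge (Suc k) l \<alpha> (\<lambda>v. \<beta> (case_nat (e j) v)) e"
proof -
  define N where "N = Suc (k + l)"
  define F1 where "F1 \<sigma> = of_int (sign \<sigma>) * \<alpha> (case_nat (e j) (\<lambda>i. e (\<sigma> i))) * \<beta> (\<lambda>i. e (\<sigma> (k + i)))" for \<sigma>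
  define F2 where "F2 \<sigma> = of_int (sign \<sigma>) * \<alpha> (\<lambda>i. e (\<sigma> i)) * \<beta> (case_nat (e j) (\<lambda>i. e (\<sigma> (Suc k + i))))" for \<sigma>
  have sg: "sign (\<sigma> \<circ> Transposition.transpose a b) = - sign \<sigma>" if "\<sigma> permutes {..<N}" "a \<noteq> b" for \<sigma> a b
  proof -
    have "permutation \<sigma>" using that(1) permutation_permutes by blast
    then show ?thesis using that(2) by (simp add: sign_compose permutation_swap_id sign_swap_id)
  qed
  have S1: "(\<Sum>\<sigma> | \<sigma> permutes {..<N}. F1 \<sigma>) = card {k..<N} * (\<Sum>\<sigma> | \<sigma> permutes {..<N} \<and> \<sigma> k = j. F1 \<sigma>)"
  proof (rule sum_permutations_orbit)
    show "j < N" "k \<in> {k..<N}" "{k..<N} \<subseteq> {..<N}" using j by (auto simp: N_def)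
  next
    fix \<sigma> m assume s: "\<sigma> permutes {..<N}" and m: "m \<in> {k..<N}"
    show "F1 (\<sigma> \<circ> Transposition.transpose k m) = F1 \<sigma>"
    proof (cases "m = k")
      case False
      have a: "\<alpha> (case_nat (e j) (\<lambda>i. e ((\<sigma> \<circ> Transposition.transpose k m) i))) = \<alpha> (case_nat (e j) (\<lambda>i. e (\<sigma> i)))"
        by (rule alternating_cong[OF \<alpha>]) (use m in \<open>auto simp: Transposition.transpose_def split: nat.split\<close>)
      \<comment> \<open>Inside the block of \<beta> the transposition of k and m acts as that of 0
        and m - k; the sign it produces cancels the change of \<open>sign \<sigma>\<close>.\<close>
      have "(\<lambda>i. e ((\<sigma> \<circ> Transposition.transpose k m) (k + i)))
         = (\<lambda>i. (\<lambda>i. e (\<sigma> (k + i))) (Transposition.transpose 0 (m - k) i))"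
        using m by (auto simp: Transposition.transpose_def fun_eq_iff)
      then have b: "\<beta> (\<lambda>i. e ((\<sigma> \<circ> Transposition.transpose k m) (k + i))) = - \<beta> (\<lambda>i. e (\<sigma> (k + i)))"
        using alternating_swap[OF \<beta>, of 0 "m - k" "\<lambda>i. e (\<sigma> (k + i))"] m False by (auto simp: N_def)
      show ?thesis unfolding F1_def a b using sg[OF s, of k m] False by simp
    qed simp
  next
    fix \<sigma> m assume s: "\<sigma> permutes {..<N}" and m: "m < N" "m \<notin> {k..<N}" "\<sigma> m = j"
    have "\<alpha> (case_nat (e j) (\<lambda>i. e (\<sigma> i))) = 0"
      by (rule alternating_repeat[OF \<alpha>, of 0 "Suc m"]) (use m in auto)
    then show "F1 \<sigma> = 0" by (simp add: F1_def)
  qed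
  have S2: "(\<Sum>\<sigma> | \<sigma> permutes {..<N}. F2 \<sigma>) = card {..<Suc k} * (\<Sum>\<sigma> | \<sigma> permutes {..<N} \<and> \<sigma> k = j. F2 \<sigma>)"
  proof (rule sum_permutations_orbit)
    show "j < N" "k \<in> {..<Suc k}" "{..<Suc k} \<subseteq> {..<N}" using j by (auto simp: N_def)
  next
    fix \<sigma> m assume s: "\<sigma> permutes {..<N}" and m: "m \<in> {..<Suc k}"
    show "F2 (\<sigma> \<circ> Transposition.transpose k m) = F2 \<sigma>"
    proof (cases "m = k")
      case False
      have b: "(\<lambda>i. e ((\<sigma> \<circ> Transposition.transpose k m) (Suc k + i))) = (\<lambda>i. e (\<sigma> (Suc k + i)))"
        using m by (auto simp: Transposition.transpose_def fun_eq_iff)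
      have a: "\<alpha> (\<lambda>i. e ((\<sigma> \<circ> Transposition.transpose k m) i)) = - \<alpha> (\<lambda>i. e (\<sigma> i))"
        using alternating_swap[OF \<alpha>, of k m "\<lambda>i. e (\<sigma> i)"] m False by simp
      show ?thesis unfolding F2_def a b using sg[OF s, of k m] False by simp
    qed simp
  next
    fix \<sigma> m assume s: "\<sigma> permutes {..<N}" and m': "m < N" "m \<notin> {..<Suc k}" and mj: "\<sigma> m = j"
    define i where "i = m - Suc k"
    have m: "m = Suc (k + i)" "i < l" using m' by (auto simp: N_def i_def)
    have "\<beta> (case_nat (e j) (\<lambda>i. e (\<sigma> (Suc k + i)))) = 0"
      by (rule alternating_repeat[OF \<beta>, of 0 "Suc i"]) (use m mj in auto)
    then show "F2 \<sigma> = 0" by (simp add: F2_def)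
  qed
  have F: "F1 \<sigma> = (-1) ^ k * F2 \<sigma>" if "\<sigma> k = j" for \<sigma>
  proof -
    have "\<alpha> (case_nat (e j) (\<lambda>i. e (\<sigma> i))) =
      \<alpha> (case_nat (e (\<sigma> k)) (\<lambda>i. if i < k then e (\<sigma> i) else e (\<sigma> (Suc i))))"
      using that by (intro alternating_cong[OF \<alpha>]) (auto split: nat.split)
    also have "\<dots> = (-1) ^ k * \<alpha> (\<lambda>i. e (\<sigma> i))"
      using alternating_move_front[OF \<alpha>, of k "\<lambda>i. e (\<sigma> i)"] by simp
    finally have a: "\<alpha> (case_nat (e j) (\<lambda>i. e (\<sigma> i))) = (-1) ^ k * \<alpha> (\<lambda>i. e (\<sigma> i))" .
    have "\<beta> (\<lambda>i. e (\<sigma> (k + i))) = \<beta> (case_nat (e j) (\<lambda>i. e (\<sigma> (Suc k + i))))"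
      using that by (intro alternating_cong[OF \<beta>]) (auto split: nat.split)
    with a show ?thesis by (simp add: F1_def F2_def)
  qed
  define X where "X = (\<Sum>\<sigma> | \<sigma> permutes {..<N} \<and> \<sigma> k = j. F2 \<sigma>)"
  have X1: "(\<Sum>\<sigma> | \<sigma> permutes {..<N} \<and> \<sigma> k = j. F1 \<sigma>) = (-1) ^ k * X"
    unfolding X_def sum_distrib_left by (rule sum.cong) (auto simp: F)
  have cN: "card {k..<N} = Suc l" by (simp add: N_def)
  have "wedge k (Suc l) (\<lambda>v. \<alpha> (case_nat (e j) v)) \<beta> e = (real (Suc l) * ((-1) ^ k * X)) / (fact k * fact (Suc l))"
    using S1[unfolded X1 cN] unfolding wedge_def F1_def N_def by simp
  also have "\<dots> = (-1) ^ k * X / (fact k * fact l)"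
    by (simp only: fact_Suc) (simp add: field_simps del: of_nat_Suc)
  finally have 1: "wedge k (Suc l) (\<lambda>v. \<alpha> (case_nat (e j) v)) \<beta> e = (-1) ^ k * X / (fact k * fact l)" .
  have "wedge (Suc k) l \<alpha> (\<lambda>v. \<beta> (case_nat (e j) v)) e = (real (Suc k) * X) / (fact (Suc k) * fact l)"
    using S2[folded X_def] unfolding wedge_def F2_def N_def by simp
  also have "\<dots> = X / (fact k * fact l)"
    by (simp only: fact_Suc) (simp add: field_simps del: of_nat_Suc)
  finally show ?thesis using 1 by simp
qed

text \<open>In degree \<open>n + 1\<close> every form vanishes, so \<open>\<iota>\<^sub>y\<close> can be moved across a wedge product.\<close>

lemma wedge_interior:
  fixes \<alpha> \<beta> :: "'n::finite covector"
  assumes \<alpha>: "alternating (Suc k) \<alpha>" and \<beta>: "alternating (Suc l) \<beta>" and n: "CARD('n) = Suc k + l"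
  shows "wedge k (Suc l) (\<lambda>v. \<alpha> (case_nat y v)) \<beta> std_frame
       = (-1) ^ k * wedge (Suc k) l \<alpha> (\<lambda>v. \<beta> (case_nat y v)) std_frame"
proof -
  define c where "c j = y $ from_nat_into UNIV j" for j
  have y: "y = (\<Sum>j<Suc (k + l). c j *\<^sub>R std_frame j)"
    unfolding c_def using std_frame_expand[of y] n by simp
  have a: "\<alpha> (case_nat y v) = (\<Sum>j<Suc (k + l). c j * \<alpha> (case_nat (std_frame j) v))" for v
    unfolding y linear_sum[OF alternating_interior_linear[OF \<alpha>]] linear_scale[OF alternating_interior_linear[OF \<alpha>]]
    by simp
  have b: "\<beta> (case_nat y v) = (\<Sum>j<Suc (k + l). c j * \<beta> (case_nat (std_frame j) v))" for v
    unfolding y linear_sum[OF alternating_interior_linear[OF \<beta>]] linear_scale[OF alternating_interior_linear[OF \<beta>]]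
    by simp
  show ?thesis
    unfolding a b wedge_linear_left_sum wedge_linear_right_sum sum_distrib_left
    by (rule sum.cong[OF refl]) (simp add: wedge_interior_frame[OF \<alpha> \<beta>])
qed

section \<open>Smooth forms and Cartan's formula\<close>

lemma frechet_derivative_eqI: "(f has_derivative f') (at x) \<Longrightarrow> frechet_derivative f (at x) = f'"
  by (rule frechet_derivative_at[symmetric])

lemma C_diff_Suc_imp: "C_diff (Suc m) f \<Longrightarrow> C_diff m f"
proof (induction m arbitrary: f)
  case 0
  then show ?case
    by (auto intro!: continuous_at_imp_continuous_on differentiable_imp_continuous_within)
next
  case (Suc m)
  then show ?case by (metis C_diff.simps(2))
qed

lemma C_diff_const: "C_diff m (\<lambda>x. c)"
  by (induction m arbitrary: c) (auto simp: frechet_derivative_eqI[OF has_derivative_const])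

lemma C_diff_add: "C_diff m f \<Longrightarrow> C_diff m g \<Longrightarrow> C_diff m (\<lambda>x. f x + g x)"
proof (induction m arbitrary: f g)
  case 0
  then show ?case by (auto intro: continuous_on_add)
next
  case (Suc m)
  then have d: "f differentiable at x" "g differentiable at x" for x by auto
  then have "frechet_derivative (\<lambda>x. f x + g x) (at x) v
    = frechet_derivative f (at x) v + frechet_derivative g (at x) v" for x v
    by (subst frechet_derivative_eqI[OF has_derivative_add])
      (auto simp: frechet_derivative_works[symmetric])
  then show ?case using Suc d by auto
qed

lemma C_diff_mult: "C_diff m f \<Longrightarrow> C_diff m g \<Longrightarrow> C_diff m (\<lambda>x. f x * g x)"
proof (induction m arbitrary: f g)
  case 0
  then show ?case by (auto intro: continuous_on_mult)
next
  case (Suc m)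
  then have d: "f differentiable at x" "g differentiable at x" for x by auto
  then have "frechet_derivative (\<lambda>x. f x * g x) (at x) v
    = f x * frechet_derivative g (at x) v + frechet_derivative f (at x) v * g x" for x v
    by (subst frechet_derivative_eqI[OF has_derivative_mult])
      (auto simp: frechet_derivative_works[symmetric])
  moreover have "C_diff m f" "C_diff m g" using Suc.prems by (auto intro: C_diff_Suc_imp)
  ultimately show ?case using Suc d by (auto intro!: C_diff_add differentiable_mult)
qed

lemma C_diff_bounded_linear: "bounded_linear f \<Longrightarrow> C_diff m f"
proof (cases m)
  case (Suc m')
  assume f: "bounded_linear f"
  then have "frechet_derivative f (at x) = f" for x
    by (intro frechet_derivative_eqI bounded_linear_imp_has_derivative)
  then show ?thesis using f Suc by (auto simp: C_diff_const intro: bounded_linear_imp_differentiable)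
qed (auto intro: linear_continuous_on)

lemma frechet_derivative_scale_arg:
  assumes "f differentiable at (c *\<^sub>R x)"
  shows "frechet_derivative (\<lambda>x. f (c *\<^sub>R x)) (at x) v = c * frechet_derivative (f :: _ \<Rightarrow> real) (at (c *\<^sub>R x)) v"
    and "(\<lambda>x. f (c *\<^sub>R x)) differentiable at x"
proof -
  let ?D = "frechet_derivative f (at (c *\<^sub>R x))"
  have D: "(f has_derivative ?D) (at (c *\<^sub>R x))"
    using assms by (simp add: frechet_derivative_works[symmetric])
  have "((\<lambda>x. f (c *\<^sub>R x)) has_derivative (\<lambda>v. ?D (c *\<^sub>R v))) (at x)"
    by (rule has_derivative_compose[of "\<lambda>x. c *\<^sub>R x" "\<lambda>v. c *\<^sub>R v" x UNIV f ?D, OF _ D]) (auto intro!: derivative_eq_intros)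
  moreover have "linear ?D" using D has_derivative_linear by blast
  ultimately show "frechet_derivative (\<lambda>x. f (c *\<^sub>R x)) (at x) v = c * ?D v"
    and "(\<lambda>x. f (c *\<^sub>R x)) differentiable at x"
    by (auto simp: frechet_derivative_eqI linear_scale differentiable_def)
qed

lemma C_diff_scale_arg: "C_diff m f \<Longrightarrow> C_diff m (\<lambda>x. f (c *\<^sub>R x))"
proof (induction m arbitrary: f)
  case 0
  then show ?case
    by (auto intro!: continuous_on_compose2[of UNIV f] continuous_intros)
next
  case (Suc m)
  then show ?case
    by (auto simp: frechet_derivative_scale_arg intro!: C_diff_mult C_diff_const)
qed

lemma smooth_const: "smooth (\<lambda>x. c)"
  and smooth_add: "smooth f \<Longrightarrow> smooth g \<Longrightarrow> smooth (\<lambda>x. f x + g x)"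
  and smooth_mult: "smooth f \<Longrightarrow> smooth g \<Longrightarrow> smooth (\<lambda>x. f x * g x)"
  and smooth_bounded_linear: "bounded_linear f \<Longrightarrow> smooth f"
  and smooth_scale_arg: "smooth f \<Longrightarrow> smooth (\<lambda>x. f (c *\<^sub>R x))"
  unfolding smooth_def
  by (auto intro: C_diff_const C_diff_add C_diff_mult C_diff_bounded_linear C_diff_scale_arg)

lemma smooth_sum: "finite S \<Longrightarrow> (\<And>i. i \<in> S \<Longrightarrow> smooth (f i)) \<Longrightarrow> smooth (\<lambda>x. \<Sum>i\<in>S. f i x)"
  by (induction S rule: finite_induct) (auto intro: smooth_const smooth_add)

lemma smooth_continuous: "smooth f \<Longrightarrow> continuous_on UNIV f"
  unfolding smooth_def using C_diff.simps(1) by blast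

lemma smooth_differentiable: "smooth f \<Longrightarrow> f differentiable at x"
  unfolding smooth_def using C_diff.simps(2) by blast

lemma smooth_has_derivative: "smooth f \<Longrightarrow> (f has_derivative frechet_derivative f (at x)) (at x)"
  using smooth_differentiable frechet_derivative_works by blast

lemma smooth_derivative: "smooth f \<Longrightarrow> smooth (\<lambda>x. frechet_derivative f (at x) v)"
  unfolding smooth_def using C_diff.simps(2) by blast

lemma smooth_nth: "smooth (\<lambda>x. x $ i)"
  by (rule smooth_bounded_linear) (rule bounded_linear_vec_nth)

lemma case_nat_expand:
  fixes \<alpha> :: "'n::finite covector"
  assumes "alternating (Suc k) \<alpha>"
  shows "\<alpha> (case_nat y v) = (\<Sum>i\<in>UNIV. y $ i * \<alpha> (case_nat (axis i 1) v))"
proof -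
  note lin = alternating_interior_linear[OF assms, of v]
  have "y = (\<Sum>i\<in>UNIV. (y $ i) *\<^sub>R axis i 1)" by (rule vec_expand)
  then have "\<alpha> (case_nat y v) = \<alpha> (case_nat (\<Sum>i\<in>UNIV. (y $ i) *\<^sub>R axis i 1) v)" by simp
  then show ?thesis by (simp add: linear_sum[OF lin] linear_scale[OF lin])
qed

text \<open>The point x enters twice, through the coefficients and as the inserted vector. Expanding
  the latter in coordinates leaves a finite sum of products of smooth functions.\<close>

lemma smooth_interior:
  fixes \<omega> :: "'n::finite form"
  assumes "\<And>x. alternating (Suc l) (\<omega> x)" "\<And>v. smooth (\<lambda>x. \<omega> x v)"
  shows "smooth (\<lambda>x. \<omega> x (case_nat x v))"
  by (subst case_nat_expand[OF assms(1)])
    (intro smooth_sum smooth_mult smooth_nth assms, simp)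

lemma test_form_interior:
  assumes "test_form (Suc l) \<omega>"
  shows "test_form l (\<lambda>x v. \<omega> x (case_nat x v))"
proof -
  from assms obtain K where "compact K" "\<forall>x. x \<notin> K \<longrightarrow> \<omega> x = (\<lambda>v. 0)"
    unfolding test_form_def by blast
  then show ?thesis
    using assms unfolding test_form_def
    by (auto intro: alternating_interior smooth_interior intro!: exI[of _ K])
qed

text \<open>Only the coefficients are dilated. This is not the pullback, whose additional factor c^l
  is carried separately where it is needed.\<close>

lemma test_form_scale_arg:
  assumes "test_form l \<omega>" "c \<noteq> 0"
  shows "test_form l (\<lambda>x. \<omega> (c *\<^sub>R x))"
proof -
  from assms obtain K where K: "compact K" "\<And>x. x \<notin> K \<Longrightarrow> \<omega> x = (\<lambda>v. 0)"
    unfolding test_form_def by blast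
  have "compact ((\<lambda>x. inverse c *\<^sub>R x) ` K)" using K(1) by (rule compact_scaling)
  moreover have "\<omega> (c *\<^sub>R x) = (\<lambda>v. 0)" if "x \<notin> (\<lambda>x. inverse c *\<^sub>R x) ` K" for x
  proof (rule K(2))
    show "c *\<^sub>R x \<notin> K"
      using that assms(2) by (auto simp: image_iff)
  qed
  ultimately show ?thesis
    using assms unfolding test_form_def
    by (auto intro: smooth_scale_arg[where f="\<lambda>x. \<omega> x v" for v])
qed

lemma ext_deriv_scale_arg:
  assumes "\<And>v. smooth (\<lambda>x. \<omega> x v)"
  shows "ext_deriv l (\<lambda>x. \<omega> (c *\<^sub>R x)) x v = c * ext_deriv l \<omega> (c *\<^sub>R x) v"
  unfolding ext_deriv_def sum_distrib_left
  by (intro sum.cong refl, subst frechet_derivative_scale_arg(1)[where f="\<lambda>x. \<omega> x w" for w])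
    (auto intro: smooth_differentiable[OF assms])

text \<open>The conditions on an alternating form are linear in the coefficient functions, hence
  they pass to the derivative in a fixed direction h.\<close>

lemma alternating_frechet_derivative:
  fixes \<omega> :: "'n::finite form"
  assumes "\<And>x. alternating k (\<omega> x)" "\<And>v. smooth (\<lambda>x. \<omega> x v)"
  shows "alternating k (\<lambda>v. frechet_derivative (\<lambda>y. \<omega> y v) (at x) h)"
proof -
  note der = smooth_has_derivative[OF assms(2)]
  show ?thesis
    unfolding alternating_def
  proof (intro conjI allI impI)
    fix v w :: "nat \<Rightarrow> real^'n" assume "\<forall>i<k. v i = w i"
    then have "\<omega> y v = \<omega> y w" for y using alternating_cong[OF assms(1)] by metis
    then show "frechet_derivative (\<lambda>y. \<omega> y v) (at x) h = frechet_derivative (\<lambda>y. \<omega> y w) (at x) h" by simp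
  next
    fix v :: "nat \<Rightarrow> real^'n" and i assume "i < k"
    then have lin: "linear (\<lambda>a. \<omega> y (v(i := a)))" for y using alternating_linear[OF assms(1)] by blast
    show "linear (\<lambda>a. frechet_derivative (\<lambda>y. \<omega> y (v(i := a))) (at x) h)"
    proof (rule linearI)
      fix a b :: "real^'n" and r :: real
      have "(\<lambda>y. \<omega> y (v(i := a + b))) = (\<lambda>y. \<omega> y (v(i := a)) + \<omega> y (v(i := b)))"
        using linear_add[OF lin] by blast
      then show "frechet_derivative (\<lambda>y. \<omega> y (v(i := a + b))) (at x) h =
          frechet_derivative (\<lambda>y. \<omega> y (v(i := a))) (at x) h + frechet_derivative (\<lambda>y. \<omega> y (v(i := b))) (at x) h"
        by (simp add: frechet_derivative_eqI[OF has_derivative_add[OF der der]])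
      have "(\<lambda>y. \<omega> y (v(i := r *\<^sub>R a))) = (\<lambda>y. r * \<omega> y (v(i := a)))"
        using linear_scale[OF lin] by auto
      then show "frechet_derivative (\<lambda>y. \<omega> y (v(i := r *\<^sub>R a))) (at x) h =
          r *\<^sub>R frechet_derivative (\<lambda>y. \<omega> y (v(i := a))) (at x) h"
        by (simp add: frechet_derivative_eqI[OF has_derivative_mult_right[OF der]])
    qed
  next
    fix v :: "nat \<Rightarrow> real^'n" and i j assume "i < j \<and> j < k \<and> v i = v j"
    then have "(\<lambda>y. \<omega> y v) = (\<lambda>y. 0)" using assms(1) unfolding alternating_def by blast
    then show "frechet_derivative (\<lambda>y. \<omega> y v) (at x) h = 0"
      by (simp add: frechet_derivative_eqI[OF has_derivative_const])
  qed
qed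

text \<open>The sum in \<open>ext_deriv\<close> is not visibly alternating. If the entries a < b
  coincide, each term that deletes another entry keeps the repetition and vanishes, and the two
  terms that delete a or b cancel.\<close>

lemma alternating_ext_deriv:
  fixes \<omega> :: "'n::finite form"
  assumes "\<And>x. alternating k (\<omega> x)" "\<And>v. smooth (\<lambda>x. \<omega> x v)"
  shows "alternating (Suc k) (ext_deriv k \<omega> x)"
proof -
  define sk where "sk i v = (\<lambda>j. if j < i then v j else v (Suc j))" for i and v :: "nat \<Rightarrow> real^'n"
  define D where "D h v = frechet_derivative (\<lambda>y. \<omega> y v) (at x) h" for h v
  have altD: "alternating k (D h)" for h
    unfolding D_def by (rule alternating_frechet_derivative[OF assms])
  have linD: "linear (\<lambda>h. D h v)" for v
    unfolding D_def using smooth_has_derivative[OF assms(2)] has_derivative_linear by blast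
  have ext: "ext_deriv k \<omega> x v = (\<Sum>i\<le>k. (-1) ^ i * D (v i) (sk i v))" for v
    unfolding ext_deriv_def D_def sk_def ..
  show ?thesis
    unfolding alternating_def ext
  proof (intro conjI allI impI)
    fix v w :: "nat \<Rightarrow> real^'n" assume vw: "\<forall>i<Suc k. v i = w i"
    have "D (v i) (sk i v) = D (w i) (sk i w)" if "i \<le> k" for i
    proof -
      have "D (v i) (sk i v) = D (v i) (sk i w)"
        by (rule alternating_cong[OF altD]) (use vw in \<open>auto simp: sk_def\<close>)
      then show ?thesis using vw that by simp
    qed
    then show "(\<Sum>i\<le>k. (-1) ^ i * D (v i) (sk i v)) = (\<Sum>i\<le>k. (-1) ^ i * D (w i) (sk i w))" by simp
  next
    fix v :: "nat \<Rightarrow> real^'n" and m assume m: "m < Suc k"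
    have "linear (\<lambda>a. D ((v(m := a)) i) (sk i (v(m := a))))" if i: "i \<le> k" for i
    proof (cases "i = m")
      case True
      then have "sk i (v(m := a)) = sk i v" for a by (auto simp: sk_def)
      then show ?thesis using linD True by simp
    next
      case False
      \<comment> \<open>Deleting entry i moves all later entries down by one.\<close>
      define m' where "m' = (if m < i then m else m - 1)"
      have "sk i (v(m := a)) = (sk i v)(m' := a)" for a
        using False by (auto simp: sk_def m'_def fun_eq_iff)
      moreover have "m' < k" using m i False by (auto simp: m'_def)
      ultimately show ?thesis using alternating_linear[OF altD] False by simp
    qed
    then show "linear (\<lambda>a. \<Sum>i\<le>k. (-1) ^ i * D ((v(m := a)) i) (sk i (v(m := a))))"
      by (intro linear_compose_sum ballI linear_compose_scale_right[where 'b=real, unfolded real_scaleR_def]) auto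
  next
    fix v :: "nat \<Rightarrow> real^'n" and a b assume ab: "a < b \<and> b < Suc k \<and> v a = v b"
    have 0: "D (v i) (sk i v) = 0" if i: "i \<le> k" "i \<noteq> a" "i \<noteq> b" for i
    proof (rule alternating_repeat[OF altD])
      let ?a = "if a < i then a else a - 1" and ?b = "if b < i then b else b - 1"
      show "?a < k" "?b < k" "?a \<noteq> ?b" "sk i v ?a = sk i v ?b"
        using ab i by (auto simp: sk_def)
    qed
    have "(\<Sum>i\<le>k. (-1) ^ i * D (v i) (sk i v)) = (\<Sum>i\<in>{a, b}. (-1) ^ i * D (v i) (sk i v))"
      by (rule sum.mono_neutral_right) (use ab 0 in auto)
    also have "\<dots> = (-1) ^ a * D (v a) (sk a v) + (-1) ^ b * D (v a) (sk b v)"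
      using ab by simp
    also have "\<dots> = 0"
    proof -
      define h where "h = v a"
      have nb: "(-1::real) ^ b = - ((-1) ^ (b - 1))" using ab by (cases b) auto
      have mf: "D h (case_nat (w i) (sk i w)) = (-1) ^ i * D h w" if "i < k" for i w
        unfolding sk_def by (rule alternating_move_front[OF altD that])
      \<comment> \<open>Deleting both entries leaves the same tuple in either order. The surviving
        copy of h sits at b - 1 once a is deleted and at a once b is deleted; moving it to the front
        in both tuples shows that the two terms are opposite.\<close>
      have "sk (b - 1) (sk a v) = sk a (sk b v)"
        using ab by (auto simp: sk_def fun_eq_iff)
      moreover have "sk a v (b - 1) = h" "sk b v a = h" using ab by (auto simp: sk_def h_def)
      moreover have "D h (case_nat (sk a v (b - 1)) (sk (b - 1) (sk a v))) = (-1) ^ (b - 1) * D h (sk a v)"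
        by (rule mf) (use ab in linarith)
      moreover have "D h (case_nat (sk b v a) (sk a (sk b v))) = (-1) ^ a * D h (sk b v)"
        by (rule mf) (use ab in simp)
      ultimately have eq: "(-1) ^ (b - 1) * D h (sk a v) = (-1) ^ a * D h (sk b v)" by simp
      have "(-1) ^ a * D h (sk a v) + (-1) ^ b * D h (sk b v)
        = (-1) ^ a * ((-1) ^ (b - 1) * ((-1) ^ (b - 1) * D h (sk a v))) - (-1) ^ (b - 1) * D h (sk b v)"
        using nb by (simp flip: power_add mult.assoc mult_2)
      also have "\<dots> = ((-1) ^ a * (-1) ^ a) * (-1) ^ (b - 1) * D h (sk b v) - (-1) ^ (b - 1) * D h (sk b v)"
        unfolding eq by (simp add: mult_ac)
      also have "\<dots> = 0" by (simp flip: power_add mult_2)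
      finally show ?thesis unfolding h_def .
    qed
    finally show "(\<Sum>i\<le>k. (-1) ^ i * D (v i) (sk i v)) = 0" .
  qed
qed

text \<open>Cartan's formula \<open>d \<iota>\<^sub>E \<omega> + \<iota>\<^sub>E d \<omega> = L\<^sub>E \<omega>\<close> for the Euler field \<open>E\<^sub>x = x\<close>.\<close>

lemma cartan_euler:
  fixes \<omega> :: "'n::finite form"
  assumes alt: "\<And>x. alternating (Suc l) (\<omega> x)" and sm: "\<And>v. smooth (\<lambda>x. \<omega> x v)"
  shows "ext_deriv l (\<lambda>x v. \<omega> x (case_nat x v)) x v + ext_deriv (Suc l) \<omega> x (case_nat x v)
       = real (Suc l) * \<omega> x v + frechet_derivative (\<lambda>y. \<omega> y v) (at x) x"
proof -
  define sk where "sk i v = (\<lambda>j. if j < i then v j else v (Suc j))" for i and v :: "nat \<Rightarrow> real^'n"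
  \<comment> \<open>Product rule: y occurs both as the base point and as the inserted
    vector.\<close>
  have prod: "frechet_derivative (\<lambda>y. \<omega> y (case_nat y w)) (at x) h =
      frechet_derivative (\<lambda>y. \<omega> y (case_nat x w)) (at x) h + \<omega> x (case_nat h w)" for w h
  proof -
    let ?D = "\<lambda>i. frechet_derivative (\<lambda>y. \<omega> y (case_nat (axis i 1) w)) (at x)"
    note der = smooth_has_derivative[OF sm]
    have 1: "((\<lambda>y. \<Sum>i\<in>UNIV. y $ i * \<omega> y (case_nat (axis i 1) w)) has_derivative
        (\<lambda>h. \<Sum>i\<in>UNIV. x $ i * ?D i h + h $ i * \<omega> x (case_nat (axis i 1) w))) (at x)"
      by (intro has_derivative_sum has_derivative_mult der
        bounded_linear_imp_has_derivative[OF bounded_linear_vec_nth])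
    have 2: "((\<lambda>y. \<Sum>i\<in>UNIV. x $ i * \<omega> y (case_nat (axis i 1) w)) has_derivative
        (\<lambda>h. \<Sum>i\<in>UNIV. x $ i * ?D i h)) (at x)"
      by (intro has_derivative_sum has_derivative_mult_right der)
    have e: "(\<lambda>y. \<omega> y (case_nat y w)) = (\<lambda>y. \<Sum>i\<in>UNIV. y $ i * \<omega> y (case_nat (axis i 1) w))"
      "(\<lambda>y. \<omega> y (case_nat x w)) = (\<lambda>y. \<Sum>i\<in>UNIV. x $ i * \<omega> y (case_nat (axis i 1) w))"
      using case_nat_expand[OF alt] by blast+
    show ?thesis
      unfolding e frechet_derivative_eqI[OF 1] frechet_derivative_eqI[OF 2]
      by (subst (2) case_nat_expand[OF alt]) (simp add: sum.distrib)
  qed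
  have s0: "sk 0 (case_nat x v) = v" by (simp add: sk_def)
  have sS: "sk (Suc i) (case_nat x v) = case_nat x (sk i v)" for i
    by (auto simp: sk_def fun_eq_iff split: nat.split)
  \<comment> \<open>When the derivative falls on the inserted vector, each index i \<le> l yields
    one copy of \<omega> x v. This is the origin of the factor l + 1.\<close>
  have front: "(-1) ^ i * \<omega> x (case_nat (v i) (sk i v)) = \<omega> x v" if "i \<le> l" for i
    using alternating_move_front[OF alt, of i x v] that unfolding sk_def
    by (simp flip: power_add mult_2 mult.assoc)
  have "ext_deriv (Suc l) \<omega> x (case_nat x v) =
    (\<Sum>i\<le>Suc l. (-1) ^ i * frechet_derivative (\<lambda>y. \<omega> y (sk i (case_nat x v))) (at x) (case_nat x v i))"
    unfolding ext_deriv_def sk_def ..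
  \<comment> \<open>Index 0 differentiates along x itself. The other indices are the negatives of
    the derivative terms in d \<iota> \<omega> and cancel them.\<close>
  also have "\<dots> = frechet_derivative (\<lambda>y. \<omega> y v) (at x) x -
     (\<Sum>i\<le>l. (-1) ^ i * frechet_derivative (\<lambda>y. \<omega> y (case_nat x (sk i v))) (at x) (v i))"
    by (subst sum.atMost_Suc_shift) (simp add: s0 sS sum_negf)
  finally have 1: "ext_deriv (Suc l) \<omega> x (case_nat x v) = \<dots>" .
  have "ext_deriv l (\<lambda>x v. \<omega> x (case_nat x v)) x v =
    (\<Sum>i\<le>l. (-1) ^ i * (frechet_derivative (\<lambda>y. \<omega> y (case_nat x (sk i v))) (at x) (v i)
       + \<omega> x (case_nat (v i) (sk i v))))"
    unfolding ext_deriv_def prod[symmetric] sk_def ..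
  also have "\<dots> = (\<Sum>i\<le>l. (-1) ^ i * frechet_derivative (\<lambda>y. \<omega> y (case_nat x (sk i v))) (at x) (v i))
      + (\<Sum>i\<le>l. (-1) ^ i * \<omega> x (case_nat (v i) (sk i v)))"
    by (simp add: distrib_left sum.distrib)
  also have "(\<Sum>i\<le>l. (-1) ^ i * \<omega> x (case_nat (v i) (sk i v))) = (\<Sum>i\<le>l. \<omega> x v)"
    by (rule sum.cong) (auto simp: front)
  finally show ?thesis using 1 by simp
qed

section \<open>Pointwise norms\<close>

text \<open>Gram-Schmidt for b: as long as m is below the dimension, some vector lies outside the
  span of the first m; its projection is subtracted and the remainder normalised. At the end the
  numbered vectors are indexed by the coordinate type.\<close>

lemma orthonormal_frame_exists:
  fixes b :: "real^'n::finite \<Rightarrow> real^'n \<Rightarrow> real"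
  assumes bil: "bilinear b" and sym: "\<And>v w. b v w = b w v" and pos: "\<And>v. v \<noteq> 0 \<Longrightarrow> b v v > 0"
  obtains u :: "'n \<Rightarrow> real^'n" where "\<And>i j. b (u i) (u j) = (if i = j then 1 else 0)"
proof -
  have "\<exists>v :: nat \<Rightarrow> real^'n. \<forall>i<m. \<forall>j<m. b (v i) (v j) = (if i = j then 1 else 0)" if "m \<le> CARD('n)" for m
    using that
  proof (induction m)
    case (Suc m)
    then obtain v :: "nat \<Rightarrow> real^'n" where v: "\<And>i j. i < m \<Longrightarrow> j < m \<Longrightarrow> b (v i) (v j) = (if i = j then 1 else 0)"
      by auto
    have "dim (span (v ` {..<m})) \<le> card (v ` {..<m})" by (simp add: dim_le_card')
    also have "\<dots> \<le> m" using card_image_le[of "{..<m}" v] by simp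
    also have "\<dots> < CARD('n)" using Suc.prems by simp
    finally have dlt: "dim (span (v ` {..<m})) < CARD('n)" .
    have "span (v ` {..<m}) \<noteq> UNIV"
    proof
      assume "span (v ` {..<m}) = UNIV"
      then have "dim (span (v ` {..<m})) = CARD('n)" by (simp only:) simp
      with dlt show False by linarith
    qed
    then obtain w where w: "w \<notin> span (v ` {..<m})" by auto
    define w' where "w' = w - (\<Sum>i<m. b w (v i) *\<^sub>R v i)"
    have "(\<Sum>i<m. b w (v i) *\<^sub>R v i) \<in> span (v ` {..<m})"
      by (intro span_sum span_scale span_base) auto
    then have "w' \<noteq> 0" using w by (auto simp: w'_def)
    then have pw: "b w' w' > 0" by (rule pos)
    have linl: "linear (\<lambda>x. b x z)" and linr: "linear (\<lambda>x. b z x)" for z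
      using bil unfolding bilinear_def by auto
    have orth: "b w' (v j) = 0" if j: "j < m" for j
    proof -
      have "b w' (v j) = b w (v j) - (\<Sum>i<m. b w (v i) * b (v i) (v j))"
        unfolding w'_def by (simp add: linear_diff[OF linl] linear_sum[OF linl] linear_scale[OF linl])
      also have "(\<Sum>i<m. b w (v i) * b (v i) (v j)) = (\<Sum>i<m. if i = j then b w (v i) else 0)"
        by (rule sum.cong) (auto simp: v j)
      finally show ?thesis using j by simp
    qed
    define u where "u = v(m := (1 / sqrt (b w' w')) *\<^sub>R w')"
    have "b (u i) (u j) = (if i = j then 1 else 0)" if "i < Suc m" "j < Suc m" for i j
    proof -
      have [simp]: "b (v i) w' = 0" if "i < m" for i using orth[OF that] sym[of w' "v i"] by simp
      have "b w' w' / (sqrt (b w' w') * sqrt (b w' w')) = 1" using pw by simp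
      then show ?thesis
        using that by (cases "i = m"; cases "j = m")
          (simp_all add: u_def v bilinear_lmul[OF bil] bilinear_rmul[OF bil] orth)
    qed
    then show ?case by blast
  qed simp
  from this[of "CARD('n)"] obtain v :: "nat \<Rightarrow> real^'n"
    where v: "\<And>i j. i < CARD('n) \<Longrightarrow> j < CARD('n) \<Longrightarrow> b (v i) (v j) = (if i = j then 1 else 0)" by auto
  obtain h where h: "bij_betw h (UNIV :: 'n set) {0..<CARD('n)}"
    using ex_bij_betw_finite_nat[of "UNIV :: 'n set"] by auto
  then have "h i < CARD('n)" "h i = h j \<longleftrightarrow> i = j" for i j
    by (auto simp: bij_betw_def inj_eq)
  then show ?thesis using that[of "v \<circ> h"] v by auto
qed

section \<open>Orthonormal frames of the metric\<close>

definition metric_frame :: "'n::finite metric \<Rightarrow> real^'n \<Rightarrow> ('n \<Rightarrow> real^'n) \<Rightarrow> bool" where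
  "metric_frame g x u \<longleftrightarrow> (\<forall>i j. g x (u i) (u j) = (if i = j then 1 else 0))"

lemma riemannian_metricD:
  assumes "riemannian_metric g"
  shows "bilinear (g x)" "g x v w = g x w v" "v \<noteq> 0 \<Longrightarrow> g x v v > 0" "smooth (\<lambda>x. g x v w)"
  using assms unfolding riemannian_metric_def by auto

lemma metric_frame_exists:
  assumes "riemannian_metric g"
  obtains u where "metric_frame g x u"
  using orthonormal_frame_exists[of "g x"] riemannian_metricD[OF assms] unfolding metric_frame_def by metis

lemma metric_expand:
  assumes "riemannian_metric g"
  shows "g x v w = (\<Sum>i\<in>UNIV. \<Sum>j\<in>UNIV. v $ i * w $ j * gram g x $ i $ j)"
proof -
  have linl: "linear (\<lambda>v. g x v z)" and linr: "linear (\<lambda>v. g x z v)" for z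
    using riemannian_metricD(1)[OF assms, of x] unfolding bilinear_def by auto
  have "g x v w = g x (\<Sum>i\<in>UNIV. (v $ i) *\<^sub>R axis i 1) (\<Sum>i\<in>UNIV. (w $ i) *\<^sub>R axis i 1)"
    by (rule arg_cong2[OF vec_expand vec_expand])
  then show ?thesis
    by (subst sum.swap) (simp add: linear_sum[OF linl] linear_sum[OF linr] linear_scale[OF linl] linear_scale[OF linr]
      gram_def sum_distrib_left mult_ac)
qed

text \<open>With the frame vectors as columns of U, orthonormality reads U^T G U = 1 for the Gram
  matrix G. So the inverse of G, which enters \<open>covector_norm\<close>, is U U^T, and det G,
  which enters the volume, is the inverse square of det U.\<close>

lemma metric_frame_matrix:
  fixes g :: "'n::finite metric"
  assumes g: "riemannian_metric g" and u: "metric_frame g x u"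
  defines "U \<equiv> (\<chi> i m. u m $ i) :: real^'n^'n"
  shows "U ** (transpose U ** gram g x) = mat 1"
    and "matrix_inv (gram g x) = U ** transpose U"
    and "(det U)\<^sup>2 * det (gram g x) = 1"
proof -
  have "(transpose U ** gram g x) ** U = mat 1"
  proof (simp add: vec_eq_iff, intro allI)
    fix a b
    have "((transpose U ** gram g x) ** U) $ a $ b = (\<Sum>j\<in>UNIV. (\<Sum>i\<in>UNIV. u a $ i * gram g x $ i $ j) * u b $ j)"
      unfolding U_def matrix_matrix_mult_def transpose_def by simp
    also have "\<dots> = g x (u a) (u b)"
      unfolding metric_expand[OF g, of x "u a" "u b"]
      by (subst sum.swap) (simp add: sum_distrib_right sum_distrib_left mult_ac)
    finally show "((transpose U ** gram g x) ** U) $ a $ b = (mat 1 :: real^'n^'n) $ a $ b"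
      using u by (simp add: metric_frame_def mat_def)
  qed
  then show 1: "U ** (transpose U ** gram g x) = mat 1"
    using matrix_left_right_inverse by blast
  then have L: "(U ** transpose U) ** gram g x = mat 1" by (simp add: matrix_mul_assoc)
  then have R: "gram g x ** (U ** transpose U) = mat 1" using matrix_left_right_inverse by blast
  have "gram g x ** matrix_inv (gram g x) = mat 1"
    unfolding matrix_inv_def using someI[of "\<lambda>B. gram g x ** B = mat 1 \<and> B ** gram g x = mat 1"] L R by blast
  then show "matrix_inv (gram g x) = U ** transpose U"
    by (metis L matrix_mul_assoc matrix_mul_lid matrix_mul_rid)
  show "(det U)\<^sup>2 * det (gram g x) = 1"
    using arg_cong[OF L, of det] by (simp add: det_mul power2_eq_square mult_ac)
qed

lemma det_gram_pos:
  assumes "riemannian_metric g"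
  shows "det (gram g x) > 0"
proof -
  obtain u where "metric_frame g x u" using metric_frame_exists[OF assms] .
  from metric_frame_matrix(3)[OF assms this] show ?thesis
    by (metis zero_less_mult_pos zero_less_one zero_le_power2 less_eq_real_def mult_zero_left zero_neq_one)
qed

lemma metric_frame_expand:
  fixes g :: "'n::finite metric"
  assumes g: "riemannian_metric g" and u: "metric_frame g x u"
  shows "v = (\<Sum>m\<in>UNIV. g x v (u m) *\<^sub>R u m)"
proof -
  define U where "U = ((\<chi> i m. u m $ i) :: real^'n^'n)"
  have gv: "g x v (u m) = ((transpose U ** gram g x) *v v) $ m" for m
  proof -
    have "((transpose U ** gram g x) *v v) $ m = (\<Sum>j\<in>UNIV. (\<Sum>i\<in>UNIV. u m $ i * gram g x $ i $ j) * v $ j)"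
      unfolding U_def matrix_matrix_mult_def matrix_vector_mult_def transpose_def by simp
    also have "\<dots> = g x (u m) v"
      unfolding metric_expand[OF g, of x "u m" v]
      by (subst sum.swap) (simp add: sum_distrib_right sum_distrib_left mult_ac)
    finally show ?thesis using riemannian_metricD(2)[OF g] by metis
  qed
  have "v = (U ** (transpose U ** gram g x)) *v v"
    unfolding U_def metric_frame_matrix(1)[OF assms] by simp
  also have "\<dots> = U *v ((transpose U ** gram g x) *v v)"
    by (simp add: matrix_vector_mul_assoc)
  also have "\<dots> = (\<Sum>m\<in>UNIV. g x v (u m) *\<^sub>R u m)"
    unfolding gv by (simp add: vec_eq_iff matrix_vector_mult_def U_def mult.commute)
  finally show ?thesis .
qed

text \<open>Parseval's identity: g x v v is the sum of the squares of the coefficients of v in the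
  frame.\<close>

lemma metric_frame_coeff:
  fixes g :: "'n::finite metric"
  assumes g: "riemannian_metric g" and u: "metric_frame g x u"
  shows "\<bar>g x v (u m)\<bar> \<le> sqrt (g x v v)"
proof -
  have linl: "linear (\<lambda>v. g x v z)" and linr: "linear (\<lambda>v. g x z v)" for z
    using riemannian_metricD(1)[OF g, of x] unfolding bilinear_def by auto
  have "g x v v = g x v (\<Sum>m\<in>UNIV. g x v (u m) *\<^sub>R u m)"
    using metric_frame_expand[OF assms] by metis
  also have "\<dots> = (\<Sum>m\<in>UNIV. (g x v (u m))\<^sup>2)"
    by (simp add: linear_sum[OF linr] linear_scale[OF linr] power2_eq_square)
  finally have "(g x v (u m))\<^sup>2 \<le> g x v v"
    using member_le_sum[of m UNIV "\<lambda>m. (g x v (u m))\<^sup>2"] by simp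
  then show ?thesis using real_le_rsqrt by (simp add: real_le_rsqrt)
qed

text \<open>Writing every entry of the inverse Gram matrix as a sum over the frame and exchanging
  product and sum turns the double sum over axes into a sum of squares. The norm can then be
  estimated in a frame adapted to the point.\<close>

lemma covector_norm_frame:
  fixes g :: "'n::finite metric"
  assumes g: "riemannian_metric g" and u: "metric_frame g x u" and \<alpha>: "alternating k \<alpha>"
  shows "covector_norm g k x \<alpha> = L2_set (\<lambda>M. \<alpha> (\<lambda>a. u (M a))) ({..<k} \<rightarrow>\<^sub>E UNIV) / sqrt (fact k)"
proof -
  let ?P = "{..<k} \<rightarrow>\<^sub>E (UNIV :: 'n set)"
  have inv: "matrix_inv (gram g x) $ i $ j = (\<Sum>m\<in>UNIV. u m $ i * u m $ j)" for i j
    unfolding metric_frame_matrix(2)[OF g u] by (simp add: matrix_matrix_mult_def transpose_def)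
  have ex: "\<alpha> (\<lambda>a. u (M a)) = (\<Sum>I\<in>?P. (\<Prod>a<k. u (M a) $ I a) * \<alpha> (\<lambda>a. axis (I a) 1))" for M
    by (rule alternating_expand[OF \<alpha>]) (auto intro: vec_expand)
  have "(\<Sum>I\<in>?P. \<Sum>J\<in>?P. (\<Prod>a<k. matrix_inv (gram g x) $ I a $ J a) * \<alpha> (\<lambda>a. axis (I a) 1) * \<alpha> (\<lambda>a. axis (J a) 1))
     = (\<Sum>I\<in>?P. \<Sum>J\<in>?P. \<Sum>M\<in>?P. (\<Prod>a<k. u (M a) $ I a) * (\<Prod>a<k. u (M a) $ J a) * \<alpha> (\<lambda>a. axis (I a) 1) * \<alpha> (\<lambda>a. axis (J a) 1))"
    by (simp add: inv prod_sum_PiE sum_distrib_right prod.distrib)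
  also have "\<dots> = (\<Sum>I\<in>?P. \<Sum>M\<in>?P. \<Sum>J\<in>?P. (\<Prod>a<k. u (M a) $ I a) * (\<Prod>a<k. u (M a) $ J a) * \<alpha> (\<lambda>a. axis (I a) 1) * \<alpha> (\<lambda>a. axis (J a) 1))"
    by (rule sum.cong[OF refl], rule sum.swap)
  also have "\<dots> = (\<Sum>M\<in>?P. \<Sum>I\<in>?P. \<Sum>J\<in>?P. (\<Prod>a<k. u (M a) $ I a) * (\<Prod>a<k. u (M a) $ J a) * \<alpha> (\<lambda>a. axis (I a) 1) * \<alpha> (\<lambda>a. axis (J a) 1))"
    by (rule sum.swap)
  also have "\<dots> = (\<Sum>M\<in>?P. (\<alpha> (\<lambda>a. u (M a)))\<^sup>2)"
    unfolding ex power2_eq_square sum_product by (simp add: mult_ac)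
  finally show ?thesis
    unfolding covector_norm_def L2_set_def by (simp add: real_sqrt_divide)
qed

lemma covector_norm_nonneg: "riemannian_metric g \<Longrightarrow> alternating k \<alpha> \<Longrightarrow> 0 \<le> covector_norm g k x \<alpha>"
  by (metis covector_norm_frame metric_frame_exists L2_set_nonneg divide_nonneg_nonneg fact_ge_zero real_sqrt_ge_zero)

lemma covector_norm_triangle:
  assumes g: "riemannian_metric g" and "alternating k \<alpha>" "alternating k \<beta>"
  shows "covector_norm g k x (\<lambda>v. \<alpha> v + c * \<beta> v) \<le> covector_norm g k x \<alpha> + \<bar>c\<bar> * covector_norm g k x \<beta>"
proof -
  obtain u where u: "metric_frame g x u" using metric_frame_exists[OF g] .
  have s: "alternating k (\<lambda>v. \<alpha> v + c * \<beta> v)"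
    using alternating_linear_combination[OF assms(2,3), of 1 c] by simp
  let ?P = "{..<k} \<rightarrow>\<^sub>E UNIV"
  have "L2_set (\<lambda>M. c * \<beta> (\<lambda>a. u (M a))) ?P = \<bar>c\<bar> * L2_set (\<lambda>M. \<beta> (\<lambda>a. u (M a))) ?P"
    unfolding L2_set_def by (simp add: power_mult_distrib real_sqrt_mult flip: sum_distrib_left)
  then show ?thesis
    unfolding covector_norm_frame[OF g u assms(2)] covector_norm_frame[OF g u assms(3)] covector_norm_frame[OF g u s]
    using L2_set_triangle_ineq[of "\<lambda>M. \<alpha> (\<lambda>a. u (M a))" "\<lambda>M. c * \<beta> (\<lambda>a. u (M a))" ?P]
    by (simp add: divide_right_mono flip: add_divide_distrib)
qed

lemma covector_norm_zero: "covector_norm g k x (\<lambda>v. 0) = 0"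
  unfolding covector_norm_def by simp

lemma covector_norm_ge_frame:
  assumes g: "riemannian_metric g" and u: "metric_frame g x u" and \<alpha>: "alternating k \<alpha>"
  shows "\<bar>\<alpha> (\<lambda>a. u (M a))\<bar> \<le> sqrt (fact k) * covector_norm g k x \<alpha>"
proof -
  let ?P = "{..<k} \<rightarrow>\<^sub>E UNIV"
  have "\<alpha> (\<lambda>a. u (M a)) = \<alpha> (\<lambda>a. u (restrict M {..<k} a))"
    by (rule alternating_cong[OF \<alpha>]) simp
  moreover have "\<bar>\<alpha> (\<lambda>a. u (restrict M {..<k} a))\<bar> \<le> L2_set (\<lambda>M. \<alpha> (\<lambda>a. u (M a))) ?P"
    using member_le_L2_set[of ?P "restrict M {..<k}" "\<lambda>M. \<bar>\<alpha> (\<lambda>a. u (M a))\<bar>"]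
    by (simp add: finite_PiE L2_set_def)
  ultimately show ?thesis unfolding covector_norm_frame[OF assms] by simp
qed

lemma covector_norm_le_frame:
  assumes g: "riemannian_metric g" and u: "metric_frame g x u" and \<alpha>: "alternating k \<alpha>"
  shows "covector_norm g k x \<alpha> \<le> (\<Sum>M\<in>{..<k} \<rightarrow>\<^sub>E UNIV. \<bar>\<alpha> (\<lambda>a. u (M a))\<bar>)"
proof -
  let ?L = "L2_set (\<lambda>M. \<alpha> (\<lambda>a. u (M a))) ({..<k} \<rightarrow>\<^sub>E UNIV)"
  have "?L / sqrt (fact k) \<le> ?L / 1"
    by (intro divide_left_mono) (auto simp: L2_set_nonneg fact_ge_1)
  then show ?thesis unfolding covector_norm_frame[OF assms] using L2_set_le_sum_abs order_trans by fastforce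
qed

section \<open>Comparison of the metric with Euclidean quantities\<close>

text \<open>An l^1 norm that does not see the metric, so that the dependence of
  \<open>covector_norm\<close> on the point can be expressed by powers of \<open>stretch\<close>
  alone.\<close>

definition comp_norm :: "nat \<Rightarrow> 'n::finite covector \<Rightarrow> real" where
  "comp_norm k \<alpha> = (\<Sum>J\<in>{..<k} \<rightarrow>\<^sub>E UNIV. \<bar>\<alpha> (\<lambda>a. axis (J a) 1)\<bar>)"

lemma comp_norm_nonneg: "0 \<le> comp_norm k \<alpha>"
  unfolding comp_norm_def by (simp add: sum_nonneg)

lemma abs_le_comp_norm:
  assumes "alternating k \<alpha>"
  shows "\<bar>\<alpha> (\<lambda>a. axis (J a) 1)\<bar> \<le> comp_norm k \<alpha>"
proof -
  have "\<alpha> (\<lambda>a. axis (J a) 1) = \<alpha> (\<lambda>a. axis (restrict J {..<k} a) 1)"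
    by (rule alternating_cong[OF assms]) simp
  then show ?thesis
    unfolding comp_norm_def
    using member_le_sum[of "restrict J {..<k}" "{..<k} \<rightarrow>\<^sub>E UNIV" "\<lambda>J. \<bar>\<alpha> (\<lambda>a. axis (J a) 1)\<bar>"]
    by (simp add: finite_PiE)
qed

text \<open>
  Up to a bounded factor, \<open>dr\<close> and \<open>r / stretch x\<close> times an orthonormal coframe of the sphere form an
  orthonormal coframe.
\<close>

definition stretch :: "real^'n::finite \<Rightarrow> real" where
  "stretch x = max 1 (norm x * exp (norm x))"

lemma stretch_ge_1: "1 \<le> stretch x"
  unfolding stretch_def by simp

lemma continuous_on_gram:
  assumes "riemannian_metric g"
  shows "continuous_on S (\<lambda>x. gram g x $ i $ j)"
  unfolding gram_def using smooth_continuous[OF riemannian_metricD(4)[OF assms]] continuous_on_subset by force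

lemma continuous_on_det_gram:
  fixes g :: "'n::finite metric"
  assumes "riemannian_metric g"
  shows "continuous_on S (\<lambda>x. det (gram g x))"
  unfolding det_def by (intro continuous_intros continuous_on_gram[OF assms])

text \<open>By compactness, g x v v attains positive extrema for x in the ball and v on the unit
  sphere; homogeneity of degree 2 in v does the rest.\<close>

lemma metric_local_bounds:
  fixes g :: "'n::finite metric"
  assumes g: "riemannian_metric g" and R: "R > 0"
  obtains c C where "0 < c" "0 < C" "\<And>x v. norm x \<le> R \<Longrightarrow> c * (norm v)\<^sup>2 \<le> g x v v"
    "\<And>x v. norm x \<le> R \<Longrightarrow> g x v v \<le> C * (norm v)\<^sup>2"
proof -
  let ?S = "cball (0::real^'n) R \<times> sphere (0::real^'n) 1"
  have eq: "(\<lambda>z. g (fst z) (snd z) (snd z)) =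
      (\<lambda>z. \<Sum>i\<in>UNIV. \<Sum>j\<in>UNIV. snd z $ i * snd z $ j * gram g (fst z) $ i $ j)"
    by (rule ext) (rule metric_expand[OF g])
  have "continuous_on ?S (\<lambda>z. \<Sum>i\<in>UNIV. \<Sum>j\<in>UNIV. snd z $ i * snd z $ j * gram g (fst z) $ i $ j)"
    by (intro continuous_intros continuous_on_compose2[OF continuous_on_gram[OF g, of UNIV] continuous_on_fst]) auto
  then have cont: "continuous_on ?S (\<lambda>z. g (fst z) (snd z) (snd z))"
    by (subst eq)
  have comp: "compact ?S" by (intro compact_Times compact_cball compact_sphere)
  have "sphere (0::real^'n) 1 \<noteq> {}" by simp
  then have ne: "?S \<noteq> {}" using R by auto
  obtain z1 where z1: "z1 \<in> ?S" "\<And>z. z \<in> ?S \<Longrightarrow> g (fst z1) (snd z1) (snd z1) \<le> g (fst z) (snd z) (snd z)"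
    using continuous_attains_inf[OF comp ne cont] by blast
  obtain z2 where z2: "z2 \<in> ?S" "\<And>z. z \<in> ?S \<Longrightarrow> g (fst z) (snd z) (snd z) \<le> g (fst z2) (snd z2) (snd z2)"
    using continuous_attains_sup[OF comp ne cont] by blast
  have p: "g (fst z) (snd z) (snd z) > 0" if "z \<in> ?S" for z
    using that by (intro riemannian_metricD(3)[OF g]) auto
  have hom: "g x v v = (norm v)\<^sup>2 * g x (v /\<^sub>R norm v) (v /\<^sub>R norm v)" if "v \<noteq> 0" for x v
    using that by (simp add: bilinear_lmul[OF riemannian_metricD(1)[OF g]] bilinear_rmul[OF riemannian_metricD(1)[OF g]]
      power2_eq_square divide_simps)
  have z: "g x 0 0 = 0" for x using bilinear_lzero[OF riemannian_metricD(1)[OF g]] by blast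
  show thesis
  proof
    show "0 < g (fst z1) (snd z1) (snd z1)" "0 < g (fst z2) (snd z2) (snd z2)" using p z1 z2 by auto
    fix x v :: "real^'n" assume x: "norm x \<le> R"
    have "g (fst z1) (snd z1) (snd z1) * (norm v)\<^sup>2 \<le> g x v v \<and> g x v v \<le> g (fst z2) (snd z2) (snd z2) * (norm v)\<^sup>2"
    proof (cases "v = 0")
      case False
      then have xv: "(x, v /\<^sub>R norm v) \<in> ?S" using x by simp
      define q where "q = g x (v /\<^sub>R norm v) (v /\<^sub>R norm v)"
      have "g (fst z1) (snd z1) (snd z1) \<le> q" "q \<le> g (fst z2) (snd z2) (snd z2)"
        using z1(2)[OF xv] z2(2)[OF xv] by (auto simp: q_def)
      moreover have "g x v v = (norm v)\<^sup>2 * q" unfolding q_def by (rule hom[OF False])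
      ultimately show ?thesis by (auto intro: mult_right_mono simp: mult.commute[of "(norm v)\<^sup>2"])
    qed (simp add: z)
    then show "g (fst z1) (snd z1) (snd z1) * (norm v)\<^sup>2 \<le> g x v v" "g x v v \<le> g (fst z2) (snd z2) (snd z2) * (norm v)\<^sup>2" by auto
  qed
qed

text \<open>For the first bound the arguments are expanded in an orthonormal frame, with
  coefficients at most \<open>sqrt C\<close>; for the second the frame is expanded in the axes, with
  entries at most \<open>1 / sqrt c\<close>.\<close>

lemma covector_local_bounds:
  fixes g :: "'n::finite metric"
  assumes g: "riemannian_metric g"
  obtains C where "0 < C"
    "\<And>x \<alpha> v. norm x \<le> R \<Longrightarrow> alternating k \<alpha> \<Longrightarrow> (\<And>a. a < k \<Longrightarrow> norm (v a) \<le> 1) \<Longrightarrow> \<bar>\<alpha> v\<bar> \<le> C * covector_norm g k x \<alpha>"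
    "\<And>x \<alpha>. norm x \<le> R \<Longrightarrow> alternating k \<alpha> \<Longrightarrow> covector_norm g k x \<alpha> \<le> C * comp_norm k \<alpha>"
proof -
  \<comment> \<open>R is arbitrary and may be negative, so the bounds are taken on the ball of
    radius \<open>max 1 R\<close>.\<close>
  obtain c C where c: "0 < c" "0 < C" "\<And>x v. norm x \<le> max 1 R \<Longrightarrow> c * (norm v)\<^sup>2 \<le> g x v v"
    and C: "\<And>x v. norm x \<le> max 1 R \<Longrightarrow> g x v v \<le> C * (norm v)\<^sup>2"
    using metric_local_bounds[OF g, of "max 1 R"] by (metis less_max_iff_disj zero_less_one)
  let ?P = "{..<k} \<rightarrow>\<^sub>E (UNIV :: 'n set)"
  define C1 where "C1 = sqrt C ^ k * (card ?P * sqrt (fact k))"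
  define C2 where "C2 = card ?P * (1 / sqrt c) ^ k"
  show thesis
  proof
    have "C1 \<ge> 0" "C2 \<ge> 0" using c by (auto simp: C1_def C2_def)
    then show "0 < 1 + C1 + C2" by simp
    fix x :: "real^'n" and \<alpha> :: "'n covector" assume x: "norm x \<le> R" and \<alpha>: "alternating k \<alpha>"
    obtain u where u: "metric_frame g x u" using metric_frame_exists[OF g] .
    have x': "norm x \<le> max 1 R" using x by simp
    note cn = covector_norm_nonneg[OF g \<alpha>, of x]
    show "\<bar>\<alpha> v\<bar> \<le> (1 + C1 + C2) * covector_norm g k x \<alpha>" if v: "\<And>a. a < k \<Longrightarrow> norm (v a) \<le> 1" for v
    proof -
      have "\<bar>\<alpha> v\<bar> \<le> sqrt C ^ k * (\<Sum>M\<in>?P. \<bar>\<alpha> (\<lambda>a. u (M a))\<bar>)"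
      proof (rule alternating_expand_bound[OF \<alpha>])
        show "v a = (\<Sum>m\<in>UNIV. g x (v a) (u m) *\<^sub>R u m)" for a by (rule metric_frame_expand[OF g u])
        fix M a assume "a < k"
        have "\<bar>g x (v a) (u (M a))\<bar> \<le> sqrt (g x (v a) (v a))" by (rule metric_frame_coeff[OF g u])
        also have "\<dots> \<le> sqrt (C * 1)"
        proof (rule real_sqrt_le_mono)
          have "g x (v a) (v a) \<le> C * (norm (v a))\<^sup>2" by (rule C[OF x'])
          also have "\<dots> \<le> C * 1"
            using v[OF \<open>a < k\<close>] c(2) by (intro mult_left_mono power_le_one) auto
          finally show "g x (v a) (v a) \<le> C * 1" .
        qed
        finally show "\<bar>g x (v a) (u (M a))\<bar> \<le> sqrt C" by simp
      qed simp
      also have "(\<Sum>M\<in>?P. \<bar>\<alpha> (\<lambda>a. u (M a))\<bar>) \<le> (\<Sum>M\<in>?P. sqrt (fact k) * covector_norm g k x \<alpha>)"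
        by (intro sum_mono covector_norm_ge_frame[OF g u \<alpha>])
      finally have "\<bar>\<alpha> v\<bar> \<le> C1 * covector_norm g k x \<alpha>"
        using c by (simp add: C1_def mult_ac)
      also have "\<dots> \<le> (1 + C1 + C2) * covector_norm g k x \<alpha>"
        using \<open>C2 \<ge> 0\<close> cn by (intro mult_right_mono) auto
      finally show ?thesis .
    qed
    have "\<bar>\<alpha> (\<lambda>a. u (M a))\<bar> \<le> (1 / sqrt c) ^ k * comp_norm k \<alpha>" for M
      unfolding comp_norm_def
    proof (rule alternating_expand_bound[OF \<alpha>])
      fix J :: "nat \<Rightarrow> 'n" and a
      have "c * (norm (u (M a)))\<^sup>2 \<le> 1" using c(3)[OF x', of "u (M a)"] u by (simp add: metric_frame_def)
      then have "norm (u (M a)) \<le> sqrt (1 / c)"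
        using c(1) by (intro real_le_rsqrt) (simp add: field_simps)
      then show "\<bar>u (M a) $ J a\<bar> \<le> 1 / sqrt c"
        using component_le_norm_cart[of "u (M a)" "J a"] by (simp add: real_sqrt_divide)
    next
      show "u (M a) = (\<Sum>m\<in>UNIV. u (M a) $ m *\<^sub>R axis m 1)" for a by (rule vec_expand)
    qed simp
    then have "(\<Sum>M\<in>?P. \<bar>\<alpha> (\<lambda>a. u (M a))\<bar>) \<le> (\<Sum>M\<in>?P. (1 / sqrt c) ^ k * comp_norm k \<alpha>)"
      by (intro sum_mono)
    then have "covector_norm g k x \<alpha> \<le> C2 * comp_norm k \<alpha>"
      using covector_norm_le_frame[OF g u \<alpha>] by (simp add: C2_def)
    also have "\<dots> \<le> (1 + C1 + C2) * comp_norm k \<alpha>"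
      using \<open>C1 \<ge> 0\<close> comp_norm_nonneg by (intro mult_right_mono) auto
    finally show "covector_norm g k x \<alpha> \<le> (1 + C1 + C2) * comp_norm k \<alpha>" .
  qed
qed

lemma det_gram_local_bounds:
  fixes g :: "'n::finite metric"
  assumes g: "riemannian_metric g"
  obtains C where "0 < C" "\<And>x. norm x \<le> R \<Longrightarrow> sqrt (det (gram g x)) \<le> C"
    "\<And>x. norm x \<le> R \<Longrightarrow> 1 \<le> C * sqrt (det (gram g x))"
proof -
  let ?S = "cball (0::real^'n) (max 1 R)" and ?d = "\<lambda>x. sqrt (det (gram g x))"
  have cont: "continuous_on ?S ?d" by (intro continuous_intros continuous_on_det_gram[OF g])
  have ne: "?S \<noteq> {}" by simp
  obtain x1 where x1: "x1 \<in> ?S" "\<And>x. x \<in> ?S \<Longrightarrow> ?d x1 \<le> ?d x"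
    using continuous_attains_inf[OF compact_cball ne cont] by blast
  obtain x2 where x2: "x2 \<in> ?S" "\<And>x. x \<in> ?S \<Longrightarrow> ?d x \<le> ?d x2"
    using continuous_attains_sup[OF compact_cball ne cont] by blast
  have p: "?d x > 0" for x using det_gram_pos[OF g, of x] by simp
  show thesis
  proof
    show "0 < ?d x2 + 1 / ?d x1" by (intro add_pos_pos divide_pos_pos p) simp
    fix x :: "real^'n" assume "norm x \<le> R"
    then have x: "x \<in> ?S" by simp
    show "?d x \<le> ?d x2 + 1 / ?d x1" using x2(2)[OF x] divide_pos_pos[OF zero_less_one p[of x1]] by linarith
    have "1 = 1 / ?d x1 * ?d x1" using p[of x1] by simp
    also have "\<dots> \<le> (?d x2 + 1 / ?d x1) * ?d x"
      using x1(2)[OF x] p[of x1] p[of x2] p[of x] by (intro mult_mono) (auto simp: less_imp_le)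
    finally show "1 \<le> (?d x2 + 1 / ?d x1) * ?d x" .
  qed
qed

text \<open>A Euclidean orthonormal basis containing the radial vector is rescaled. A tangential
  vector r \<xi> has g-length exp (- r) |\<xi>|, so for \<xi> equal to exp r times a Euclidean unit
  vector it has g-length 1. The resulting factor r exp r is \<open>stretch x\<close> because norm x
  \<ge> 1.\<close>

lemma cusp_frame:
  fixes g :: "'n::finite metric"
  assumes R: "\<And>r \<theta> a b \<xi> \<eta>. r > R \<Longrightarrow> \<theta> \<in> sphere 0 1 \<Longrightarrow> \<xi> \<bullet> \<theta> = 0 \<Longrightarrow> \<eta> \<bullet> \<theta> = 0 \<Longrightarrow>
        g (r *\<^sub>R \<theta>) (a *\<^sub>R \<theta> + r *\<^sub>R \<xi>) (b *\<^sub>R \<theta> + r *\<^sub>R \<eta>) = a * b + exp (- 2 * r) * (\<xi> \<bullet> \<eta>)"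
    and x: "norm x > R" "norm x \<ge> 1"
  obtains A :: "real^'n^'n" and i0 where "orthogonal_matrix A" "column i0 A = x /\<^sub>R norm x"
    "metric_frame g x (\<lambda>i. if i = i0 then x /\<^sub>R norm x else stretch x *\<^sub>R column i A)"
proof -
  define r where "r = norm x"
  define \<omega> where "\<omega> = x /\<^sub>R norm x"
  have r: "r \<ge> 1" "r > R" using x by (auto simp: r_def)
  have "x \<noteq> 0" using x by auto
  then have \<omega>: "norm \<omega> = 1" "r *\<^sub>R \<omega> = x" by (auto simp: r_def \<omega>_def)
  have st: "stretch x = r * exp r"
  proof -
    have "1 * 1 \<le> r * exp r" using r by (intro mult_mono) auto
    then show ?thesis by (simp add: stretch_def r_def[symmetric])
  qed
  obtain A :: "real^'n^'n" and i0 where A: "orthogonal_matrix A" "A *v axis i0 1 = \<omega>"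
    using orthogonal_matrix_exists_basis[OF \<omega>(1)] by metis
  have col: "column i0 A = \<omega>"
    using A(2) by (simp add: matrix_vector_mult_basis)
  have on: "column i A \<bullet> column j A = (if i = j then 1 else 0)" for i j
    using A(1) unfolding orthogonal_matrix_orthonormal_columns by (auto simp: orthogonal_def norm_eq_1)
  have sp: "\<omega> \<in> sphere 0 1" using \<omega> by simp
  let ?u = "\<lambda>i. if i = i0 then \<omega> else stretch x *\<^sub>R column i A"
  have u: "?u i = (if i = i0 then 1 else 0) *\<^sub>R \<omega> + r *\<^sub>R (if i = i0 then 0 else exp r *\<^sub>R column i A)" for i
    by (simp add: st)
  have "metric_frame g x ?u"
    unfolding metric_frame_def
  proof (intro allI)
    fix i j
    have "g (r *\<^sub>R \<omega>) (?u i) (?u j) = (if i = i0 then 1 else 0) * (if j = i0 then 1 else 0)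
      + exp (- 2 * r) * ((if i = i0 then 0 else exp r *\<^sub>R column i A) \<bullet> (if j = i0 then 0 else exp r *\<^sub>R column j A))"
      unfolding u by (rule R[OF r(2) sp]) (use on[of _ i0] col in auto)
    also have "\<dots> = (if i = j then 1 else 0)"
      by (auto simp: on simp flip: exp_add)
    finally show "g x (?u i) (?u j) = (if i = j then 1 else 0)" using \<omega>(2) by simp
  qed
  then show thesis using that[OF A(1), of i0] col unfolding \<omega>_def by blast
qed

lemma orthogonal_expand:
  fixes A :: "real^'n::finite^'n"
  assumes "orthogonal_matrix A"
  shows "v = (\<Sum>m\<in>UNIV. (v \<bullet> column m A) *\<^sub>R column m A)"
proof -
  have "v = (A ** transpose A) *v v" using assms by (simp add: orthogonal_matrix_def)
  also have "\<dots> = A *v (transpose A *v v)" by (simp only: matrix_vector_mul_assoc)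
  also have "\<dots> = (\<Sum>m\<in>UNIV. (v \<bullet> column m A) *\<^sub>R column m A)"
    by (simp add: vec_eq_iff matrix_vector_mult_def column_def transpose_def inner_vec_def mult_ac)
  finally show ?thesis .
qed

text \<open>Far out, an adapted frame consists of the radial vector and of \<open>stretch x\<close>
  times Euclidean unit vectors. For the first estimate the axes are expanded in the frame, where
  each tangential slot brings a factor 1 / \<open>stretch x\<close>; for the second the frame is
  expanded in the axes, where each slot brings at most \<open>stretch x\<close>. The determinant of
  the frame is \<open>stretch x\<close> to the power n - 1 up to sign, which gives the density. In
  the remaining ball \<open>stretch\<close> is bounded and the local bounds apply.\<close>

lemma cusp_bounds:
  fixes g :: "'n::finite metric"
  assumes g: "riemannian_metric g" and "cusp_end g"
  obtains C where "0 < C"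
    "\<And>x \<alpha>. x \<noteq> 0 \<Longrightarrow> alternating (Suc m) \<alpha> \<Longrightarrow>
        stretch x ^ m * comp_norm m (\<lambda>v. \<alpha> (case_nat (x /\<^sub>R norm x) v)) \<le> C * covector_norm g (Suc m) x \<alpha>"
    "\<And>x \<alpha>. x \<noteq> 0 \<Longrightarrow> alternating m \<alpha> \<Longrightarrow> (\<And>v a c. a < m \<Longrightarrow> v a = c *\<^sub>R x \<Longrightarrow> \<alpha> v = 0) \<Longrightarrow>
        covector_norm g m x \<alpha> \<le> C * (stretch x ^ m * comp_norm m \<alpha>)"
    "\<And>x. sqrt (det (gram g x)) * stretch x ^ (CARD('n) - 1) \<le> C"
    "\<And>x. 1 \<le> C * (sqrt (det (gram g x)) * stretch x ^ (CARD('n) - 1))"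
proof -
  obtain R0 where R0: "\<And>r \<theta> a b \<xi> \<eta>. r > R0 \<Longrightarrow> \<theta> \<in> sphere 0 1 \<Longrightarrow> \<xi> \<bullet> \<theta> = 0 \<Longrightarrow> \<eta> \<bullet> \<theta> = 0 \<Longrightarrow>
        g (r *\<^sub>R \<theta>) (a *\<^sub>R \<theta> + r *\<^sub>R \<xi>) (b *\<^sub>R \<theta> + r *\<^sub>R \<eta>) = a * b + exp (- 2 * r) * (\<xi> \<bullet> \<eta>)"
    using assms(2) unfolding cusp_end_def by blast
  have cf: "\<exists>A i0. orthogonal_matrix A \<and> column i0 A = x /\<^sub>R norm x \<and>
      metric_frame g x (\<lambda>i. if i = i0 then x /\<^sub>R norm x else stretch x *\<^sub>R column i A)"
    if "norm x > R0" "norm x \<ge> 1" for x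
    by (rule cusp_frame[OF R0 that], assumption+) blast
  define R where "R = max 1 R0"
  define T where "T = R * exp R"
  have "1 * 1 \<le> R * exp R" unfolding R_def by (intro mult_mono) auto
  then have T: "T \<ge> 1" by (simp add: T_def)
  have R1: "R \<ge> 1" by (simp add: R_def)
  have stT: "stretch x \<le> T" if "norm x \<le> R" for x :: "real^'n"
    using that T R1 unfolding stretch_def T_def by (auto intro!: mult_mono)
  obtain C1 where C1: "0 < C1"
    "\<And>x \<alpha> v. norm x \<le> R \<Longrightarrow> alternating (Suc m) \<alpha> \<Longrightarrow> (\<And>a. a < Suc m \<Longrightarrow> norm (v a) \<le> 1) \<Longrightarrow> \<bar>\<alpha> v\<bar> \<le> C1 * covector_norm g (Suc m) x \<alpha>"
    using covector_local_bounds[OF g, of R "Suc m"] by metis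
  obtain C2 where C2: "0 < C2"
    "\<And>x \<alpha>. norm x \<le> R \<Longrightarrow> alternating m \<alpha> \<Longrightarrow> covector_norm g m x \<alpha> \<le> C2 * comp_norm m \<alpha>"
    using covector_local_bounds[OF g, of R m] by metis
  obtain C3 where C3: "0 < C3" "\<And>x. norm x \<le> R \<Longrightarrow> sqrt (det (gram g x)) \<le> C3"
    "\<And>x. norm x \<le> R \<Longrightarrow> 1 \<le> C3 * sqrt (det (gram g x))"
    using det_gram_local_bounds[OF g, of R] by metis
  let ?P = "{..<m} \<rightarrow>\<^sub>E (UNIV :: 'n set)"
  define N where "N = real (card ?P)"
  have N: "N \<ge> 0" by (simp add: N_def)
  define D1 where "D1 = T ^ m * (N * C1)"
  define D1' where "D1' = N * (N * sqrt (fact (Suc m)))"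
  define D3 where "D3 = C3 * T ^ (CARD('n) - 1)"
  define C where "C = 1 + D1 + D1' + C2 + N + D3"
  have nn: "D1 \<ge> 0" "D1' \<ge> 0" "C2 \<ge> 0" "D3 \<ge> 0" using T N C1(1) C2(1) C3(1) by (auto simp: D1_def D1'_def D3_def)
  show thesis
  proof
    show "0 < C" using nn N by (simp add: C_def)
  next
    fix x :: "real^'n" and \<alpha> :: "'n covector" assume x0: "x \<noteq> 0" and \<alpha>: "alternating (Suc m) \<alpha>"
    note cn = covector_norm_nonneg[OF g \<alpha>, of x]
    define \<beta> where "\<beta> = (\<lambda>v. \<alpha> (case_nat (x /\<^sub>R norm x) v))"
    have \<beta>: "alternating m \<beta>" unfolding \<beta>_def by (rule alternating_interior[OF \<alpha>])
    have st: "stretch x > 0" using stretch_ge_1[of x] by simp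
    have "stretch x ^ m * comp_norm m \<beta> \<le> (D1 + D1') * covector_norm g (Suc m) x \<alpha>"
    proof (cases "norm x \<le> R")
      case True
      have "\<bar>\<beta> (\<lambda>a. axis (J a) 1)\<bar> \<le> C1 * covector_norm g (Suc m) x \<alpha>" for J
        unfolding \<beta>_def by (rule C1(2)[OF True \<alpha>]) (use x0 in \<open>auto split: nat.split\<close>)
      then have "comp_norm m \<beta> \<le> (\<Sum>J\<in>?P. C1 * covector_norm g (Suc m) x \<alpha>)"
        unfolding comp_norm_def by (intro sum_mono)
      then have c: "comp_norm m \<beta> \<le> N * (C1 * covector_norm g (Suc m) x \<alpha>)" by (simp add: N_def)
      have "stretch x ^ m * comp_norm m \<beta> \<le> T ^ m * (N * (C1 * covector_norm g (Suc m) x \<alpha>))"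
        using c stT[OF True] st T comp_norm_nonneg by (intro mult_mono power_mono) auto
      also have "\<dots> = D1 * covector_norm g (Suc m) x \<alpha>" by (simp add: D1_def mult_ac)
      also have "\<dots> \<le> (D1 + D1') * covector_norm g (Suc m) x \<alpha>" using cn nn by (intro mult_right_mono) auto
      finally show ?thesis .
    next
      case False
      then have far: "norm x > R0" "norm x \<ge> 1" by (auto simp: R_def)
      obtain A :: "real^'n^'n" and i0 where A: "orthogonal_matrix A" "column i0 A = x /\<^sub>R norm x"
        and u: "metric_frame g x (\<lambda>i. if i = i0 then x /\<^sub>R norm x else stretch x *\<^sub>R column i A)"
        using cf[OF far] by blast
      define u where "u = (\<lambda>i. if i = i0 then x /\<^sub>R norm x else stretch x *\<^sub>R column i A)"
      define s where "s i = (if i = i0 then 1 else stretch x)" for i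
      note u = u[folded u_def]
      have nc: "norm (column i A) = 1" for i
        using A(1) unfolding orthogonal_matrix_orthonormal_columns by blast
      have us: "(1 / s i) *\<^sub>R u i = column i A" for i using st A(2) by (simp add: u_def s_def)
      have B: "\<bar>\<beta> (\<lambda>a. u (M a))\<bar> \<le> sqrt (fact (Suc m)) * covector_norm g (Suc m) x \<alpha>" for M
      proof -
        have "case_nat (x /\<^sub>R norm x) (\<lambda>a. u (M a)) = (\<lambda>a. u (case_nat i0 M a))"
          by (auto simp: u_def fun_eq_iff split: nat.split)
        then show ?thesis unfolding \<beta>_def using covector_norm_ge_frame[OF g u \<alpha>] by simp
      qed
      have "\<bar>\<beta> (\<lambda>a. axis (J a) 1)\<bar> \<le> (1 / stretch x) ^ m * (\<Sum>M\<in>?P. \<bar>\<beta> (\<lambda>a. u (M a))\<bar>)" for J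
      proof (rule alternating_expand_bound[OF \<beta>])
        fix a
        show "axis (J a) 1 = (\<Sum>i\<in>UNIV. ((axis (J a) 1 \<bullet> column i A) / s i) *\<^sub>R u i)"
          using orthogonal_expand[OF A(1), of "axis (J a) 1"] by (simp flip: us)
      next
        fix M a assume M: "\<beta> (\<lambda>a. u (M a)) \<noteq> 0" and a: "a < m"
        \<comment> \<open>A tuple containing the radial vector repeats the vector already inserted
          by \<beta>, so only the tangential coefficients have to be bounded by 1 /
          \<open>stretch x\<close>.\<close>
        have "M a \<noteq> i0"
        proof
          assume "M a = i0"
          then have "\<beta> (\<lambda>a. u (M a)) = 0"
            unfolding \<beta>_def by (intro alternating_repeat[OF \<alpha>, of 0 "Suc a"]) (use a in \<open>auto simp: u_def\<close>)
          with M show False ..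
        qed
        moreover have "\<bar>axis (J a) 1 \<bullet> column (M a) A\<bar> \<le> 1"
          using Cauchy_Schwarz_ineq2[of "axis (J a) 1" "column (M a) A"] nc by simp
        ultimately show "\<bar>(axis (J a) 1 \<bullet> column (M a) A) / s (M a)\<bar> \<le> 1 / stretch x"
          using st by (simp add: s_def divide_right_mono)
      qed simp
      also have "(1 / stretch x) ^ m * (\<Sum>M\<in>?P. \<bar>\<beta> (\<lambda>a. u (M a))\<bar>) \<le>
          (1 / stretch x) ^ m * (\<Sum>M\<in>?P. sqrt (fact (Suc m)) * covector_norm g (Suc m) x \<alpha>)"
        using st B by (intro mult_left_mono sum_mono) auto
      finally have "\<bar>\<beta> (\<lambda>a. axis (J a) 1)\<bar> \<le> (1 / stretch x) ^ m * (N * (sqrt (fact (Suc m)) * covector_norm g (Suc m) x \<alpha>))" for J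
        by (simp add: N_def)
      then have "comp_norm m \<beta> \<le> (\<Sum>J\<in>?P. (1 / stretch x) ^ m * (N * (sqrt (fact (Suc m)) * covector_norm g (Suc m) x \<alpha>)))"
        unfolding comp_norm_def by (rule sum_mono)
      then have "stretch x ^ m * comp_norm m \<beta> \<le> stretch x ^ m * (N * ((1 / stretch x) ^ m * (N * (sqrt (fact (Suc m)) * covector_norm g (Suc m) x \<alpha>))))"
        using st by (intro mult_left_mono) (auto simp: N_def)
      also have "\<dots> = D1' * covector_norm g (Suc m) x \<alpha>"
        using st by (simp add: D1'_def power_divide)
      also have "\<dots> \<le> (D1 + D1') * covector_norm g (Suc m) x \<alpha>" using cn nn by (intro mult_right_mono) auto
      finally show ?thesis .
    qed
    also have "\<dots> \<le> C * covector_norm g (Suc m) x \<alpha>"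
      using cn nn N by (intro mult_right_mono) (auto simp: C_def)
    finally show "stretch x ^ m * comp_norm m (\<lambda>v. \<alpha> (case_nat (x /\<^sub>R norm x) v)) \<le> C * covector_norm g (Suc m) x \<alpha>"
      unfolding \<beta>_def .
  next
    fix x :: "real^'n" and \<alpha> :: "'n covector" assume x0: "x \<noteq> 0" and \<alpha>: "alternating m \<alpha>"
      and ker: "\<And>v a c. a < m \<Longrightarrow> v a = c *\<^sub>R x \<Longrightarrow> \<alpha> v = 0"
    have st: "stretch x ^ m \<ge> 1" using stretch_ge_1[of x] by simp
    have "covector_norm g m x \<alpha> \<le> (C2 + N) * (stretch x ^ m * comp_norm m \<alpha>)"
    proof (cases "norm x \<le> R")
      case True
      have "covector_norm g m x \<alpha> \<le> C2 * comp_norm m \<alpha>" by (rule C2(2)[OF True \<alpha>])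
      also have "\<dots> \<le> (C2 + N) * (stretch x ^ m * comp_norm m \<alpha>)"
        using st comp_norm_nonneg[of m \<alpha>] C2(1) N by (intro mult_mono) (auto simp: mult_le_cancel_right1 intro!: mult_nonneg_nonneg)
      finally show ?thesis .
    next
      case False
      then have far: "norm x > R0" "norm x \<ge> 1" by (auto simp: R_def)
      obtain A :: "real^'n^'n" and i0 where A: "orthogonal_matrix A" "column i0 A = x /\<^sub>R norm x"
        and u: "metric_frame g x (\<lambda>i. if i = i0 then x /\<^sub>R norm x else stretch x *\<^sub>R column i A)"
        using cf[OF far] by blast
      define u where "u = (\<lambda>i. if i = i0 then x /\<^sub>R norm x else stretch x *\<^sub>R column i A)"
      note u = u[folded u_def]
      have nc: "norm (column i A) = 1" for i
        using A(1) unfolding orthogonal_matrix_orthonormal_columns by blast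
      have "\<bar>\<alpha> (\<lambda>a. u (M a))\<bar> \<le> stretch x ^ m * comp_norm m \<alpha>" for M
        unfolding comp_norm_def
      proof (rule alternating_expand_bound[OF \<alpha>])
        show "u (M a) = (\<Sum>i\<in>UNIV. (u (M a) $ i) *\<^sub>R axis i 1)" for a by (rule vec_expand)
        fix J :: "nat \<Rightarrow> 'n" and a
        have "norm (u (M a)) \<le> stretch x" using stretch_ge_1[of x] x0 nc by (simp add: u_def)
        then show "\<bar>u (M a) $ J a\<bar> \<le> stretch x"
          using component_le_norm_cart order_trans by blast
      qed simp
      then have "(\<Sum>M\<in>?P. \<bar>\<alpha> (\<lambda>a. u (M a))\<bar>) \<le> (\<Sum>M\<in>?P. stretch x ^ m * comp_norm m \<alpha>)"
        by (intro sum_mono)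
      then have "covector_norm g m x \<alpha> \<le> N * (stretch x ^ m * comp_norm m \<alpha>)"
        using covector_norm_le_frame[OF g u \<alpha>] by (simp add: N_def)
      also have "\<dots> \<le> (C2 + N) * (stretch x ^ m * comp_norm m \<alpha>)"
        using st comp_norm_nonneg[of m \<alpha>] C2(1) by (intro mult_right_mono) auto
      finally show ?thesis .
    qed
    also have "\<dots> \<le> C * (stretch x ^ m * comp_norm m \<alpha>)"
      using nn N st comp_norm_nonneg[of m \<alpha>] by (intro mult_right_mono) (auto simp: C_def)
    finally show "covector_norm g m x \<alpha> \<le> C * (stretch x ^ m * comp_norm m \<alpha>)" .
  next
    fix x :: "real^'n"
    let ?d = "sqrt (det (gram g x))" and ?n = "CARD('n) - 1"
    have dp: "?d > 0" using det_gram_pos[OF g] by simp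
    have "?d * stretch x ^ ?n \<le> 1 + D3 \<and> 1 \<le> (1 + D3) * (?d * stretch x ^ ?n)"
    proof (cases "norm x \<le> R")
      case True
      have st: "1 \<le> stretch x ^ ?n" "stretch x ^ ?n \<le> T ^ ?n" "T ^ ?n \<ge> 1"
        using stretch_ge_1[of x] stT[OF True] T by (auto intro: power_mono)
      have "?d * stretch x ^ ?n \<le> D3" unfolding D3_def using C3(2)[OF True] st dp C3(1) by (intro mult_mono) auto
      moreover have "1 \<le> D3 * (?d * stretch x ^ ?n)"
      proof -
        have "1 * 1 \<le> (C3 * ?d) * (T ^ ?n * stretch x ^ ?n)"
          using C3(3)[OF True] st mult_mono[of 1 "T ^ ?n" 1 "stretch x ^ ?n"] by (intro mult_mono) auto
        then show ?thesis by (simp add: D3_def mult_ac)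
      qed
      moreover have "0 \<le> ?d * stretch x ^ ?n" using dp st by simp
      ultimately show ?thesis by (simp add: distrib_right)
    next
      case False
      then have far: "norm x > R0" "norm x \<ge> 1" by (auto simp: R_def)
      obtain A :: "real^'n^'n" and i0 where A: "orthogonal_matrix A" "column i0 A = x /\<^sub>R norm x"
        and u: "metric_frame g x (\<lambda>i. if i = i0 then x /\<^sub>R norm x else stretch x *\<^sub>R column i A)"
        using cf[OF far] by blast
      define s where "s i = (if i = i0 then 1 else stretch x)" for i
      have us: "(if i = i0 then x /\<^sub>R norm x else stretch x *\<^sub>R column i A) = s i *\<^sub>R column i A" for i
        by (simp add: s_def A(2))
      define U where "U = ((\<chi> i m. (s m *\<^sub>R column m A) $ i) :: real^'n^'n)"
      have dU: "(det U)\<^sup>2 * det (gram g x) = 1"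
        unfolding U_def using metric_frame_matrix(3)[OF g u] unfolding us .
      \<comment> \<open>The scalings contribute one factor \<open>stretch x\<close> for every index
        other than i0, and the orthogonal matrix contributes a sign.\<close>
      have "transpose U = (\<chi> i. s i *s (transpose A $ i))"
        by (simp add: vec_eq_iff U_def transpose_def column_def)
      then have "det U = prod s UNIV * det A"
        using det_rows_mul[of s "\<lambda>i. transpose A $ i"] by (metis det_transpose vec_lambda_eta)
      moreover have "prod s UNIV = stretch x ^ ?n"
        unfolding s_def by (simp add: prod.If_cases Compl_eq_Diff_UNIV card_Diff_singleton flip: Collect_neg_eq)
      moreover have "(det A)\<^sup>2 = 1" using det_orthogonal_matrix[OF A(1)] by auto
      ultimately have "(?d * stretch x ^ ?n)\<^sup>2 = 1"
        using dU dp by (simp add: power_mult_distrib mult.commute)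
      moreover have "?d * stretch x ^ ?n \<ge> 0" using dp stretch_ge_1[of x] by simp
      ultimately have "?d * stretch x ^ ?n = 1" by (simp add: power2_eq_1_iff)
      then show ?thesis using nn by simp
    qed
    moreover have "1 + D3 \<le> C" using nn N by (simp add: C_def)
    moreover have "0 \<le> ?d * stretch x ^ ?n" using dp stretch_ge_1[of x] by simp
    ultimately show "?d * stretch x ^ ?n \<le> C" "1 \<le> C * (?d * stretch x ^ ?n)"
      by (auto intro: order_trans mult_right_mono)
  qed
qed

section \<open>Integration along rays\<close>

lemma nn_integral_scaleR:
  fixes g :: "'a::euclidean_space \<Rightarrow> ennreal"
  assumes [measurable]: "g \<in> borel_measurable borel" and c: "c > 0"
  shows "(\<integral>\<^sup>+x. g x \<partial>lborel) = (\<integral>\<^sup>+x. ennreal (c ^ DIM('a)) * g (c *\<^sub>R x) \<partial>lborel)"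
  by (subst lborel_affine[of c 0]) (use c in \<open>auto simp: nn_integral_density nn_integral_distr\<close>)

lemma integral_scaleR:
  fixes g :: "'a::euclidean_space \<Rightarrow> real"
  assumes [measurable]: "g \<in> borel_measurable borel" and c: "c > 0"
  shows "(LINT x|lborel. g x) = c ^ DIM('a) * (LINT x|lborel. g (c *\<^sub>R x))"
  by (subst lborel_affine[of c 0]) (use c in \<open>auto simp: integral_density integral_distr\<close>)

lemma indicator_Ioi_AE: "AE t in lborel. indicator {0<..} (t::real) = (indicator {0..} t :: ennreal)"
  by (rule AE_mp[OF AE_lborel_singleton[of "0::real"]]) (auto simp: indicator_def)

text \<open>Both integrands are the density (1 + s)^-2 on the half-line in disguise, with s = r / t
  in the first and s = t r in the second. Each proof uses an explicit antiderivative.\<close>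

lemma nn_integral_kernel:
  assumes "r > (0::real)"
  shows "(\<integral>\<^sup>+t. ennreal (r / (t + r) ^ 2) * indicator {0<..} t \<partial>lborel) = 1"
    and "(\<integral>\<^sup>+t. ennreal (r / (1 + t * r) ^ 2) * indicator {0<..} t \<partial>lborel) = 1"
proof -
  have "(\<integral>\<^sup>+t. ennreal (r / (t + r) ^ 2) * indicator {0<..} t \<partial>lborel)
      = (\<integral>\<^sup>+t. ennreal (r / (t + r) ^ 2) * indicator {0..} t \<partial>lborel)"
    by (rule nn_integral_cong_AE) (use indicator_Ioi_AE in eventually_elim, simp)
  also have "\<dots> = ennreal (0 - (- r / (0 + r)))"
  proof (rule nn_integral_FTC_atLeast[where F="\<lambda>t. - r / (t + r)"])
    show "((\<lambda>t. - r / (t + r)) \<longlongrightarrow> 0) at_top"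
      using filterlim_tendsto_add_at_top[OF tendsto_const[of r] filterlim_ident]
      by (intro tendsto_divide_0[OF tendsto_const] filterlim_at_top_imp_at_infinity) (simp add: add.commute)
  qed (use assms in \<open>auto intro!: derivative_eq_intros simp: power2_eq_square\<close>)
  finally show "(\<integral>\<^sup>+t. ennreal (r / (t + r) ^ 2) * indicator {0<..} t \<partial>lborel) = 1"
    using assms by simp
  have "(\<integral>\<^sup>+t. ennreal (r / (1 + t * r) ^ 2) * indicator {0<..} t \<partial>lborel)
      = (\<integral>\<^sup>+t. ennreal (r / (1 + t * r) ^ 2) * indicator {0..} t \<partial>lborel)"
    by (rule nn_integral_cong_AE) (use indicator_Ioi_AE in eventually_elim, simp)
  also have "\<dots> = ennreal (0 - (- 1 / (1 + 0 * r)))"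
  proof (rule nn_integral_FTC_atLeast[where F="\<lambda>t. - 1 / (1 + t * r)"])
    have "filterlim (\<lambda>t. t * r) at_top at_top"
      using assms by (intro filterlim_at_top_mult_tendsto_pos[OF tendsto_const] filterlim_ident)
    then show "((\<lambda>t. - 1 / (1 + t * r)) \<longlongrightarrow> 0) at_top"
      by (intro tendsto_divide_0[OF tendsto_const] filterlim_at_top_imp_at_infinity
        filterlim_tendsto_add_at_top[OF tendsto_const])
    fix t :: real assume "0 \<le> t"
    then have "1 + t * r > 0" using assms by (simp add: add_pos_nonneg)
    then show "((\<lambda>t. - 1 / (1 + t * r)) has_real_derivative r / (1 + t * r) ^ 2) (at t)"
      by (auto intro!: derivative_eq_intros simp: power2_eq_square)
  qed (use assms in auto)
  finally show "(\<integral>\<^sup>+t. ennreal (r / (1 + t * r) ^ 2) * indicator {0<..} t \<partial>lborel) = 1"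
    by simp
qed

text \<open>The factor r^(1-n) cancels the polar Jacobian: in polar coordinates this is the measure
  (1 + r)^-2 dr times that of the sphere. It lets statements about almost every direction be made
  for almost every x, without polar coordinates.\<close>

definition radial_weight :: "'a::euclidean_space \<Rightarrow> real" where
  "radial_weight x = 1 / (norm x ^ (DIM('a) - 1) * (1 + norm x) ^ 2)"

lemma radial_weight_measurable [measurable]: "radial_weight \<in> borel_measurable borel"
  unfolding radial_weight_def by measurable

lemma radial_weight_nonneg: "0 \<le> radial_weight x"
  unfolding radial_weight_def by simp

text \<open>
  Integrating over a ray and then against a radial weight is, in polar coordinates, integration
  against \<open>|y|\<^sup>1\<^sup>-\<^sup>n\<close> times the total mass of \<open>(1 + r)\<^sup>-\<^sup>2\<close>.
\<close>

lemma nn_integral_rays: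
  fixes K :: "'a::euclidean_space \<Rightarrow> ennreal"
  assumes [measurable]: "K \<in> borel_measurable borel"
  shows "(\<integral>\<^sup>+x. ennreal (radial_weight x) *
           (\<integral>\<^sup>+t. K (t *\<^sub>R x) * ennreal (norm x) * indicator {0<..} t \<partial>lborel) \<partial>lborel)
       = (\<integral>\<^sup>+y. K y * ennreal (1 / norm y ^ (DIM('a) - 1)) \<partial>lborel)"
proof -
  define w where "w x = ennreal (radial_weight x * norm x)" for x :: 'a
  have [measurable]: "w \<in> borel_measurable borel" unfolding w_def by measurable
  have w: "ennreal (radial_weight x) * ennreal (norm x) = w x" for x :: 'a
    unfolding w_def by (simp add: ennreal_mult radial_weight_nonneg)
  have "(\<integral>\<^sup>+x. ennreal (radial_weight x) *
           (\<integral>\<^sup>+t. K (t *\<^sub>R x) * ennreal (norm x) * indicator {0<..} t \<partial>lborel) \<partial>lborel)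
     = (\<integral>\<^sup>+x. (\<integral>\<^sup>+t. w x * K (t *\<^sub>R x) * indicator {0<..} t \<partial>lborel) \<partial>lborel)"
    by (subst nn_integral_cmult[symmetric]) (auto simp: w[symmetric] mult_ac)
  also have "\<dots> = (\<integral>\<^sup>+t. (\<integral>\<^sup>+x. w x * K (t *\<^sub>R x) * indicator {0<..} t \<partial>lborel) \<partial>lborel)"
    by (rule lborel_pair.Fubini') measurable
  \<comment> \<open>For fixed t the substitution x = y / t frees K from t, after which the
    t-integral can be evaluated for fixed y.\<close>
  also have "\<dots> = (\<integral>\<^sup>+t. (\<integral>\<^sup>+y. ennreal ((1 / t) ^ DIM('a)) * (w ((1 / t) *\<^sub>R y) * K y) * indicator {0<..} t \<partial>lborel) \<partial>lborel)"
  proof (rule nn_integral_cong)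
    fix t :: real
    show "(\<integral>\<^sup>+x. w x * K (t *\<^sub>R x) * indicator {0<..} t \<partial>lborel) =
      (\<integral>\<^sup>+y. ennreal ((1 / t) ^ DIM('a)) * (w ((1 / t) *\<^sub>R y) * K y) * indicator {0<..} t \<partial>lborel)"
    proof (cases "t > 0")
      case True
      then show ?thesis
        by (subst nn_integral_scaleR[of _ "1 / t"]) (auto simp: indicator_def)
    qed (simp add: indicator_def)
  qed
  also have "\<dots> = (\<integral>\<^sup>+y. (\<integral>\<^sup>+t. ennreal ((1 / t) ^ DIM('a)) * (w ((1 / t) *\<^sub>R y) * K y) * indicator {0<..} t \<partial>lborel) \<partial>lborel)"
    by (rule lborel_pair.Fubini') measurable
  also have "\<dots> = (\<integral>\<^sup>+y. K y * ennreal (1 / norm y ^ (DIM('a) - 1)) \<partial>lborel)"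
  proof (rule nn_integral_cong_AE, rule AE_mp[OF AE_lborel_singleton[of "0::'a"]], rule AE_I2, rule impI)
    fix y :: 'a assume y: "y \<noteq> 0"
    define r where "r = norm y"
    have r: "r > 0" using y by (simp add: r_def)
    obtain m where m: "DIM('a) = Suc m" using DIM_positive[where 'a='a] by (cases "DIM('a)") auto
    \<comment> \<open>The Jacobian t^-n times weight and length at y / t splits into |y|^(1-n) and
      the first kernel of \<open>nn_integral_kernel\<close>, whose mass is 1.\<close>
    have "ennreal ((1 / t) ^ DIM('a)) * (w ((1 / t) *\<^sub>R y) * K y) * indicator {0<..} t
        = K y * ennreal (1 / r ^ m) * (ennreal (r / (t + r) ^ 2) * indicator {0<..} t)" for t
    proof (cases "t > 0")
      case True
      have tr: "(1 + r / t)\<^sup>2 = (t + r)\<^sup>2 / t\<^sup>2" using True by (simp add: field_simps power2_eq_square)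
      have "(1 / t) ^ Suc m * (1 / ((r / t) ^ m * (1 + r / t)\<^sup>2) * (r / t)) = 1 / r ^ m * (r / (t + r) ^ 2)"
        unfolding tr using True r by (simp add: divide_simps power2_eq_square)
      then have "ennreal ((1 / t) ^ DIM('a)) * w ((1 / t) *\<^sub>R y) = ennreal (1 / r ^ m) * ennreal (r / (t + r) ^ 2)"
        unfolding w_def radial_weight_def using True r
        by (simp add: ennreal_mult[symmetric] m r_def[symmetric])
      then show ?thesis by (metis (no_types, lifting) mult.commute mult.left_commute)
    qed simp
    then show "(\<integral>\<^sup>+t. ennreal ((1 / t) ^ DIM('a)) * (w ((1 / t) *\<^sub>R y) * K y) * indicator {0<..} t \<partial>lborel)
       = K y * ennreal (1 / norm y ^ (DIM('a) - 1))"
      by (simp add: nn_integral_cmult nn_integral_kernel(1)[OF r] m r_def[symmetric])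
  qed
  finally show ?thesis .
qed

text \<open>Each ray crosses the shell 1 \<le> |x| \<le> 2 in a segment of length 1, so the weight
  may be multiplied by the ray integral of the indicator of the shell. The formula for rays then
  turns the total mass into an integral over that bounded shell.\<close>

lemma nn_integral_radial_weight:
  "(\<integral>\<^sup>+x. ennreal (radial_weight (x::'a::euclidean_space)) \<partial>lborel) < \<infinity>"
proof -
  define S where "S = {x::'a. 1 \<le> norm x \<and> norm x \<le> 2}"
  have [measurable]: "S \<in> sets borel" unfolding S_def by measurable
  have "(\<integral>\<^sup>+x. ennreal (radial_weight (x::'a)) \<partial>lborel) =
    (\<integral>\<^sup>+x. ennreal (radial_weight x) *
      (\<integral>\<^sup>+t. indicator S (t *\<^sub>R x) * ennreal (norm x) * indicator {0<..} t \<partial>lborel) \<partial>lborel)"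
  proof (rule nn_integral_cong_AE, rule AE_mp[OF AE_lborel_singleton[of "0::'a"]], rule AE_I2, rule impI)
    fix x :: 'a assume x: "x \<noteq> 0"
    have "(indicator S (t *\<^sub>R x) :: ennreal) * ennreal (norm x) * indicator {0<..} t =
        ennreal (norm x) * indicator {1 / norm x..2 / norm x} t" for t
    proof (cases "t > 0")
      case True
      then show ?thesis using x by (auto simp: S_def indicator_def field_simps)
    next
      case False
      moreover have "1 / norm x > 0" using x by simp
      ultimately have "\<not> 1 / norm x \<le> t" by linarith
      then show ?thesis using False by (simp add: indicator_def)
    qed
    then have "(\<integral>\<^sup>+t. indicator S (t *\<^sub>R x) * ennreal (norm x) * indicator {0<..} t \<partial>lborel) =
      ennreal (norm x) * ennreal (2 / norm x - 1 / norm x)"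
      using x by (simp add: nn_integral_cmult divide_right_mono)
    also have "\<dots> = 1" using x by (subst ennreal_mult[symmetric]) (auto simp: field_simps)
    finally show "ennreal (radial_weight x) = ennreal (radial_weight x) *
      (\<integral>\<^sup>+t. indicator S (t *\<^sub>R x) * ennreal (norm x) * indicator {0<..} t \<partial>lborel)" by simp
  qed
  also have "\<dots> = (\<integral>\<^sup>+y. indicator S y * ennreal (1 / norm y ^ (DIM('a) - 1)) \<partial>lborel)"
    by (rule nn_integral_rays) measurable
  also have "\<dots> \<le> (\<integral>\<^sup>+y. indicator (cball 0 2) (y::'a) \<partial>lborel)"
  proof (rule nn_integral_mono)
    fix y :: 'a
    have "1 / norm y ^ (DIM('a) - 1) \<le> 1" if "1 \<le> norm y"
      using that by (simp add: divide_le_eq one_le_power)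
    then show "indicator S y * ennreal (1 / norm y ^ (DIM('a) - 1)) \<le> indicator (cball 0 2) y"
      by (auto simp: S_def indicator_def ennreal_le_1)
  qed
  also have "\<dots> < \<infinity>" using emeasure_lborel_cball_finite[of "0::'a" 2] by simp
  finally show ?thesis .
qed

text \<open>If y > c then y^(1-p) \<le> c^(1-p). This crude form of Young's inequality, with its
  free parameter c, takes the place of Hoelder's inequality.\<close>

lemma young_crude:
  fixes y c p :: real
  assumes "0 \<le> y" "0 < c" "1 \<le> p"
  shows "y \<le> c + c powr (1 - p) * y powr p"
proof (cases "y \<le> c")
  case True
  then show ?thesis by (simp add: add_increasing2)
next
  case False
  then have y: "y > 0" "c \<le> y" using assms by auto
  have "y = y powr (1 - p) * y powr p" using y by (simp flip: powr_add)
  also have "\<dots> \<le> c powr (1 - p) * y powr p"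
    using y assms by (intro mult_right_mono powr_mono2') auto
  finally show ?thesis using assms by simp
qed

text \<open>Hoelder's inequality on a ray: \<open>young_crude\<close> is applied to b t (1 + t r)^2,
  and the result is integrated against the probability density r / (1 + t r)^2.\<close>

lemma nn_integral_ray_bound:
  fixes b :: "real \<Rightarrow> real"
  assumes [measurable]: "b \<in> borel_measurable borel" and b: "\<And>t. 0 \<le> b t" and p: "1 < p" and r: "0 < r"
    and X: "(\<integral>\<^sup>+t. ennreal (b t powr p * (1 + t * r) powr (2 * (p - 1))) * ennreal r * indicator {0<..} t \<partial>lborel) = ennreal X"
    and X0: "0 \<le> X"
  shows "(\<integral>\<^sup>+t. ennreal (b t) * ennreal r * indicator {0<..} t \<partial>lborel) \<le> ennreal (2 * (1 + X) powr (1 / p))"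
proof -
  \<comment> \<open>This value balances the two terms, since c^(1-p) X \<le> c. The added 1 keeps c
    positive when X = 0.\<close>
  define c where "c = (1 + X) powr (1 / p)"
  have c: "c > 0" using X0 by (simp add: c_def)
  have cp: "c powr (1 - p) * X \<le> c"
  proof -
    have "c powr p = 1 + X" using X0 p by (simp add: c_def powr_powr)
    then have "c powr (1 - p) * X \<le> c powr (1 - p) * c powr p"
      by (intro mult_left_mono) auto
    also have "\<dots> = c" using c by (simp flip: powr_add)
    finally show ?thesis .
  qed
  have "(\<integral>\<^sup>+t. ennreal (b t) * ennreal r * indicator {0<..} t \<partial>lborel)
     \<le> (\<integral>\<^sup>+t. ennreal c * (ennreal (r / (1 + t * r) ^ 2) * indicator {0<..} t) +
         ennreal (c powr (1 - p)) * (ennreal (b t powr p * (1 + t * r) powr (2 * (p - 1))) * ennreal r * indicator {0<..} t) \<partial>lborel)"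
  proof (rule nn_integral_mono)
    fix t :: real
    show "ennreal (b t) * ennreal r * indicator {0<..} t \<le>
      ennreal c * (ennreal (r / (1 + t * r) ^ 2) * indicator {0<..} t) +
         ennreal (c powr (1 - p)) * (ennreal (b t powr p * (1 + t * r) powr (2 * (p - 1))) * ennreal r * indicator {0<..} t)"
    proof (cases "t > 0")
      case True
      define s where "s = 1 + t * r"
      have s: "s > 0" using True r by (simp add: s_def add_pos_pos)
      have s2: "s\<^sup>2 = s powr 2" using s by (simp add: powr_numeral)
      have "b t * s\<^sup>2 \<le> c + c powr (1 - p) * (b t * s\<^sup>2) powr p"
        using b[of t] c p by (intro young_crude) auto
      also have "(b t * s\<^sup>2) powr p = b t powr p * s powr (2 * (p - 1)) * s\<^sup>2"
      proof -
        have "s powr (2 * (p - 1)) * s\<^sup>2 = s powr (2 * p)"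
          unfolding s2 by (simp flip: powr_add add: algebra_simps)
        moreover have "s\<^sup>2 powr p = s powr (2 * p)"
          unfolding s2 by (simp add: powr_powr)
        ultimately show ?thesis using b[of t] s by (simp add: powr_mult mult.assoc)
      qed
      finally have "b t * s\<^sup>2 \<le> c + c powr (1 - p) * (b t powr p * s powr (2 * (p - 1))) * s\<^sup>2"
        by (simp add: mult_ac)
      then have "b t \<le> (c + c powr (1 - p) * (b t powr p * s powr (2 * (p - 1))) * s\<^sup>2) / s\<^sup>2"
        using s by (simp add: pos_le_divide_eq)
      also have "\<dots> = c / s\<^sup>2 + c powr (1 - p) * (b t powr p * s powr (2 * (p - 1)))"
        using s by (simp add: field_simps)
      finally have "b t * r \<le> (c / s\<^sup>2 + c powr (1 - p) * (b t powr p * s powr (2 * (p - 1)))) * r"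
        using r by (intro mult_right_mono) auto
      also have "\<dots> = c * (r / s\<^sup>2) + c powr (1 - p) * (b t powr p * s powr (2 * (p - 1)) * r)"
        by (simp add: field_simps)
      finally have "ennreal (b t * r) \<le> ennreal (c * (r / s\<^sup>2) + c powr (1 - p) * (b t powr p * s powr (2 * (p - 1)) * r))"
        by (rule ennreal_leI)
      then show ?thesis
        using True b[of t] r c s unfolding s_def[symmetric]
        by (simp add: ennreal_mult'[symmetric] ennreal_plus[symmetric] del: ennreal_plus)
    qed simp
  qed
  also have "\<dots> = ennreal c * 1 + ennreal (c powr (1 - p)) * ennreal X"
  proof -
    have "(\<integral>\<^sup>+t. ennreal c * (ennreal (r / (1 + t * r) ^ 2) * indicator {0<..} t) \<partial>lborel) = ennreal c * 1"
      by (subst nn_integral_cmult) (measurable, simp only: nn_integral_kernel(2)[OF r])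
    moreover have "(\<integral>\<^sup>+t. ennreal (c powr (1 - p)) *
        (ennreal (b t powr p * (1 + t * r) powr (2 * (p - 1))) * ennreal r * indicator {0<..} t) \<partial>lborel)
        = ennreal (c powr (1 - p)) * ennreal X"
      by (subst nn_integral_cmult) (measurable, simp only: X)
    ultimately show ?thesis by (subst nn_integral_add) auto
  qed
  also have "\<dots> = ennreal (c + c powr (1 - p) * X)"
    using c X0 by (simp add: ennreal_mult'[symmetric] ennreal_plus[symmetric] del: ennreal_plus)
  also have "\<dots> \<le> ennreal (2 * c)"
    using cp by (intro ennreal_leI) auto
  finally show ?thesis unfolding c_def .
qed

text \<open>Integration by arc length over the full ray through x. For x \<noteq> 0 the value
  depends on the direction of x only, which is why it can bound the integral up to x uniformly in
  the radius.\<close>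

definition ray_integral :: "('a::euclidean_space \<Rightarrow> real) \<Rightarrow> 'a \<Rightarrow> ennreal" where
  "ray_integral B x = (\<integral>\<^sup>+t. ennreal (B (t *\<^sub>R x)) * ennreal (norm x) * indicator {0<..} t \<partial>lborel)"

lemma ray_integral_measurable [measurable]:
  assumes [measurable]: "B \<in> borel_measurable borel"
  shows "ray_integral B \<in> borel_measurable borel"
  unfolding ray_integral_def by measurable

text \<open>
  A Hardy inequality: the weight is \<open>(1 + r)\<^sup>-\<^sup>2\<close> in polar coordinates on the left-hand side, and
  \<open>(1 + r)\<close> to the power \<open>2 (p - 1)\<close> in the hypothesis.
\<close>

lemma ray_integral_bound:
  fixes B :: "'a::euclidean_space \<Rightarrow> real"
  assumes [measurable]: "B \<in> borel_measurable borel" and B: "\<And>x. 0 \<le> B x" and p: "1 < p"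
    and fin: "(\<integral>\<^sup>+y. ennreal (B y powr p * (1 + norm y) powr (2 * (p - 1))) * ennreal (1 / norm y ^ (DIM('a) - 1)) \<partial>lborel) < \<infinity>"
  shows "AE x in lborel. ray_integral B x < \<infinity>"
    and "(\<integral>\<^sup>+x. ennreal (radial_weight x) * ennreal (enn2real (ray_integral B x) powr p) \<partial>lborel) < \<infinity>"
proof -
  define K where "K y = ennreal (B y powr p * (1 + norm y) powr (2 * (p - 1)))" for y
  have [measurable]: "K \<in> borel_measurable borel" unfolding K_def by measurable
  define X where "X x = (\<integral>\<^sup>+t. K (t *\<^sub>R x) * ennreal (norm x) * indicator {0<..} t \<partial>lborel)" for x
  have [measurable]: "X \<in> borel_measurable borel" unfolding X_def by measurable
  have fX: "(\<integral>\<^sup>+x. ennreal (radial_weight x) * X x \<partial>lborel) < \<infinity>"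
    using fin unfolding X_def nn_integral_rays[OF \<open>K \<in> borel_measurable borel\<close>] by (simp add: K_def)
  have "AE x in lborel. ennreal (radial_weight x) * X x \<noteq> \<infinity>"
    by (rule nn_integral_PInf_AE) (use fX in auto)
  then have "AE x in lborel. X x < \<infinity> \<and> x \<noteq> 0"
    using AE_lborel_singleton[of "0::'a"]
  proof eventually_elim
    case (elim x)
    then have "radial_weight x > 0" unfolding radial_weight_def
      by (intro divide_pos_pos mult_pos_pos zero_less_power add_pos_nonneg) auto
    then show ?case using elim by (auto simp: ennreal_mult_eq_top_iff less_top)
  qed
  then have bound: "AE x in lborel. X x < \<infinity> \<and> ray_integral B x \<le> ennreal (2 * (1 + enn2real (X x)) powr (1 / p))"
  proof eventually_elim
    case (elim x)
    have "ray_integral B x \<le> ennreal (2 * (1 + enn2real (X x)) powr (1 / p))"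
      unfolding ray_integral_def
    proof (rule nn_integral_ray_bound[OF _ _ p])
      show "(\<integral>\<^sup>+t. ennreal (B (t *\<^sub>R x) powr p * (1 + t * norm x) powr (2 * (p - 1))) * ennreal (norm x) * indicator {0<..} t \<partial>lborel)
          = ennreal (enn2real (X x))"
      proof -
        have "X x = ennreal (enn2real (X x))" using elim by simp
        moreover have "X x = (\<integral>\<^sup>+t. ennreal (B (t *\<^sub>R x) powr p * (1 + t * norm x) powr (2 * (p - 1))) * ennreal (norm x) * indicator {0<..} t \<partial>lborel)"
          unfolding X_def K_def by (rule nn_integral_cong) (auto simp: indicator_def)
        ultimately show ?thesis by simp
      qed
    qed (use elim B in auto)
    then show ?case using elim by simp
  qed
  then show "AE x in lborel. ray_integral B x < \<infinity>"
    by eventually_elim (auto intro: le_less_trans)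
  have "(\<integral>\<^sup>+x. ennreal (radial_weight x) * ennreal (enn2real (ray_integral B x) powr p) \<partial>lborel)
      \<le> (\<integral>\<^sup>+x. ennreal (2 powr p) * (ennreal (radial_weight x) + ennreal (radial_weight x) * X x) \<partial>lborel)"
  proof (rule nn_integral_mono_AE, use bound in eventually_elim)
    case (elim x)
    then have "enn2real (ray_integral B x) \<le> 2 * (1 + enn2real (X x)) powr (1 / p)"
      by (intro enn2real_leI) auto
    then have "enn2real (ray_integral B x) powr p \<le> (2 * (1 + enn2real (X x)) powr (1 / p)) powr p"
      using p by (intro powr_mono2) auto
    also have "\<dots> = 2 powr p * (1 + enn2real (X x))"
      using p by (simp add: powr_mult powr_powr)
    finally have "ennreal (radial_weight x) * ennreal (enn2real (ray_integral B x) powr p) \<le>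
        ennreal (radial_weight x) * ennreal (2 powr p * (1 + enn2real (X x)))"
      by (intro mult_left_mono ennreal_leI) auto
    also have "\<dots> = ennreal (2 powr p) * (ennreal (radial_weight x) + ennreal (radial_weight x) * ennreal (enn2real (X x)))"
      by (simp add: ennreal_mult distrib_left mult_ac)
    finally show ?case using elim by simp
  qed
  also have "\<dots> < \<infinity>"
    using fX nn_integral_radial_weight[where 'a='a]
    by (simp add: nn_integral_cmult nn_integral_add ennreal_mult_less_top)
  finally show "(\<integral>\<^sup>+x. ennreal (radial_weight x) * ennreal (enn2real (ray_integral B x) powr p) \<partial>lborel) < \<infinity>" .
qed

section \<open>Measurability and volume\<close>

lemma test_form_continuous: "test_form l \<omega> \<Longrightarrow> continuous_on UNIV (\<lambda>x. \<omega> x v)"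
  unfolding test_form_def using smooth_continuous by blast

text \<open>Integrability over compact sets makes the truncations to balls measurable, and the
  coefficient is their pointwise limit.\<close>

lemma loc_integrable_measurable:
  assumes "loc_integrable_form k \<theta>"
  shows "(\<lambda>x. \<theta> x v) \<in> borel_measurable lebesgue"
proof (rule borel_measurable_LIMSEQ_real)
  fix m :: nat
  have "(\<lambda>x. \<theta> x v) absolutely_integrable_on cball 0 (real m)"
    using assms unfolding loc_integrable_form_def by auto
  then show "(\<lambda>x. indicator (cball 0 (real m)) x *\<^sub>R \<theta> x v) \<in> borel_measurable lebesgue"
    unfolding set_integrable_def by (rule borel_measurable_integrable)
next
  fix x :: "real^'a"
  obtain N :: nat where N: "norm x \<le> real N" using real_arch_simple by blast
  have "eventually (\<lambda>m. indicator (cball 0 (real m)) x *\<^sub>R \<theta> x v = \<theta> x v) sequentially"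
    using eventually_ge_at_top[of N] by eventually_elim (use N in \<open>auto simp: indicator_def\<close>)
  then show "(\<lambda>m. indicator (cball 0 (real m)) x *\<^sub>R \<theta> x v) \<longlonglongrightarrow> \<theta> x v"
    by (rule tendsto_eventually)
qed

text \<open>Lebesgue measurable coefficients need not be jointly measurable for the product of the
  Borel structures after composition with (t, x) -> t x. Fubini is therefore applied to forms with
  Borel coefficients.\<close>

definition borel_form :: "nat \<Rightarrow> 'n::finite form \<Rightarrow> bool" where
  "borel_form k \<theta> \<longleftrightarrow> (\<forall>x. alternating k (\<theta> x)) \<and> (\<forall>v. (\<lambda>x. \<theta> x v) \<in> borel_measurable borel)"

lemma borel_formD:
  assumes "borel_form k \<theta>"
  shows "alternating k (\<theta> x)" "(\<lambda>x. \<theta> x v) \<in> borel_measurable borel"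
  using assms unfolding borel_form_def by auto

lemma covector_expand:
  fixes \<alpha> :: "'n::finite covector"
  assumes "alternating k \<alpha>"
  shows "\<alpha> v = (\<Sum>J\<in>{..<k} \<rightarrow>\<^sub>E UNIV. (\<Prod>a<k. v a $ J a) * \<alpha> (\<lambda>a. axis (J a) 1))"
  by (rule alternating_expand[OF assms]) (auto intro: vec_expand)

text \<open>Each of the finitely many components agrees with a Borel function off a null set.
  Setting the whole form to 0 on one common Borel null set, instead of changing single components,
  keeps it alternating at every point.\<close>

lemma borel_version:
  fixes \<theta> :: "'n::finite form"
  assumes \<theta>: "loc_integrable_form k \<theta>"
  obtains \<theta>' where "borel_form k \<theta>'" "AE x in lborel. \<theta>' x = \<theta> x"
proof -
  let ?P = "{..<k} \<rightarrow>\<^sub>E (UNIV :: 'n set)"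
  have alt: "alternating k (\<theta> x)" for x using \<theta> unfolding loc_integrable_form_def by blast
  have "\<exists>g\<in>borel_measurable lborel. AE x in lborel. \<theta> x (\<lambda>a. axis (J a) 1) = g x" for J :: "nat \<Rightarrow> 'n"
    by (rule completion_ex_borel_measurable_real) (rule loc_integrable_measurable[OF \<theta>])
  then obtain G where G: "\<And>J. G J \<in> borel_measurable lborel" "\<And>J. AE x in lborel. \<theta> x (\<lambda>a. axis (J a) 1) = G J x"
    by metis
  have "AE x in lborel. \<forall>J\<in>?P. \<theta> x (\<lambda>a. axis (J a) 1) = G J x"
    by (rule AE_finite_allI) (auto simp: finite_PiE G)
  then obtain N where N: "N \<in> null_sets lborel" "{x. \<not> (\<forall>J\<in>?P. \<theta> x (\<lambda>a. axis (J a) 1) = G J x)} \<subseteq> N"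
    by (auto elim!: AE_E simp: null_sets_def)
  define \<theta>' where "\<theta>' x v = (if x \<in> N then 0 else \<theta> x v)" for x v
  have [measurable]: "N \<in> sets borel" using N(1) by auto
  show thesis
  proof
    show "AE x in lborel. \<theta>' x = \<theta> x"
      using AE_not_in[OF N(1)] by eventually_elim (auto simp: \<theta>'_def)
    show "borel_form k \<theta>'"
      unfolding borel_form_def
    proof (intro conjI allI)
      fix x show "alternating k (\<theta>' x)"
        unfolding \<theta>'_def by (cases "x \<in> N") (auto simp: alternating_zero alt)
    next
      fix v
      have "\<theta>' x v = (\<Sum>J\<in>?P. (\<Prod>a<k. v a $ J a) * (if x \<in> N then 0 else G J x))" for x
      proof (cases "x \<in> N")
        case False
        then have "\<forall>J\<in>?P. \<theta> x (\<lambda>a. axis (J a) 1) = G J x" using N(2) by blast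
        then show ?thesis unfolding \<theta>'_def using False covector_expand[OF alt, of x v] by simp
      qed (simp add: \<theta>'_def)
      then show "(\<lambda>x. \<theta>' x v) \<in> borel_measurable borel"
        using G(1) by simp
    qed
  qed
qed

text \<open>By Cramer's rule the entries are quotients of continuous functions with nonvanishing
  denominator.\<close>

lemma matrix_inv_measurable:
  fixes g :: "'n::finite metric"
  assumes g: "riemannian_metric g"
  shows "(\<lambda>x. matrix_inv (gram g x) $ i $ j) \<in> borel_measurable borel"
proof -
  have eq: "matrix_inv (gram g x) $ i $ j = det (\<chi> r s. if s = i then axis j 1 $ r else gram g x $ r $ s) / det (gram g x)" for x
  proof -
    have "invertible (gram g x)" using det_gram_pos[OF g, of x] by (simp add: invertible_det_nz)
    then have "gram g x ** matrix_inv (gram g x) = mat 1"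
      unfolding invertible_def matrix_inv_def by (rule someI2_ex) blast
    then have "gram g x *v (matrix_inv (gram g x) *v axis j 1) = axis j 1"
      by (simp add: matrix_vector_mul_assoc)
    then have "matrix_inv (gram g x) *v axis j 1 = (\<chi> k. det (\<chi> r s. if s = k then axis j 1 $ r else gram g x $ r $ s) / det (gram g x))"
      using det_gram_pos[OF g, of x] by (subst (asm) cramer) auto
    moreover have "(matrix_inv (gram g x) *v axis j 1) $ i = matrix_inv (gram g x) $ i $ j"
      by (simp add: matrix_vector_mult_basis column_def)
    ultimately show ?thesis by simp
  qed
  have "continuous_on UNIV (\<lambda>x. (if s = i then axis j 1 $ r else gram g x $ r $ s) :: real)" for r s
    by (cases "s = i") (auto intro: continuous_on_gram[OF g])
  then have "continuous_on UNIV (\<lambda>x. det (\<chi> r s. if s = i then axis j 1 $ r else gram g x $ r $ s))"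
    unfolding det_def by (intro continuous_intros) auto
  then have "continuous_on UNIV (\<lambda>x. matrix_inv (gram g x) $ i $ j)"
    unfolding eq using det_gram_pos[OF g]
    by (intro continuous_on_divide continuous_on_det_gram[OF g]) (auto simp: less_imp_neq[symmetric])
  then show ?thesis by (rule borel_measurable_continuous_onI)
qed

lemma covector_norm_measurable:
  fixes g :: "'n::finite metric"
  assumes g: "riemannian_metric g" and \<theta>: "\<And>v. (\<lambda>x. \<theta> x v) \<in> borel_measurable lebesgue"
  shows "(\<lambda>x. covector_norm g k x (\<theta> x)) \<in> borel_measurable lebesgue"
proof -
  have [measurable]: "(\<lambda>x. matrix_inv (gram g x) $ i $ j) \<in> borel_measurable lebesgue" for i j
    using matrix_inv_measurable[OF g] by (auto intro: measurable_completion)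
  note [measurable] = \<theta>
  show ?thesis unfolding covector_norm_def by measurable
qed

lemma vol_density_measurable:
  fixes g :: "'n::finite metric"
  assumes g: "riemannian_metric g"
  shows "(\<lambda>x. sqrt (det (gram g x))) \<in> borel_measurable lebesgue"
proof -
  have "(\<lambda>x. sqrt (det (gram g x))) \<in> borel_measurable borel"
    by (intro borel_measurable_continuous_onI continuous_intros continuous_on_det_gram[OF g])
  then show ?thesis by (auto intro: measurable_completion)
qed

lemma nn_integral_vol:
  fixes g :: "'n::finite metric"
  assumes g: "riemannian_metric g" and "f \<in> borel_measurable lebesgue"
  shows "(\<integral>\<^sup>+x. f x \<partial>vol g) = (\<integral>\<^sup>+x. ennreal (sqrt (det (gram g x))) * f x \<partial>lebesgue)"
  unfolding vol_def using vol_density_measurable[OF g] assms(2) by (subst nn_integral_density) auto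

lemma AE_vol:
  fixes g :: "'n::finite metric"
  assumes g: "riemannian_metric g"
  shows "(AE x in vol g. P x) \<longleftrightarrow> (AE x in lebesgue. P x)"
  unfolding vol_def using vol_density_measurable[OF g] det_gram_pos[OF g]
  by (subst AE_density) auto

text \<open>For s > 0 put c = a / s. With K large, 1 + r \<le> K (1 + c r) \<le> K exp (c r), and
  the power s of the right-hand side is K^s exp (a r).\<close>

lemma exp_dominates:
  assumes "a > (0::real)" "s \<ge> 0"
  obtains C where "C > 0" "\<And>r. r \<ge> 0 \<Longrightarrow> exp (- r) powr a * (1 + r) powr s \<le> C"
proof (cases "s = 0")
  case True
  show thesis
  proof (rule that[of 1])
    fix r :: real assume "r \<ge> 0"
    then show "exp (- r) powr a * (1 + r) powr s \<le> 1" using assms True by (simp add: powr_def)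
  qed simp
next
  case False
  define c where "c = a / s"
  define K where "K = max 1 (1 / c)"
  have c: "c > 0" "c * s = a" using assms False by (auto simp: c_def)
  have K: "K \<ge> 1" "K * c \<ge> 1" using c by (auto simp: K_def max_def field_simps)
  show thesis
  proof (rule that[of "K powr s"])
    fix r :: real assume r: "r \<ge> 0"
    have "1 + r \<le> K * (1 + c * r)"
      using K r mult_right_mono[of 1 "K * c" r] by (simp add: algebra_simps)
    also have "\<dots> \<le> K * exp (c * r)"
      using K exp_ge_add_one_self[of "c * r"] by (intro mult_left_mono) auto
    finally have "(1 + r) powr s \<le> (K * exp (c * r)) powr s"
      using r assms by (intro powr_mono2) auto
    also have "\<dots> = K powr s * exp (a * r)"
      using K c by (simp add: powr_mult powr_def[of "exp _"] mult_ac)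
    finally have "exp (- r) powr a * (1 + r) powr s \<le> exp (- r) powr a * (K powr s * exp (a * r))"
      by (intro mult_left_mono) auto
    also have "\<dots> = K powr s" by (simp add: powr_def[of "exp _"] flip: exp_add)
    finally show "exp (- r) powr a * (1 + r) powr s \<le> K powr s" .
  qed (use K in simp)
qed

text \<open>\<open>norm x / stretch x\<close> is \<open>min r (exp (- r))\<close>, comparable to the radius of the sphere \<open>{r} \<times> S\<close>.\<close>

lemma norm_div_stretch_le: "norm x / stretch x \<le> exp (- norm x)"
proof -
  have "norm x * exp (norm x) \<le> stretch x" by (simp add: stretch_def)
  then show ?thesis using stretch_ge_1[of x] by (simp add: exp_minus field_simps)
qed

lemma radius_dominates:
  assumes "a > (0::real)" "s \<ge> 0"
  obtains C where "C > 0" "\<And>x::real^'n::finite. (norm x / stretch x) powr a * (1 + norm x) powr s \<le> C"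
proof -
  obtain C where C: "C > 0" "\<And>r. r \<ge> 0 \<Longrightarrow> exp (- r) powr a * (1 + r) powr s \<le> C"
    using exp_dominates[OF assms] by metis
  show thesis
  proof (rule that[OF C(1)])
    fix x :: "real^'n"
    have "(norm x / stretch x) powr a \<le> exp (- norm x) powr a"
      using norm_div_stretch_le[of x] stretch_ge_1[of x] assms by (intro powr_mono2) auto
    then have "(norm x / stretch x) powr a * (1 + norm x) powr s \<le> exp (- norm x) powr a * (1 + norm x) powr s"
      by (rule mult_right_mono) simp
    also have "\<dots> \<le> C" by (rule C(2)) simp
    finally show "(norm x / stretch x) powr a * (1 + norm x) powr s \<le> C" .
  qed
qed

text \<open>The density is at most a multiple of \<open>stretch\<close> to the power 1 - n, and this
  is at most a multiple of \<open>radial_weight\<close>, because the power n - 1 of r /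
  \<open>stretch\<close> decays exponentially and absorbs (1 + r)^2. Here n \<ge> 2 makes the
  exponent positive.\<close>

lemma finite_volume:
  fixes g :: "'n::finite metric"
  assumes n: "2 \<le> CARD('n)" and g: "riemannian_metric g" and "cusp_end g"
  shows "(\<integral>\<^sup>+x. ennreal (sqrt (det (gram g x))) \<partial>lborel) < \<infinity>"
proof -
  let ?n = "CARD('n) - 1"
  obtain C1 where C1: "0 < C1" "\<And>x. sqrt (det (gram g x)) * stretch x ^ ?n \<le> C1"
    using cusp_bounds[OF assms(2,3), of 0] by metis
  obtain C2 where C2: "C2 > 0" "\<And>x::real^'n. (norm x / stretch x) powr real ?n * (1 + norm x) powr 2 \<le> C2"
    using radius_dominates[of "real ?n" 2] n by auto
  have "(\<integral>\<^sup>+x. ennreal (sqrt (det (gram g x))) \<partial>lborel) \<le> (\<integral>\<^sup>+x. ennreal (C1 * C2) * ennreal (radial_weight (x::real^'n)) \<partial>lborel)"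
  proof (rule nn_integral_mono_AE, rule AE_mp[OF AE_lborel_singleton[of 0]], rule AE_I2, rule impI)
    fix x :: "real^'n" assume x: "x \<noteq> 0"
    let ?s = "stretch x" and ?r = "norm x"
    have s: "?s > 0" using stretch_ge_1[of x] by simp
    have "?r ^ ?n / ?s ^ ?n * (1 + ?r) ^ 2 \<le> C2"
    proof -
      have "(?r / ?s) powr real ?n = ?r ^ ?n / ?s ^ ?n" using x s
        by (subst powr_realpow) (simp_all add: power_divide)
      moreover have "(1 + ?r) powr 2 = (1 + ?r)\<^sup>2" by (simp add: powr_numeral add_nonneg_eq_0_iff)
      ultimately show ?thesis using C2(2)[of x] by simp
    qed
    then have "1 / ?s ^ ?n \<le> C2 * radial_weight x"
    proof -
      let ?q = "?r ^ ?n * (1 + ?r) ^ 2"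
      have q: "?q > 0" using x by (intro mult_pos_pos zero_less_power add_pos_nonneg) auto
      have sn: "?s ^ ?n > 0" using s by simp
      have "?q * (1 / ?s ^ ?n) \<le> C2" using \<open>?r ^ ?n / ?s ^ ?n * (1 + ?r) ^ 2 \<le> C2\<close> by simp
      then have "1 / ?s ^ ?n \<le> C2 / ?q" using q by (simp only: pos_le_divide_eq mult.commute)
      then show ?thesis unfolding radial_weight_def by simp
    qed
    moreover have "sqrt (det (gram g x)) \<le> C1 * (1 / ?s ^ ?n)"
      using C1(2)[of x] s by (simp add: field_simps)
    ultimately have "sqrt (det (gram g x)) \<le> C1 * (C2 * radial_weight x)"
      using C1(1) by (meson mult_left_mono order_trans less_imp_le)
    then show "ennreal (sqrt (det (gram g x))) \<le> ennreal (C1 * C2) * ennreal (radial_weight x)"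
      using C1 C2 by (simp add: ennreal_mult''[symmetric] radial_weight_nonneg mult_ac ennreal_leI)
  qed
  also have "\<dots> < \<infinity>"
    using nn_integral_radial_weight[where 'a="real^'n"] by (simp add: nn_integral_cmult ennreal_mult_less_top)
  finally show ?thesis .
qed

text \<open>Since the volume is finite, the exponent \<open>\<infinity>\<close> can be replaced by a finite one.\<close>

lemma Lp_forms_real_exponent:
  fixes g :: "'n::finite metric"
  assumes n: "2 \<le> CARD('n)" and g: "riemannian_metric g" and cusp: "cusp_end g"
    and \<theta>: "\<theta> \<in> Lp_forms g k p" and p0: "0 < p0" "ennreal p0 < p"
  obtains p1 where "p0 < p1"
    "(\<integral>\<^sup>+x. ennreal (sqrt (det (gram g x))) * ennreal (covector_norm g k x (\<theta> x) powr p1) \<partial>lborel) < \<infinity>"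
proof -
  have li: "loc_integrable_form k \<theta>" using \<theta> unfolding Lp_forms_def by blast
  have [measurable]: "(\<lambda>x. covector_norm g k x (\<theta> x)) \<in> borel_measurable lebesgue"
    by (rule covector_norm_measurable[OF g loc_integrable_measurable[OF li]])
  have nn: "0 \<le> covector_norm g k x (\<theta> x)" for x
    using li covector_norm_nonneg[OF g] unfolding loc_integrable_form_def by blast
  show thesis
  proof (cases "p = \<infinity>")
    case True
    then obtain C where "AE x in lebesgue. covector_norm g k x (\<theta> x) \<le> C"
      using \<theta> AE_vol[OF g] unfolding Lp_forms_def by auto
    then have "(\<integral>\<^sup>+x. ennreal (sqrt (det (gram g x))) * ennreal (covector_norm g k x (\<theta> x) powr (p0 + 1)) \<partial>lebesgue)
      \<le> (\<integral>\<^sup>+x. ennreal (sqrt (det (gram g x))) * ennreal (C powr (p0 + 1)) \<partial>lebesgue)"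
      by (intro nn_integral_mono_AE) (auto elim!: eventually_mono intro!: mult_left_mono ennreal_leI powr_mono2 nn simp: less_imp_le p0)
    also have "\<dots> = (\<integral>\<^sup>+x. ennreal (sqrt (det (gram g x))) \<partial>lebesgue) * ennreal (C powr (p0 + 1))"
      using vol_density_measurable[OF g] by (subst nn_integral_multc) auto
    also have "\<dots> < \<infinity>"
      using finite_volume[OF n g cusp] by (simp add: nn_integral_completion ennreal_mult_less_top)
    finally show thesis using that[of "p0 + 1"] by (simp add: nn_integral_completion)
  next
    case False
    define p1 where "p1 = enn2real p"
    have p: "p = ennreal p1" using False by (simp add: p1_def less_top)
    have "p0 < p1" using p0 unfolding p by (simp add: ennreal_less_iff)
    moreover have "integrable (vol g) (\<lambda>x. covector_norm g k x (\<theta> x) powr p1)"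
      using \<theta> False unfolding Lp_forms_def p1_def by simp
    then have "(\<integral>\<^sup>+x. ennreal (norm (covector_norm g k x (\<theta> x) powr p1)) \<partial>vol g) < \<infinity>"
      unfolding integrable_iff_bounded by blast
    then have "(\<integral>\<^sup>+x. ennreal (sqrt (det (gram g x))) * ennreal (covector_norm g k x (\<theta> x) powr p1) \<partial>lborel) < \<infinity>"
      by (subst (asm) nn_integral_vol[OF g]) (simp_all add: nn_integral_completion)
    ultimately show thesis by (rule that)
  qed
qed

section \<open>The cone operator\<close>

text \<open>Up to a constant depending on v, the mass dominates the cone integrand, and it does not
  itself involve v. Convergence is thus tested once for each x, and the default value is taken for
  all v simultaneously, which keeps \<open>cone\<close> alternating.\<close>

definition cone_mass :: "nat \<Rightarrow> 'n::finite form \<Rightarrow> real^'n \<Rightarrow> ennreal" where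
  "cone_mass m \<theta> x =
     (\<integral>\<^sup>+t. ennreal (t ^ m * comp_norm m (\<lambda>v. \<theta> (t *\<^sub>R x) (case_nat x v))) * indicator {0<..1} t \<partial>lborel)"

text \<open>
  The cone operator of the Poincare lemma. The value \<open>0\<close> is a default for the null set of rays on
  which the integral diverges.
\<close>

definition cone :: "nat \<Rightarrow> 'n::finite form \<Rightarrow> 'n form" where
  "cone m \<theta> x v =
     (if cone_mass m \<theta> x < \<infinity>
      then LINT t|lborel. indicator {0<..1} t * (t ^ m * \<theta> (t *\<^sub>R x) (case_nat x v)) else 0)"

text \<open>The inserted vector x varies with the point, so it is expanded in coordinates; what
  remains are Borel coefficients composed with (t, x) -> t x.\<close>

lemma ray_measurable:
  fixes \<theta> :: "'n::finite form"
  assumes \<theta>: "borel_form (Suc m) \<theta>"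
  shows "(\<lambda>(t, x). \<theta> (t *\<^sub>R x) (case_nat x v)) \<in> borel_measurable (borel \<Otimes>\<^sub>M borel)"
proof -
  note [measurable] = borel_formD(2)[OF \<theta>]
  have eq: "(\<lambda>(t, x). \<theta> (t *\<^sub>R x) (case_nat x v)) = (\<lambda>(t, x). \<Sum>i\<in>UNIV. x $ i * \<theta> (t *\<^sub>R x) (case_nat (axis i 1) v))"
    by (intro ext, clarify) (rule case_nat_expand[OF borel_formD(1)[OF \<theta>]])
  have [measurable]: "(\<lambda>x::real^'n. x $ i) \<in> borel_measurable borel" for i
    by (rule borel_measurable_continuous_onI) (intro continuous_intros)
  show ?thesis unfolding eq by measurable
qed

lemma ray_comp_norm_measurable:
  fixes \<theta> :: "'n::finite form"
  assumes \<theta>: "borel_form (Suc m) \<theta>"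
  shows "(\<lambda>(t, x). comp_norm m (\<lambda>v. \<theta> (t *\<^sub>R x) (case_nat x v))) \<in> borel_measurable (borel \<Otimes>\<^sub>M borel)"
proof -
  note [measurable] = ray_measurable[OF \<theta>]
  show ?thesis unfolding comp_norm_def by measurable
qed

lemma cone_mass_measurable:
  fixes \<theta> :: "'n::finite form"
  assumes \<theta>: "borel_form (Suc m) \<theta>"
  shows "cone_mass m \<theta> \<in> borel_measurable borel"
proof -
  have [measurable]: "(\<lambda>(x, t). comp_norm m (\<lambda>v. \<theta> (t *\<^sub>R x) (case_nat x v))) \<in> borel_measurable (borel \<Otimes>\<^sub>M borel)"
    using measurable_pair_swap[OF ray_comp_norm_measurable[OF \<theta>]] by simp
  show ?thesis unfolding cone_mass_def by measurable
qed

lemma abs_le_comp_norm_vectors: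
  fixes \<alpha> :: "'n::finite covector"
  assumes "alternating k \<alpha>"
  shows "\<bar>\<alpha> v\<bar> \<le> (1 + (\<Sum>a<k. norm (v a))) ^ k * comp_norm k \<alpha>"
  unfolding comp_norm_def
proof (rule alternating_expand_bound[OF assms])
  show "v a = (\<Sum>m\<in>UNIV. (v a $ m) *\<^sub>R axis m 1)" for a by (rule vec_expand)
  fix M :: "nat \<Rightarrow> 'n" and a assume "a < k"
  have "\<bar>v a $ M a\<bar> \<le> norm (v a)" by (rule component_le_norm_cart)
  also have "\<dots> \<le> (\<Sum>a<k. norm (v a))" using \<open>a < k\<close> by (intro member_le_sum) auto
  finally show "\<bar>v a $ M a\<bar> \<le> 1 + (\<Sum>a<k. norm (v a))" by simp
qed simp

lemma cone_integrable:
  fixes \<theta> :: "'n::finite form"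
  assumes \<theta>: "borel_form (Suc m) \<theta>" and fin: "cone_mass m \<theta> x < \<infinity>"
  shows "integrable lborel (\<lambda>t. indicator {0<..1} t * (t ^ m * \<theta> (t *\<^sub>R x) (case_nat x v)))"
proof -
  have [measurable]: "(\<lambda>t. \<theta> (t *\<^sub>R x) (case_nat x w)) \<in> borel_measurable borel" for w
    by (rule measurable_compose[OF _ borel_formD(2)[OF \<theta>]]) measurable
  define c where "c = (1 + (\<Sum>a<m. norm (v a))) ^ m"
  have c: "c \<ge> 0" unfolding c_def by (intro zero_le_power add_nonneg_nonneg sum_nonneg) auto
  have [measurable]: "(\<lambda>t. comp_norm m (\<lambda>v. \<theta> (t *\<^sub>R x) (case_nat x v))) \<in> borel_measurable borel"
    unfolding comp_norm_def by measurable
  have "(\<integral>\<^sup>+t. ennreal (norm (indicator {0<..1} t * (t ^ m * \<theta> (t *\<^sub>R x) (case_nat x v)))) \<partial>lborel)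
    \<le> (\<integral>\<^sup>+t. ennreal c * (ennreal (t ^ m * comp_norm m (\<lambda>v. \<theta> (t *\<^sub>R x) (case_nat x v))) * indicator {0<..1} t) \<partial>lborel)"
  proof (rule nn_integral_mono)
    fix t :: real
    have "\<bar>\<theta> (t *\<^sub>R x) (case_nat x v)\<bar> \<le> c * comp_norm m (\<lambda>v. \<theta> (t *\<^sub>R x) (case_nat x v))"
      unfolding c_def
      by (rule abs_le_comp_norm_vectors) (rule alternating_interior[OF borel_formD(1)[OF \<theta>]])
    then have "t ^ m * \<bar>\<theta> (t *\<^sub>R x) (case_nat x v)\<bar> \<le> t ^ m * (c * comp_norm m (\<lambda>v. \<theta> (t *\<^sub>R x) (case_nat x v)))" if "t > 0"
      using that by (intro mult_left_mono) auto
    then show "ennreal (norm (indicator {0<..1} t * (t ^ m * \<theta> (t *\<^sub>R x) (case_nat x v)))) \<le>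
        ennreal c * (ennreal (t ^ m * comp_norm m (\<lambda>v. \<theta> (t *\<^sub>R x) (case_nat x v))) * indicator {0<..1} t)"
      using c by (auto simp: indicator_def abs_mult ennreal_mult'[symmetric] mult_ac intro!: ennreal_leI)
  qed
  also have "\<dots> = ennreal c * cone_mass m \<theta> x"
    unfolding cone_mass_def by (subst nn_integral_cmult) auto
  also have "\<dots> < \<infinity>" using fin by (simp add: ennreal_mult_less_top)
  finally show ?thesis by (intro integrableI_bounded) auto
qed

lemma alternating_cone:
  fixes \<theta> :: "'n::finite form"
  assumes \<theta>: "borel_form (Suc m) \<theta>"
  shows "alternating m (cone m \<theta> x)"
proof (cases "cone_mass m \<theta> x < \<infinity>")
  case False
  then show ?thesis unfolding cone_def by (simp add: alternating_zero)
next
  case True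
  note alt = alternating_interior[OF borel_formD(1)[OF \<theta>]]
  let ?h = "\<lambda>v t. indicator {0<..1} t * (t ^ m * \<theta> (t *\<^sub>R x) (case_nat x v))"
  have cone: "cone m \<theta> x v = (LINT t|lborel. ?h v t)" for v using True by (simp add: cone_def)
  note int = cone_integrable[OF \<theta> True]
  show ?thesis
    unfolding alternating_def
  proof (intro conjI allI impI)
    fix v w :: "nat \<Rightarrow> real^'n" assume "\<forall>i<m. v i = w i"
    then have "\<theta> y (case_nat x v) = \<theta> y (case_nat x w)" for y using alternating_cong[OF alt] by metis
    then show "cone m \<theta> x v = cone m \<theta> x w" unfolding cone by simp
  next
    fix v :: "nat \<Rightarrow> real^'n" and i assume "i < m"
    then have lin: "linear (\<lambda>a. \<theta> y (case_nat x (v(i := a))))" for y using alternating_linear[OF alt] by blast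
    show "linear (\<lambda>a. cone m \<theta> x (v(i := a)))"
      unfolding cone
    proof (rule linearI)
      fix a b :: "real^'n" and r :: real
      have "?h (v(i := a + b)) = (\<lambda>t. ?h (v(i := a)) t + ?h (v(i := b)) t)"
        by (simp only: linear_add[OF lin] distrib_left)
      then show "(LINT t|lborel. ?h (v(i := a + b)) t) = (LINT t|lborel. ?h (v(i := a)) t) + (LINT t|lborel. ?h (v(i := b)) t)"
        by (simp only: Bochner_Integration.integral_add[OF int int])
      have "?h (v(i := r *\<^sub>R a)) = (\<lambda>t. r * ?h (v(i := a)) t)"
        by (simp only: linear_scale[OF lin] real_scaleR_def mult_ac)
      then show "(LINT t|lborel. ?h (v(i := r *\<^sub>R a)) t) = r *\<^sub>R (LINT t|lborel. ?h (v(i := a)) t)"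
        by (simp only: integral_mult_right_zero real_scaleR_def)
    qed
  next
    fix v :: "nat \<Rightarrow> real^'n" and i j assume ij: "i < j \<and> j < m \<and> v i = v j"
    have "\<theta> y (case_nat x v) = 0" for y by (rule alternating_repeat[OF alt, of i j]) (use ij in auto)
    then show "cone m \<theta> x v = 0" unfolding cone by simp
  qed
qed

text \<open>The integrand contains x in slot 0 and a multiple of x in slot a + 1. The cone has no dr
  component, which is the hypothesis of the second estimate in \<open>cusp_bounds\<close>.\<close>

lemma cone_kernel:
  fixes \<theta> :: "'n::finite form"
  assumes \<theta>: "borel_form (Suc m) \<theta>" and "a < m" "v a = c *\<^sub>R x"
  shows "cone m \<theta> x v = 0"
proof -
  have "\<theta> y (case_nat x v) = 0" for y
  proof -
    note alt = borel_formD(1)[OF \<theta>, of y]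
    have "case_nat x v = (case_nat x v)(Suc a := c *\<^sub>R x)" using assms(3) by (auto simp: fun_eq_iff split: nat.split)
    then have "\<theta> y (case_nat x v) = c * \<theta> y ((case_nat x v)(Suc a := x))"
      using linear_scale[OF alternating_linear[OF alt, of "Suc a"], of "case_nat x v" c x] assms(2) by (simp only:) simp
    also have "\<theta> y ((case_nat x v)(Suc a := x)) = 0"
      by (rule alternating_repeat[OF alt, of 0 "Suc a"]) (use assms(2) in auto)
    finally show ?thesis by simp
  qed
  then show ?thesis unfolding cone_def by simp
qed

lemma cone_measurable:
  fixes \<theta> :: "'n::finite form"
  assumes \<theta>: "borel_form (Suc m) \<theta>"
  shows "(\<lambda>x. cone m \<theta> x v) \<in> borel_measurable borel"
proof -
  have [measurable]: "(\<lambda>(x, t). \<theta> (t *\<^sub>R x) (case_nat x v)) \<in> borel_measurable (borel \<Otimes>\<^sub>M borel)"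
    using measurable_pair_swap[OF ray_measurable[OF \<theta>]] by simp
  note [measurable] = cone_mass_measurable[OF \<theta>]
  have [measurable]: "(\<lambda>x. LINT t|lborel. indicator {0<..1} t * (t ^ m * \<theta> (t *\<^sub>R x) (case_nat x v))) \<in> borel_measurable borel"
    by (rule sigma_finite_measure.borel_measurable_lebesgue_integral[OF sigma_finite_lborel]) measurable
  show ?thesis unfolding cone_def by measurable
qed

lemma comp_norm_cone:
  fixes \<theta> :: "'n::finite form"
  assumes \<theta>: "borel_form (Suc m) \<theta>" and fin: "cone_mass m \<theta> x < \<infinity>"
  shows "comp_norm m (cone m \<theta> x) \<le> enn2real (cone_mass m \<theta> x)"
proof -
  let ?P = "{..<m} \<rightarrow>\<^sub>E (UNIV :: 'n set)"
  let ?h = "\<lambda>J t. indicator {0<..1} t * (t ^ m * \<theta> (t *\<^sub>R x) (case_nat x (\<lambda>a. axis (J a) 1)))"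
  have [simp]: "integrable lborel (?h J)" for J by (rule cone_integrable[OF assms])
  have "comp_norm m (cone m \<theta> x) = (\<Sum>J\<in>?P. \<bar>(LINT t|lborel. ?h J t)\<bar>)"
    unfolding comp_norm_def cone_def using fin by simp
  also have "\<dots> \<le> (\<Sum>J\<in>?P. (LINT t|lborel. abs (?h J t)))"
    by (intro sum_mono integral_abs_bound)
  also have "\<dots> = (LINT t|lborel. (\<Sum>J\<in>?P. \<bar>?h J t\<bar>))"
    by (subst Bochner_Integration.integral_sum) auto
  also have "\<dots> = enn2real (\<integral>\<^sup>+t. ennreal (\<Sum>J\<in>?P. \<bar>?h J t\<bar>) \<partial>lborel)"
  proof (rule integral_eq_nn_integral)
    have "integrable lborel (\<lambda>t. \<Sum>J\<in>?P. \<bar>?h J t\<bar>)"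
      by (intro Bochner_Integration.integrable_sum integrable_abs) simp
    then show "(\<lambda>t. \<Sum>J\<in>?P. \<bar>?h J t\<bar>) \<in> borel_measurable lborel" by (rule borel_measurable_integrable)
  qed (auto intro!: sum_nonneg)
  also have "(\<integral>\<^sup>+t. ennreal (\<Sum>J\<in>?P. \<bar>?h J t\<bar>) \<partial>lborel) = cone_mass m \<theta> x"
    unfolding cone_mass_def comp_norm_def
    by (rule nn_integral_cong) (auto simp: indicator_def abs_mult sum_distrib_left)
  finally show ?thesis .
qed

text \<open>If \<open>\<theta> = dr \<and> \<beta> + \<gamma>\<close> in polar coordinates, this is the size of \<open>\<beta>\<close> in the metric of the unit sphere.\<close>

definition sphere_part :: "nat \<Rightarrow> 'n::finite form \<Rightarrow> real^'n \<Rightarrow> real" where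
  "sphere_part m \<theta> y = norm y ^ m * comp_norm m (\<lambda>v. \<theta> y (case_nat (y /\<^sub>R norm y) v))"

lemma comp_norm_scale: "comp_norm m (\<lambda>v. c * \<alpha> v) = \<bar>c\<bar> * comp_norm m \<alpha>"
  unfolding comp_norm_def by (simp add: abs_mult sum_distrib_left)

lemma sphere_part_measurable:
  fixes \<theta> :: "'n::finite form"
  assumes \<theta>: "borel_form (Suc m) \<theta>"
  shows "sphere_part m \<theta> \<in> borel_measurable borel"
proof -
  have "(\<lambda>y. (norm y, y /\<^sub>R norm y)) \<in> borel \<rightarrow>\<^sub>M (borel \<Otimes>\<^sub>M borel :: (real \<times> (real^'n)) measure)"
    by measurable
  from measurable_compose[OF this ray_comp_norm_measurable[OF \<theta>]]
  have f: "(\<lambda>y. comp_norm m (\<lambda>v. \<theta> (norm y *\<^sub>R (y /\<^sub>R norm y)) (case_nat (y /\<^sub>R norm y) v))) \<in> borel_measurable borel"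
    by simp
  have "norm y *\<^sub>R (y /\<^sub>R norm y) = y" for y :: "real^'n" by (cases "y = 0") auto
  then have eq: "sphere_part m \<theta> = (\<lambda>y. norm y ^ m * comp_norm m (\<lambda>v. \<theta> (norm y *\<^sub>R (y /\<^sub>R norm y)) (case_nat (y /\<^sub>R norm y) v)))"
    by (intro ext) (simp only: sphere_part_def)
  show ?thesis unfolding eq by (rule borel_measurable_times[OF _ f]) measurable
qed

text \<open>Inserting x instead of the unit radial vector contributes |x|, and t^m equals |t x|^m /
  |x|^m. So the integrand of \<open>cone_mass\<close> is that of the arc length integral of
  \<open>sphere_part\<close>, divided by |x|^m; the range from 0 to 1 is enlarged to the full
  ray.\<close>

lemma cone_mass_le:
  fixes \<theta> :: "'n::finite form"
  assumes \<theta>: "borel_form (Suc m) \<theta>" and x: "x \<noteq> 0"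
  shows "cone_mass m \<theta> x \<le> ennreal (1 / norm x ^ m) * ray_integral (sphere_part m \<theta>) x"
proof -
  have [measurable]: "(\<lambda>t. sphere_part m \<theta> (t *\<^sub>R x)) \<in> borel_measurable borel"
    by (rule measurable_compose[OF _ sphere_part_measurable[OF \<theta>]]) measurable
  have eq: "t ^ m * comp_norm m (\<lambda>v. \<theta> (t *\<^sub>R x) (case_nat x v)) = (1 / norm x ^ m) * (sphere_part m \<theta> (t *\<^sub>R x) * norm x)" if t: "t > 0" for t
  proof -
    have "(t *\<^sub>R x) /\<^sub>R norm (t *\<^sub>R x) = inverse (norm x) *\<^sub>R x" using t by simp
    then have eq: "(\<lambda>v. \<theta> (t *\<^sub>R x) (case_nat ((t *\<^sub>R x) /\<^sub>R norm (t *\<^sub>R x)) v))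
       = (\<lambda>v. inverse (norm x) * \<theta> (t *\<^sub>R x) (case_nat x v))"
      by (simp only: linear_scale[OF alternating_interior_linear[OF borel_formD(1)[OF \<theta>]]] real_scaleR_def)
    then show ?thesis
      unfolding sphere_part_def eq comp_norm_scale using t x by (simp add: power_mult_distrib field_simps)
  qed
  have "cone_mass m \<theta> x \<le> (\<integral>\<^sup>+t. ennreal (1 / norm x ^ m) * (ennreal (sphere_part m \<theta> (t *\<^sub>R x)) * ennreal (norm x) * indicator {0<..} t) \<partial>lborel)"
    unfolding cone_mass_def
  proof (rule nn_integral_mono)
    fix t :: real
    show "ennreal (t ^ m * comp_norm m (\<lambda>v. \<theta> (t *\<^sub>R x) (case_nat x v))) * indicator {0<..1} t \<le>
        ennreal (1 / norm x ^ m) * (ennreal (sphere_part m \<theta> (t *\<^sub>R x)) * ennreal (norm x) * indicator {0<..} t)"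
    proof (cases "t > 0")
      case True
      have "ennreal (t ^ m * comp_norm m (\<lambda>v. \<theta> (t *\<^sub>R x) (case_nat x v))) =
        ennreal (1 / norm x ^ m) * (ennreal (sphere_part m \<theta> (t *\<^sub>R x)) * ennreal (norm x))"
        unfolding eq[OF True] by (simp only: ennreal_mult' ennreal_mult'' norm_ge_zero zero_le_divide_1_iff zero_le_power)
      then show ?thesis using True by (simp add: indicator_def)
    qed simp
  qed
  also have "\<dots> = ennreal (1 / norm x ^ m) * ray_integral (sphere_part m \<theta>) x"
    unfolding ray_integral_def by (subst nn_integral_cmult) auto
  finally show ?thesis .
qed

lemma powr_le_one_plus:
  fixes a :: real
  assumes "0 \<le> a" "0 \<le> q" "q \<le> p"
  shows "a powr q \<le> 1 + a powr p"
proof (cases "a \<le> 1")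
  case True
  then have "a powr q \<le> 1" using assms powr_mono2[of q a 1] by simp
  then show ?thesis by (simp add: add_increasing2)
next
  case False
  then have "a powr q \<le> a powr p" using assms by (intro powr_mono) auto
  then show ?thesis by simp
qed

text \<open>Put f = r / \<open>stretch\<close>, and let N be the norm of \<theta>. By
  \<open>cusp_bounds\<close> the power p of \<open>sphere_part\<close> is at most a multiple of f^(m
  p) N^p, and |y|^(1-n) is at most a multiple of f^(1-n) times the volume density. The product
  carries f to the power a = m p - (n - 1). This is positive by the hypothesis on p, so the decay of
  f absorbs the weight (1 + r)^(2 (p - 1)).\<close>

lemma sphere_part_integrable:
  fixes g :: "'n::finite metric"
  assumes g: "riemannian_metric g" and cusp: "cusp_end g" and \<theta>: "borel_form (Suc m) \<theta>"
    and p: "1 < p" "real CARD('n) - 1 < real m * p"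
    and fin: "(\<integral>\<^sup>+x. ennreal (sqrt (det (gram g x))) * ennreal (covector_norm g (Suc m) x (\<theta> x) powr p) \<partial>lborel) < \<infinity>"
  shows "(\<integral>\<^sup>+y. ennreal (sphere_part m \<theta> y powr p * (1 + norm y) powr (2 * (p - 1))) *
            ennreal (1 / norm y ^ (DIM(real^'n) - 1)) \<partial>lborel) < \<infinity>"
proof -
  let ?n = "CARD('n) - 1"
  obtain C where C: "0 < C"
    "\<And>x \<alpha>. x \<noteq> 0 \<Longrightarrow> alternating (Suc m) \<alpha> \<Longrightarrow>
        stretch x ^ m * comp_norm m (\<lambda>v. \<alpha> (case_nat (x /\<^sub>R norm x) v)) \<le> C * covector_norm g (Suc m) x \<alpha>"
    "\<And>x. 1 \<le> C * (sqrt (det (gram g x)) * stretch x ^ ?n)"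
    using cusp_bounds[OF g cusp, of m] by metis
  define a where "a = real m * p - real ?n"
  have a: "a > 0" using p(2) by (simp add: a_def)
  obtain D where D: "D > 0" "\<And>x::real^'n. (norm x / stretch x) powr a * (1 + norm x) powr (2 * (p - 1)) \<le> D"
    using radius_dominates[OF a, of "2 * (p - 1)"] p(1) by (metis diff_ge_0_iff_ge less_imp_le mult_nonneg_nonneg zero_le_numeral)
  define K where "K = D * C powr p * C"
  have K: "K \<ge> 0" using C D by (simp add: K_def)
  have "(\<integral>\<^sup>+y. ennreal (sphere_part m \<theta> y powr p * (1 + norm y) powr (2 * (p - 1))) * ennreal (1 / norm y ^ ?n) \<partial>lborel)
    \<le> (\<integral>\<^sup>+x. ennreal K * (ennreal (sqrt (det (gram g x))) * ennreal (covector_norm g (Suc m) x (\<theta> x) powr p)) \<partial>lborel)"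
  proof (rule nn_integral_mono_AE, rule AE_mp[OF AE_lborel_singleton[of 0]], rule AE_I2, rule impI)
    fix x :: "real^'n" assume x: "x \<noteq> 0"
    define r s f N d E where "r = norm x" and "s = stretch x" and "f = r / s" and "N = covector_norm g (Suc m) x (\<theta> x)"
      and "d = sqrt (det (gram g x))" and "E = comp_norm m (\<lambda>v. \<theta> x (case_nat (x /\<^sub>R norm x) v))"
    have pos: "r > 0" "s > 0" "f > 0" "d > 0" using x stretch_ge_1[of x] det_gram_pos[OF g, of x]
      by (auto simp: r_def s_def f_def d_def)
    have N: "N \<ge> 0" unfolding N_def by (rule covector_norm_nonneg[OF g borel_formD(1)[OF \<theta>]])
    have "s ^ m * E \<le> C * N" unfolding s_def E_def N_def by (rule C(2)[OF x borel_formD(1)[OF \<theta>]])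
    then have "f ^ m * (s ^ m * E) \<le> f ^ m * (C * N)" using pos by (intro mult_left_mono) auto
    moreover have B: "sphere_part m \<theta> x = f ^ m * (s ^ m * E)"
      using pos by (simp add: sphere_part_def f_def r_def[symmetric] E_def power_divide)
    moreover have "0 \<le> f ^ m * (s ^ m * E)" using pos unfolding E_def
      by (intro mult_nonneg_nonneg zero_le_power comp_norm_nonneg) auto
    ultimately have "sphere_part m \<theta> x powr p \<le> (f ^ m * (C * N)) powr p"
      using p by (intro powr_mono2) auto
    also have "\<dots> = f powr (real m * p) * (C powr p * N powr p)"
      using pos C(1) N by (simp add: powr_mult powr_powr flip: powr_realpow)
    finally have 1: "sphere_part m \<theta> x powr p \<le> f powr (real m * p) * (C powr p * N powr p)" .
    have "1 / r ^ ?n = 1 / f ^ ?n * (1 / s ^ ?n)" using pos by (simp add: f_def power_divide)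
    also have "\<dots> \<le> 1 / f ^ ?n * (C * d)"
      using C(3)[of x] pos by (intro mult_left_mono) (auto simp: d_def s_def divide_simps mult_ac)
    finally have 2: "1 / r ^ ?n \<le> 1 / f ^ ?n * (C * d)" .
    have fa: "f powr (real m * p) * (1 / f ^ ?n) = f powr a"
      unfolding a_def powr_diff powr_realpow[OF pos(3)] by (simp only: times_divide_eq_right mult_1_right)
    have "sphere_part m \<theta> x powr p * (1 + r) powr (2 * (p - 1)) * (1 / r ^ ?n) \<le>
        f powr (real m * p) * (C powr p * N powr p) * (1 + r) powr (2 * (p - 1)) * (1 / f ^ ?n * (C * d))"
      using 1 2 pos by (intro mult_mono) auto
    also have "\<dots> = (f powr (real m * p) * (1 / f ^ ?n) * (1 + r) powr (2 * (p - 1))) * (C powr p * C * (d * N powr p))"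
      by (simp only: mult_ac)
    also have "\<dots> \<le> D * (C powr p * C * (d * N powr p))"
      unfolding fa using D(2)[of x] C(1) pos
      by (intro mult_right_mono) (auto simp: f_def r_def s_def)
    also have "\<dots> = K * (d * N powr p)" by (simp add: K_def mult_ac)
    finally have "ennreal (sphere_part m \<theta> x powr p * (1 + r) powr (2 * (p - 1)) * (1 / r ^ ?n)) \<le> ennreal (K * (d * N powr p))"
      by (rule ennreal_leI)
    then show "ennreal (sphere_part m \<theta> x powr p * (1 + norm x) powr (2 * (p - 1))) * ennreal (1 / norm x ^ ?n) \<le>
        ennreal K * (ennreal (sqrt (det (gram g x))) * ennreal (covector_norm g (Suc m) x (\<theta> x) powr p))"
      using pos K by (simp add: r_def d_def N_def ennreal_mult[symmetric] ennreal_mult'[symmetric])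
  qed
  also have "\<dots> < \<infinity>"
  proof -
    have [measurable]: "(\<lambda>x. covector_norm g (Suc m) x (\<theta> x)) \<in> borel_measurable lebesgue"
      "(\<lambda>x. sqrt (det (gram g x))) \<in> borel_measurable lebesgue"
      using borel_formD(2)[OF \<theta>] by (auto intro!: covector_norm_measurable[OF g] vol_density_measurable[OF g] intro: measurable_completion)
    have "(\<integral>\<^sup>+x. ennreal K * (ennreal (sqrt (det (gram g x))) * ennreal (covector_norm g (Suc m) x (\<theta> x) powr p)) \<partial>lebesgue)
      = ennreal K * (\<integral>\<^sup>+x. ennreal (sqrt (det (gram g x))) * ennreal (covector_norm g (Suc m) x (\<theta> x) powr p) \<partial>lebesgue)"
      by (rule nn_integral_cmult) measurable
    then show ?thesis using fin by (simp add: nn_integral_completion ennreal_mult_less_top)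
  qed
  finally show ?thesis by simp
qed

text \<open>With a the full-ray integral of \<open>sphere_part\<close>, the Hardy inequality makes
  \<open>V\<close> integrable, and both integrals are compared with \<open>V\<close>. On a ball
  |x|^-m is at most a multiple of \<open>radial_weight\<close> since m \<le> n - 1. In the last
  claim the powers of f = r / \<open>stretch\<close> combine to b = n - 1 - m q, positive by the
  hypothesis on q, so f^b (1 + r)^2 is bounded and a multiple of \<open>radial_weight\<close> is
  left.\<close>

lemma cone_bounds:
  fixes g :: "'n::finite metric"
  assumes g: "riemannian_metric g" and cusp: "cusp_end g" and \<theta>: "borel_form (Suc m) \<theta>"
    and p: "1 < p" "real CARD('n) - 1 < real m * p" and m: "m \<le> CARD('n) - 1"
    and fin: "(\<integral>\<^sup>+x. ennreal (sqrt (det (gram g x))) * ennreal (covector_norm g (Suc m) x (\<theta> x) powr p) \<partial>lborel) < \<infinity>"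
  shows "AE x in lborel. cone_mass m \<theta> x < \<infinity>"
    and "(\<integral>\<^sup>+x. cone_mass m \<theta> x * indicator (cball 0 R) x \<partial>lborel) < \<infinity>"
    and "0 < q \<Longrightarrow> q \<le> p \<Longrightarrow> real m * q < real CARD('n) - 1 \<Longrightarrow>
      (\<integral>\<^sup>+x. ennreal (sqrt (det (gram g x))) * ennreal (covector_norm g m x (cone m \<theta> x) powr q) \<partial>lborel) < \<infinity>"
proof -
  let ?n = "CARD('n) - 1"
  define A where "A = ray_integral (sphere_part m \<theta>)"
  define a where "a x = enn2real (A x)" for x
  note ray = ray_integral_bound[OF sphere_part_measurable[OF \<theta>] _ p(1) sphere_part_integrable[OF g cusp \<theta> p fin], folded A_def]
  have sp: "0 \<le> sphere_part m \<theta> x" for x by (simp add: sphere_part_def comp_norm_nonneg)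
  have [measurable]: "A \<in> borel_measurable borel"
    unfolding A_def by (rule ray_integral_measurable[OF sphere_part_measurable[OF \<theta>]])
  have a0: "a x \<ge> 0" for x by (simp add: a_def)
  \<comment> \<open>The summand 1 takes care of the exponents 1 and q, which are at most p.\<close>
  define V where "V x = radial_weight x * (1 + a x powr p)" for x
  have V0: "V x \<ge> 0" for x by (simp add: V_def radial_weight_nonneg)
  have [measurable]: "V \<in> borel_measurable borel" unfolding V_def a_def by measurable
  have "(\<integral>\<^sup>+x. ennreal (V x) \<partial>lborel) = (\<integral>\<^sup>+x. ennreal (radial_weight x) + ennreal (radial_weight x) * ennreal (a x powr p) \<partial>lborel)"
    by (rule nn_integral_cong) (simp add: V_def radial_weight_nonneg distrib_left ennreal_mult)
  also have "\<dots> < \<infinity>"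
    using ray(2)[OF sp] nn_integral_radial_weight[where 'a="real^'n"]
    by (subst nn_integral_add) (auto simp: a_def)
  finally have fV: "(\<integral>\<^sup>+x. ennreal (V x) \<partial>lborel) < \<infinity>" .
  have good: "AE x in lborel. x \<noteq> 0 \<and> cone_mass m \<theta> x \<le> ennreal (1 / norm x ^ m * a x)"
    using ray(1)[OF sp] AE_lborel_singleton[of 0]
  proof eventually_elim
    case (elim x)
    then have "A x = ennreal (a x)" by (simp add: a_def)
    moreover have "ennreal (1 / norm x ^ m) * ennreal (a x) = ennreal (1 / norm x ^ m * a x)"
      by (rule ennreal_mult''[symmetric]) (rule a0)
    ultimately show ?case using cone_mass_le[OF \<theta>, of x] elim unfolding A_def by simp
  qed
  show "AE x in lborel. cone_mass m \<theta> x < \<infinity>"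
    using good by eventually_elim (auto intro: le_less_trans)
  show "(\<integral>\<^sup>+x. cone_mass m \<theta> x * indicator (cball 0 R) x \<partial>lborel) < \<infinity>"
  proof -
    \<comment> \<open>A bound on the ball for |x|^(n-1-m) (1 + |x|)^2, the quotient of |x|^-m and
      \<open>radial_weight\<close>.\<close>
    define K where "K = max 1 R ^ (?n - m) * (1 + max 1 R)\<^sup>2"
    have "(\<integral>\<^sup>+x. cone_mass m \<theta> x * indicator (cball 0 R) x \<partial>lborel) \<le> (\<integral>\<^sup>+x. ennreal K * ennreal (V x) \<partial>lborel)"
    proof (rule nn_integral_mono_AE, use good in eventually_elim)
      case (elim x)
      show ?case
      proof (cases "norm x \<le> R")
        case True
        have r: "norm x > 0" using elim by simp
        have "1 / norm x ^ m = norm x ^ (?n - m) / norm x ^ ?n"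
        proof -
          have "norm x ^ ?n = norm x ^ m * norm x ^ (?n - m)" using m by (simp only: le_add_diff_inverse flip: power_add)
          then show ?thesis using r by (simp only:) simp
        qed
        also have "\<dots> = norm x ^ (?n - m) * (1 + norm x)\<^sup>2 * radial_weight x"
          unfolding radial_weight_def using r by (simp add: add_nonneg_eq_0_iff)
        also have "\<dots> \<le> K * radial_weight x"
          unfolding K_def using True by (intro mult_right_mono mult_mono power_mono radial_weight_nonneg) auto
        finally have "1 / norm x ^ m * a x \<le> K * radial_weight x * (1 + a x powr p)"
        proof (rule mult_mono)
          show "0 \<le> K * radial_weight x" unfolding K_def by (intro mult_nonneg_nonneg radial_weight_nonneg) auto
        qed (use young_crude[of "a x" 1 p] a0[of x] p in auto)
        also have "\<dots> = K * V x" by (simp add: V_def)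
        finally have "ennreal (1 / norm x ^ m * a x) \<le> ennreal (K * V x)" by (rule ennreal_leI)
        moreover have "ennreal (K * V x) = ennreal K * ennreal (V x)" by (rule ennreal_mult''[OF V0])
        ultimately have "cone_mass m \<theta> x \<le> ennreal K * ennreal (V x)" using elim order_trans by metis
        with True show ?thesis by simp
      qed simp
    qed
    also have "\<dots> < \<infinity>" using fV by (simp add: nn_integral_cmult ennreal_mult_less_top)
    finally show ?thesis .
  qed
  assume q: "0 < q" "q \<le> p" "real m * q < real CARD('n) - 1"
  show "(\<integral>\<^sup>+x. ennreal (sqrt (det (gram g x))) * ennreal (covector_norm g m x (cone m \<theta> x) powr q) \<partial>lborel) < \<infinity>"
  proof -
    obtain C where C: "0 < C"
      "\<And>x \<alpha>. x \<noteq> 0 \<Longrightarrow> alternating m \<alpha> \<Longrightarrow> (\<And>v a c. a < m \<Longrightarrow> v a = c *\<^sub>R x \<Longrightarrow> \<alpha> v = 0) \<Longrightarrow>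
        covector_norm g m x \<alpha> \<le> C * (stretch x ^ m * comp_norm m \<alpha>)"
      "\<And>x. sqrt (det (gram g x)) * stretch x ^ ?n \<le> C"
      using cusp_bounds[OF g cusp, of m] by metis
    define b where "b = real ?n - real m * q"
    have b: "b > 0" using q(3) by (simp add: b_def)
    obtain D where D: "D > 0" "\<And>x::real^'n. (norm x / stretch x) powr b * (1 + norm x) powr 2 \<le> D"
      using radius_dominates[OF b, of 2] by auto
    define K where "K = C powr q * C * D"
    have "(\<integral>\<^sup>+x. ennreal (sqrt (det (gram g x))) * ennreal (covector_norm g m x (cone m \<theta> x) powr q) \<partial>lborel)
       \<le> (\<integral>\<^sup>+x. ennreal K * ennreal (V x) \<partial>lborel)"
    proof (rule nn_integral_mono_AE, use good in eventually_elim)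
      case (elim x)
      define r s f N d where "r = norm x" and "s = stretch x" and "f = r / s" and "N = covector_norm g m x (cone m \<theta> x)"
        and "d = sqrt (det (gram g x))"
      have pos: "r > 0" "s > 0" "f > 0" "d > 0" using elim stretch_ge_1[of x] det_gram_pos[OF g, of x]
        by (auto simp: r_def s_def f_def d_def)
      have N: "N \<ge> 0" unfolding N_def by (rule covector_norm_nonneg[OF g alternating_cone[OF \<theta>]])
      have cm: "cone_mass m \<theta> x < \<infinity>" using elim by (auto intro: le_less_trans)
      have "comp_norm m (cone m \<theta> x) \<le> enn2real (cone_mass m \<theta> x)" by (rule comp_norm_cone[OF \<theta> cm])
      also have "\<dots> \<le> 1 / r ^ m * a x" using elim a0[of x] pos unfolding r_def by (intro enn2real_leI) auto
      finally have cn: "comp_norm m (cone m \<theta> x) \<le> 1 / r ^ m * a x" .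
      have "N \<le> C * (s ^ m * comp_norm m (cone m \<theta> x))"
        unfolding N_def s_def by (rule C(2)) (use elim in \<open>auto intro: alternating_cone[OF \<theta>] cone_kernel[OF \<theta>]\<close>)
      also have "\<dots> \<le> C * (s ^ m * (1 / r ^ m * a x))"
        using cn C(1) pos by (intro mult_left_mono) auto
      also have "\<dots> = C * (a x / f ^ m)" by (simp add: f_def power_divide)
      finally have "N powr q \<le> (C * (a x / f ^ m)) powr q"
        using N q by (intro powr_mono2) auto
      also have "\<dots> = C powr q * (a x powr q / f powr (real m * q))"
        using C(1) a0[of x] pos by (simp add: powr_mult powr_divide powr_powr flip: powr_realpow)
      finally have 1: "N powr q \<le> C powr q * (a x powr q / f powr (real m * q))" .
      have "d \<le> C / s ^ ?n" using C(3)[of x] pos by (simp add: d_def s_def field_simps)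
      also have "\<dots> = C * f ^ ?n / r ^ ?n" using pos by (simp add: f_def power_divide)
      finally have 2: "d \<le> C * f ^ ?n / r ^ ?n" .
      have fb: "f ^ ?n / f powr (real m * q) = f powr b"
        unfolding b_def powr_diff powr_realpow[OF pos(3)] ..
      have "d * N powr q \<le> (C * f ^ ?n / r ^ ?n) * (C powr q * (a x powr q / f powr (real m * q)))"
        using 1 2 pos C(1) by (intro mult_mono) auto
      also have "\<dots> = C powr q * C * (f ^ ?n / f powr (real m * q)) / r ^ ?n * a x powr q"
        by (simp add: mult_ac)
      also have "\<dots> = C powr q * C * (f powr b * (1 + r) powr 2) * radial_weight x * a x powr q"
        unfolding fb radial_weight_def using pos
        by (simp add: r_def[symmetric] powr_numeral)
      also have "\<dots> \<le> C powr q * C * D * radial_weight x * (1 + a x powr p)"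
        using D(2)[of x] C(1) D(1) powr_le_one_plus[of "a x" q p] q a0[of x]
        by (intro mult_mono mult_left_mono mult_nonneg_nonneg radial_weight_nonneg) (auto simp: f_def r_def s_def)
      also have "\<dots> = K * V x" by (simp add: K_def V_def)
      finally have "ennreal (d * N powr q) \<le> ennreal (K * V x)" by (rule ennreal_leI)
      then show ?case using pos V0 by (simp add: d_def N_def ennreal_mult'' ennreal_mult')
    qed
    also have "\<dots> < \<infinity>" using fV by (simp add: nn_integral_cmult ennreal_mult_less_top)
    finally show ?thesis .
  qed
qed

section \<open>The weak differential of the cone operator\<close>

text \<open>Integrability of a wedge product asks of its second factor only continuity and bounded
  support. The class contains the test forms, their exterior derivatives and their Lie derivatives
  along the Euler field, in all degrees.\<close>

definition cc_form :: "'n::finite form \<Rightarrow> bool" where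
  "cc_form \<omega> \<longleftrightarrow> (\<forall>v. continuous_on UNIV (\<lambda>x. \<omega> x v)) \<and> (\<exists>R. \<forall>x. R < norm x \<longrightarrow> (\<forall>v. \<omega> x v = 0))"

lemma cc_formD: "cc_form \<omega> \<Longrightarrow> (\<lambda>x. \<omega> x v) \<in> borel_measurable borel"
  unfolding cc_form_def by (auto intro: borel_measurable_continuous_onI)

lemma cc_form_bounded:
  assumes "cc_form \<omega>"
  obtains M where "\<And>x. \<bar>\<omega> x v\<bar> \<le> M"
proof -
  from assms obtain R where R: "continuous_on UNIV (\<lambda>x. \<omega> x v)" "\<And>x. R < norm x \<Longrightarrow> \<omega> x v = 0"
    unfolding cc_form_def by blast
  have "bounded ((\<lambda>x. \<omega> x v) ` cball 0 R)"
    by (intro compact_imp_bounded compact_continuous_image continuous_on_subset[OF R(1)]) auto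
  then obtain M where "\<forall>x\<in>cball 0 R. \<bar>\<omega> x v\<bar> \<le> M"
    unfolding bounded_iff by auto
  then have M: "norm x \<le> R \<Longrightarrow> \<bar>\<omega> x v\<bar> \<le> M" for x by simp
  have "\<bar>\<omega> x v\<bar> \<le> max 0 M" for x
    using M[of x] R(2)[of x] by (cases "norm x \<le> R") auto
  then show thesis by (rule that)
qed

lemma cc_form_add: "cc_form \<omega> \<Longrightarrow> cc_form \<eta> \<Longrightarrow> cc_form (\<lambda>x v. \<omega> x v + \<eta> x v)"
proof -
  assume a: "cc_form \<omega>" "cc_form \<eta>"
  then obtain R S where "\<And>x v. R < norm x \<Longrightarrow> \<omega> x v = 0" "\<And>x v. S < norm x \<Longrightarrow> \<eta> x v = 0"
    unfolding cc_form_def by metis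
  then show ?thesis
    using a unfolding cc_form_def by (auto intro!: continuous_on_add exI[of _ "max R S"])
qed

lemma test_form_support:
  assumes "test_form l \<omega>"
  obtains R where "R > 0" "\<And>x v. R < norm x \<Longrightarrow> \<omega> x v = 0"
proof -
  from assms obtain K where K: "compact K" "\<And>x. x \<notin> K \<Longrightarrow> \<omega> x = (\<lambda>v. 0)"
    unfolding test_form_def by blast
  obtain R where R: "R > 0" "\<And>x. x \<in> K \<Longrightarrow> norm x \<le> R"
    using compact_imp_bounded[OF K(1)] unfolding bounded_pos by blast
  show thesis
  proof (rule that[OF R(1)])
    fix x :: "real^'a" and v assume "R < norm x"
    then have "x \<notin> K" using R(2)[of x] by auto
    then show "\<omega> x v = 0" by (simp add: K(2))
  qed
qed

lemma test_form_cc: "test_form l \<omega> \<Longrightarrow> cc_form \<omega>"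
  unfolding cc_form_def using test_form_continuous test_form_support by metis

lemma test_form_ext_deriv_cc:
  fixes \<omega> :: "'n::finite form"
  assumes \<omega>: "test_form l \<omega>"
  shows "cc_form (ext_deriv l \<omega>)"
proof -
  obtain R where R: "R > 0" "\<And>x v. R < norm x \<Longrightarrow> \<omega> x v = 0" using test_form_support[OF \<omega>] by metis
  have sm: "smooth (\<lambda>x. \<omega> x v)" for v using \<omega> unfolding test_form_def by blast
  have "frechet_derivative (\<lambda>y. \<omega> y w) (at x) h = 0" if "R < norm x" for x w h
  proof -
    have op: "open {y :: real^'n. R < norm y}" by (intro open_Collect_less continuous_intros)
    have "((\<lambda>y. \<omega> y w) has_derivative (\<lambda>h. 0)) (at x)"
      by (rule has_derivative_transform_within_open[OF has_derivative_const[of 0] op]) (use that R in auto)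
    then show ?thesis by (simp add: frechet_derivative_eqI)
  qed
  then have "\<forall>x. R < norm x \<longrightarrow> (\<forall>v. ext_deriv l \<omega> x v = 0)" unfolding ext_deriv_def by simp
  moreover have "continuous_on UNIV (\<lambda>x. ext_deriv l \<omega> x v)" for v
    unfolding ext_deriv_def by (intro continuous_intros smooth_continuous smooth_derivative sm)
  ultimately show ?thesis unfolding cc_form_def by blast
qed

lemma cc_form_interior:
  fixes \<omega> :: "'n::finite form"
  assumes cc: "cc_form \<omega>" and alt: "\<And>x. alternating (Suc l) (\<omega> x)"
  shows "cc_form (\<lambda>x v. \<omega> x (case_nat x v))"
proof -
  have "continuous_on UNIV (\<lambda>x. \<omega> x (case_nat x v))" for v
    by (subst case_nat_expand[OF alt], intro continuous_intros) (use cc in \<open>auto simp: cc_form_def\<close>)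
  then show ?thesis using cc unfolding cc_form_def by blast
qed

lemma wedge_bound:
  assumes "alternating k \<alpha>"
  shows "\<bar>wedge k l \<alpha> \<beta> std_frame\<bar> \<le> comp_norm k \<alpha> * (\<Sum>\<sigma> | \<sigma> permutes {..<k + l}. \<bar>\<beta> (\<lambda>i. std_frame (\<sigma> (k + i)))\<bar>)"
proof -
  let ?S = "\<Sum>\<sigma> | \<sigma> permutes {..<k + l}.
        of_int (sign \<sigma>) * \<alpha> (\<lambda>i. std_frame (\<sigma> i)) * \<beta> (\<lambda>i. std_frame (\<sigma> (k + i)))"
  have "\<bar>wedge k l \<alpha> \<beta> std_frame\<bar> = \<bar>?S\<bar> / (fact k * fact l)"
    unfolding wedge_def by (simp add: abs_divide abs_mult)
  also have "\<dots> \<le> \<bar>?S\<bar> / 1"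
    using mult_mono[of 1 "fact k :: real" 1 "fact l"] by (intro divide_left_mono) (auto simp: fact_ge_1)
  also have "\<dots> \<le> (\<Sum>\<sigma> | \<sigma> permutes {..<k + l}. \<bar>of_int (sign \<sigma>) * \<alpha> (\<lambda>i. std_frame (\<sigma> i)) * \<beta> (\<lambda>i. std_frame (\<sigma> (k + i)))\<bar>)"
    by (simp add: sum_abs)
  also have "\<dots> \<le> (\<Sum>\<sigma> | \<sigma> permutes {..<k + l}. comp_norm k \<alpha> * \<bar>\<beta> (\<lambda>i. std_frame (\<sigma> (k + i)))\<bar>)"
  proof (intro sum_mono)
    fix \<sigma> :: "nat \<Rightarrow> nat"
    have "\<bar>\<alpha> (\<lambda>i. std_frame (\<sigma> i))\<bar> \<le> comp_norm k \<alpha>"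
      unfolding std_frame_def by (rule abs_le_comp_norm[OF assms])
    moreover have "\<bar>of_int (sign \<sigma>) :: real\<bar> = 1" by (simp add: sign_def)
    ultimately show "\<bar>of_int (sign \<sigma>) * \<alpha> (\<lambda>i. std_frame (\<sigma> i)) * \<beta> (\<lambda>i. std_frame (\<sigma> (k + i)))\<bar>
        \<le> comp_norm k \<alpha> * \<bar>\<beta> (\<lambda>i. std_frame (\<sigma> (k + i)))\<bar>"
      by (simp add: abs_mult mult_right_mono)
  qed
  finally show ?thesis by (simp add: sum_distrib_left)
qed

text \<open>Only finitely many values of \<omega> on tuples of the standard frame enter the
  top-degree component, and each of them is bounded with bounded support.\<close>

lemma wedge_cc_bound:
  assumes "cc_form \<omega>"
  obtains M R where "M \<ge> 0" "R > 0"
    "\<And>x \<alpha>. alternating k \<alpha> \<Longrightarrow> \<bar>wedge k l \<alpha> (\<omega> x) std_frame\<bar> \<le> M * (comp_norm k \<alpha> * indicator (cball 0 R) x)"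
proof -
  have "\<exists>M. \<forall>x. \<bar>\<omega> x v\<bar> \<le> M" for v using cc_form_bounded[OF assms, of v] by blast
  then obtain M where M: "\<And>v x. \<bar>\<omega> x v\<bar> \<le> M v" by metis
  obtain R where R: "\<And>x v. R < norm x \<Longrightarrow> \<omega> x v = 0" using assms unfolding cc_form_def by blast
  define C where "C = (\<Sum>\<sigma> | \<sigma> permutes {..<k + l}. M (\<lambda>i. std_frame (\<sigma> (k + i))))"
  show thesis
  proof (rule that[of C "max 1 R"])
    show "C \<ge> 0" unfolding C_def using M by (intro sum_nonneg) (meson abs_ge_zero order_trans)
    fix x and \<alpha> :: "'a covector" assume \<alpha>: "alternating k \<alpha>"
    show "\<bar>wedge k l \<alpha> (\<omega> x) std_frame\<bar> \<le> C * (comp_norm k \<alpha> * indicator (cball 0 (max 1 R)) x)"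
    proof (cases "norm x \<le> max 1 R")
      case True
      have "\<bar>wedge k l \<alpha> (\<omega> x) std_frame\<bar> \<le> comp_norm k \<alpha> * C"
        unfolding C_def
        by (rule order_trans[OF wedge_bound[OF \<alpha>]]) (intro mult_left_mono sum_mono M comp_norm_nonneg)
      then show ?thesis using True by (simp add: mult.commute)
    next
      case False
      then have "R < norm x" by simp
      from R[OF this] have "\<omega> x = (\<lambda>v. 0)" by blast
      then show ?thesis using False by (simp add: wedge_def)
    qed
  qed simp
qed

text \<open>Local integrability in the form used for majorants: a nonnegative integral with respect
  to the Borel measure, which needs no separate measurability statement.\<close>

definition loc_bounded_mass :: "nat \<Rightarrow> 'n::finite form \<Rightarrow> bool" where
  "loc_bounded_mass k \<theta> \<longleftrightarrow> (\<forall>R. (\<integral>\<^sup>+x. ennreal (comp_norm k (\<theta> x)) * indicator (cball 0 R) x \<partial>lborel) < \<infinity>)"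

lemma comp_norm_measurable:
  assumes "\<And>v. (\<lambda>x. \<theta> x v) \<in> borel_measurable M"
  shows "(\<lambda>x. comp_norm k (\<theta> x)) \<in> borel_measurable M"
proof -
  note [measurable] = assms
  show ?thesis unfolding comp_norm_def by measurable
qed

lemma loc_integrable_mass:
  assumes "loc_integrable_form k \<theta>"
  shows "loc_bounded_mass k \<theta>"
  unfolding loc_bounded_mass_def
proof
  fix R
  let ?P = "{..<k} \<rightarrow>\<^sub>E UNIV"
  have "set_integrable lebesgue (cball 0 R) (\<lambda>x. \<theta> x v)" for v
    using assms unfolding loc_integrable_form_def by auto
  then have int: "integrable lebesgue (\<lambda>x. indicator (cball 0 R) x *\<^sub>R \<theta> x v)" for v
    unfolding set_integrable_def by blast
  then have "(\<integral>\<^sup>+x. ennreal (norm (indicator (cball 0 R) x *\<^sub>R \<theta> x v)) \<partial>lebesgue) < \<infinity>" for v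
    unfolding integrable_iff_bounded by blast
  moreover have "(\<integral>\<^sup>+x. ennreal (comp_norm k (\<theta> x)) * indicator (cball 0 R) x \<partial>lebesgue)
     = (\<integral>\<^sup>+x. (\<Sum>J\<in>?P. ennreal (norm (indicator (cball 0 R) x *\<^sub>R \<theta> x (\<lambda>a. axis (J a) 1)))) \<partial>lebesgue)"
    by (rule nn_integral_cong) (auto simp: comp_norm_def indicator_def sum_ennreal)
  moreover have "\<dots> = (\<Sum>J\<in>?P. \<integral>\<^sup>+x. ennreal (norm (indicator (cball 0 R) x *\<^sub>R \<theta> x (\<lambda>a. axis (J a) 1))) \<partial>lebesgue)"
    by (rule nn_integral_sum) (use int in \<open>auto intro!: borel_measurable_integrable\<close>)
  ultimately show "(\<integral>\<^sup>+x. ennreal (comp_norm k (\<theta> x)) * indicator (cball 0 R) x \<partial>lborel) < \<infinity>"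
    by (simp add: nn_integral_completion finite_PiE)
qed

lemma loc_bounded_mass_scale:
  fixes \<theta> :: "'n::finite form"
  assumes \<theta>: "borel_form k \<theta>" "loc_bounded_mass k \<theta>" and t: "t > 0"
  shows "loc_bounded_mass k (\<lambda>x. \<theta> (t *\<^sub>R x))"
  unfolding loc_bounded_mass_def
proof
  fix R
  have [measurable]: "(\<lambda>x. comp_norm k (\<theta> x)) \<in> borel_measurable borel"
    by (rule comp_norm_measurable) (rule borel_formD(2)[OF \<theta>(1)])
  have [measurable]: "cball (0::real^'n) r \<in> sets borel" for r by simp
  have f: "(\<lambda>x. ennreal (comp_norm k (\<theta> x)) * indicator (cball 0 (t * R)) x) \<in> borel_measurable borel"
    by measurable
  let ?I = "\<lambda>R. \<integral>\<^sup>+x. ennreal (comp_norm k (\<theta> x)) * indicator (cball 0 R) x \<partial>lborel"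
  have "?I (t * R) = (\<integral>\<^sup>+x. ennreal (t ^ CARD('n)) * (ennreal (comp_norm k (\<theta> (t *\<^sub>R x))) * indicator (cball 0 (t * R)) (t *\<^sub>R x)) \<partial>lborel)"
    by (subst nn_integral_scaleR[OF f t]) simp
  also have "\<dots> = (\<integral>\<^sup>+x. ennreal (t ^ CARD('n)) * (ennreal (comp_norm k (\<theta> (t *\<^sub>R x))) * indicator (cball 0 R) x) \<partial>lborel)"
    using t by (intro nn_integral_cong) (auto simp: indicator_def)
  also have "\<dots> = ennreal (t ^ CARD('n)) * (\<integral>\<^sup>+x. ennreal (comp_norm k (\<theta> (t *\<^sub>R x))) * indicator (cball 0 R) x \<partial>lborel)"
    by (rule nn_integral_cmult) measurable
  finally have "ennreal (t ^ CARD('n)) * (\<integral>\<^sup>+x. ennreal (comp_norm k (\<theta> (t *\<^sub>R x))) * indicator (cball 0 R) x \<partial>lborel) < \<infinity>"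
    using \<theta>(2) unfolding loc_bounded_mass_def by metis
  then show "(\<integral>\<^sup>+x. ennreal (comp_norm k (\<theta> (t *\<^sub>R x))) * indicator (cball 0 R) x \<partial>lborel) < \<infinity>"
    using t by (auto simp: ennreal_mult_less_top)
qed

lemma wedge_measurable:
  assumes "\<And>v. (\<lambda>x. \<theta> x v) \<in> borel_measurable M" "\<And>v. (\<lambda>x. \<omega> x v) \<in> borel_measurable M"
  shows "(\<lambda>x. wedge k l (\<theta> x) (\<omega> x) e) \<in> borel_measurable M"
proof -
  note [measurable] = assms
  show ?thesis unfolding wedge_def by measurable
qed

lemma wedge_integrable:
  fixes \<theta> :: "'n::finite form"
  assumes alt: "\<And>x. alternating k (\<theta> x)" and \<theta>: "\<And>v. (\<lambda>x. \<theta> x v) \<in> borel_measurable lborel"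
    "loc_bounded_mass k \<theta>" and cc: "cc_form \<omega>"
  shows "integrable lborel (\<lambda>x. wedge k l (\<theta> x) (\<omega> x) std_frame)"
proof (rule integrableI_bounded)
  show "(\<lambda>x. wedge k l (\<theta> x) (\<omega> x) std_frame) \<in> borel_measurable lborel"
    by (rule wedge_measurable) (use \<theta> cc_formD[OF cc] in auto)
  obtain M R where M: "M \<ge> 0" "R > 0"
    "\<And>x \<alpha>. alternating k \<alpha> \<Longrightarrow> \<bar>wedge k l \<alpha> (\<omega> x) std_frame\<bar> \<le> M * (comp_norm k \<alpha> * indicator (cball 0 R) x)"
    using wedge_cc_bound[OF cc] by metis
  have [measurable]: "(\<lambda>x. comp_norm k (\<theta> x)) \<in> borel_measurable lborel"
    by (rule comp_norm_measurable) (rule \<theta>)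
  have [measurable]: "cball (0::real^'n) r \<in> sets borel" for r by simp
  have "(\<integral>\<^sup>+x. ennreal (norm (wedge k l (\<theta> x) (\<omega> x) std_frame)) \<partial>lborel)
      \<le> (\<integral>\<^sup>+x. ennreal M * (ennreal (comp_norm k (\<theta> x)) * indicator (cball 0 R) x) \<partial>lborel)"
  proof (rule nn_integral_mono)
    fix x
    have "ennreal (norm (wedge k l (\<theta> x) (\<omega> x) std_frame)) \<le> ennreal (M * (comp_norm k (\<theta> x) * indicator (cball 0 R) x))"
      using M(3)[OF alt] by (intro ennreal_leI) simp
    also have "\<dots> = ennreal M * (ennreal (comp_norm k (\<theta> x)) * indicator (cball 0 R) x)"
      using M(1) by (cases "x \<in> cball 0 R") (simp_all add: ennreal_mult')
    finally show "ennreal (norm (wedge k l (\<theta> x) (\<omega> x) std_frame)) \<le> ennreal M * (ennreal (comp_norm k (\<theta> x)) * indicator (cball 0 R) x)" .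
  qed
  also have "\<dots> = ennreal M * (\<integral>\<^sup>+x. ennreal (comp_norm k (\<theta> x)) * indicator (cball 0 R) x \<partial>lborel)"
    by (rule nn_integral_cmult) measurable
  also have "\<dots> < \<infinity>" using \<theta>(2) by (auto simp: loc_bounded_mass_def ennreal_mult_less_top)
  finally show "(\<integral>\<^sup>+x. ennreal (norm (wedge k l (\<theta> x) (\<omega> x) std_frame)) \<partial>lborel) < \<infinity>" .
qed

lemma nn_integral_indicator_Icc:
  fixes \<tau> :: real
  assumes "0 \<le> c" "0 < \<tau>" "\<tau> \<le> 1"
  shows "(\<integral>\<^sup>+t. c * indicator {\<tau>..1} t \<partial>lborel) \<le> c"
proof -
  have "(\<integral>\<^sup>+t. c * indicator {\<tau>..1} t \<partial>lborel) = c * ennreal (1 - \<tau>)"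
    using assms by (simp add: nn_integral_cmult)
  also have "\<dots> \<le> c * 1" using assms by (intro mult_left_mono) (auto simp: ennreal_le_1)
  finally show ?thesis by simp
qed

lemma wedge_zero_left: "wedge k l (\<lambda>v. 0) \<beta> e = 0"
  by (simp add: wedge_def)

lemma wedge_add_left: "wedge k l (\<lambda>v. \<alpha> v + \<beta> v) \<gamma> e = wedge k l \<alpha> \<gamma> e + wedge k l \<beta> \<gamma> e"
  and wedge_add_right: "wedge k l \<gamma> (\<lambda>v. \<alpha> v + \<beta> v) e = wedge k l \<gamma> \<alpha> e + wedge k l \<gamma> \<beta> e"
  unfolding wedge_def by (simp_all add: distrib_left distrib_right sum.distrib add_divide_distrib)

lemma wedge_scale_left: "wedge k l (\<lambda>v. c * \<alpha> v) \<beta> e = c * wedge k l \<alpha> \<beta> e"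
  and wedge_scale_right: "wedge k l \<alpha> (\<lambda>v. c * \<beta> v) e = c * wedge k l \<alpha> \<beta> e"
  unfolding wedge_def by (simp_all add: sum_distrib_left mult_ac)

lemma wedge_eq_sum:
  "wedge k l \<alpha> \<beta> e = (\<Sum>\<sigma> | \<sigma> permutes {..<k + l}.
     (of_int (sign \<sigma>) * \<alpha> (\<lambda>i. e (\<sigma> i)) / (fact k * fact l)) * \<beta> (\<lambda>i. e (\<sigma> (k + i))))"
  unfolding wedge_def sum_divide_distrib by (rule sum.cong) auto

lemma wedge_eq_sum_left:
  "wedge k l \<alpha> \<beta> e = (\<Sum>\<sigma> | \<sigma> permutes {..<k + l}.
     (of_int (sign \<sigma>) * \<beta> (\<lambda>i. e (\<sigma> (k + i))) / (fact k * fact l)) * \<alpha> (\<lambda>i. e (\<sigma> i)))"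
  unfolding wedge_def sum_divide_distrib by (rule sum.cong) auto

section \<open>Homotopy along the dilations\<close>

text \<open>
  The Lie derivative of a form of degree \<open>l + 1\<close> along the Euler field, so that
  \<open>d/dt (m\<^sub>t\<^sup>* \<omega>) = m\<^sub>t\<^sup>* (euler_lie l \<omega>) / t\<close> for the dilations \<open>m\<^sub>t\<close>. Below \<open>t\<close> is replaced by \<open>1 / t\<close>.
\<close>

definition euler_lie :: "nat \<Rightarrow> 'n::finite form \<Rightarrow> 'n form" where
  "euler_lie l \<omega> x v = ext_deriv l (\<lambda>x v. \<omega> x (case_nat x v)) x v + ext_deriv (Suc l) \<omega> x (case_nat x v)"

lemma euler_lie_cc:
  fixes \<omega> :: "'n::finite form"
  assumes \<omega>: "test_form (Suc l) \<omega>"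
  shows "cc_form (euler_lie l \<omega>)"
proof -
  have "cc_form (\<lambda>x v. ext_deriv (Suc l) \<omega> x (case_nat x v))"
    using \<omega> unfolding test_form_def
    by (intro cc_form_interior[where l="Suc l"] test_form_ext_deriv_cc[OF \<omega>] alternating_ext_deriv) auto
  from cc_form_add[OF test_form_ext_deriv_cc[OF test_form_interior[OF \<omega>]] this]
  show ?thesis unfolding euler_lie_def[abs_def] .
qed

text \<open>The pullback of \<omega> under x -> x / t has coefficients t^-(l+1) \<omega>(x / t).
  Differentiating the power and the argument gives the two terms on the right of
  \<open>cartan_euler\<close>; the sign and one more factor 1 / t come from the derivative of 1 /
  t.\<close>

lemma dilation_derivative:
  fixes \<omega> :: "'n::finite form"
  assumes \<omega>: "test_form (Suc l) \<omega>" and t: "t > 0"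
  shows "((\<lambda>t. inverse t ^ Suc l * \<omega> (inverse t *\<^sub>R x) v) has_real_derivative
      - (inverse t ^ Suc (Suc l) * euler_lie l \<omega> (inverse t *\<^sub>R x) v)) (at t)"
proof -
  let ?z = "inverse t *\<^sub>R x" and ?D = "frechet_derivative (\<lambda>y. \<omega> y v) (at (inverse t *\<^sub>R x))"
  have sm: "smooth (\<lambda>x. \<omega> x v)" for v using \<omega> unfolding test_form_def by blast
  have alt: "alternating (Suc l) (\<omega> x)" for x using \<omega> unfolding test_form_def by blast
  have D: "((\<lambda>y. \<omega> y v) has_derivative ?D) (at ?z)" by (rule smooth_has_derivative[OF sm])
  have lin: "linear ?D" using D has_derivative_linear by blast
  have "((\<lambda>t. inverse t *\<^sub>R x) has_derivative (\<lambda>s. (- (inverse t * s * inverse t)) *\<^sub>R x)) (at t)"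
    using t by (auto intro!: derivative_eq_intros)
  from has_derivative_compose[OF this D]
  have 1: "((\<lambda>t. \<omega> (inverse t *\<^sub>R x) v) has_derivative (\<lambda>s. ?D ((- (inverse t * s * inverse t)) *\<^sub>R x))) (at t)" .
  have 2: "?D ((- (inverse t * s * inverse t)) *\<^sub>R x) = (- (inverse t * ?D ?z)) * s" for s
  proof -
    have "(- (inverse t * s * inverse t)) *\<^sub>R x = (- (inverse t * s)) *\<^sub>R ?z" by simp
    then show ?thesis by (simp only: linear_scale[OF lin]) simp
  qed
  have 3: "((\<lambda>t. \<omega> (inverse t *\<^sub>R x) v) has_real_derivative - (inverse t * ?D ?z)) (at t)"
    using 1 unfolding 2 has_field_derivative_def .
  have "((\<lambda>t. inverse t ^ Suc l * \<omega> (inverse t *\<^sub>R x) v) has_real_derivative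
     inverse t ^ Suc l * (- (inverse t * ?D ?z)) + (real (Suc l) * (- (inverse t * inverse t)) * inverse t ^ l) * \<omega> ?z v) (at t)"
    by (rule derivative_eq_intros 3 | use t in simp)+
  also have "inverse t ^ Suc l * (- (inverse t * ?D ?z)) + (real (Suc l) * (- (inverse t * inverse t)) * inverse t ^ l) * \<omega> ?z v
     = - (inverse t ^ Suc (Suc l) * (real (Suc l) * \<omega> ?z v + ?D ?z))"
    by (simp add: algebra_simps)
  also have "real (Suc l) * \<omega> ?z v + ?D ?z = euler_lie l \<omega> ?z v"
    unfolding euler_lie_def by (rule cartan_euler[OF alt sm, symmetric])
  finally show ?thesis .
qed

lemma cc_form_scale_continuous:
  assumes "cc_form \<omega>" "0 < \<tau>"
  shows "continuous_on {\<tau>..1} (\<lambda>t. \<omega> (inverse t *\<^sub>R x) v)"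
proof -
  have "continuous_on {\<tau>..1} (\<lambda>t. inverse t *\<^sub>R x)" using assms(2) by (auto intro!: continuous_intros)
  then show ?thesis
    using assms unfolding cc_form_def
    by (intro continuous_on_compose2[of UNIV "\<lambda>x. \<omega> x v" "{\<tau>..1}" "\<lambda>t. inverse t *\<^sub>R x"]) auto
qed

text \<open>The fundamental theorem of calculus for \<open>dilation_derivative\<close> at a fixed x:
  with \<alpha> fixed, the wedge product is linear in its second factor. The positive lower limit
  \<tau> keeps 1 / t bounded.\<close>

lemma homotopy_pointwise:
  fixes \<omega> :: "'n::finite form"
  assumes \<omega>: "test_form (Suc l) \<omega>" and \<tau>: "0 < \<tau>" "\<tau> \<le> 1"
  shows "(LINT t|lborel. indicator {\<tau>..1} t * (inverse t ^ Suc (Suc l) * wedge k (Suc l) \<alpha> (euler_lie l \<omega> (inverse t *\<^sub>R x)) e))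
     = inverse \<tau> ^ Suc l * wedge k (Suc l) \<alpha> (\<omega> (inverse \<tau> *\<^sub>R x)) e - wedge k (Suc l) \<alpha> (\<omega> x) e"
proof -
  let ?F = "\<lambda>t. - (inverse t ^ Suc l * wedge k (Suc l) \<alpha> (\<omega> (inverse t *\<^sub>R x)) e)"
  let ?f = "\<lambda>t. inverse t ^ Suc (Suc l) * wedge k (Suc l) \<alpha> (euler_lie l \<omega> (inverse t *\<^sub>R x)) e"
  have "(?F has_real_derivative ?f t) (at t within {\<tau>..1})" if t: "\<tau> \<le> t" for t
  proof -
    have "t > 0" using t \<tau> by simp
    then have "((\<lambda>t. - (\<Sum>\<sigma> | \<sigma> permutes {..<k + Suc l}.
       (of_int (sign \<sigma>) * \<alpha> (\<lambda>i. e (\<sigma> i)) / (fact k * fact (Suc l))) * (inverse t ^ Suc l * \<omega> (inverse t *\<^sub>R x) (\<lambda>i. e (\<sigma> (k + i))))))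
      has_real_derivative - (\<Sum>\<sigma> | \<sigma> permutes {..<k + Suc l}.
       (of_int (sign \<sigma>) * \<alpha> (\<lambda>i. e (\<sigma> i)) / (fact k * fact (Suc l))) *
         (- (inverse t ^ Suc (Suc l) * euler_lie l \<omega> (inverse t *\<^sub>R x) (\<lambda>i. e (\<sigma> (k + i))))))) (at t within {\<tau>..1})"
      by (intro DERIV_minus DERIV_sum DERIV_cmult has_field_derivative_at_within[OF dilation_derivative[OF \<omega>]])
    then show ?thesis
      unfolding wedge_eq_sum by (simp only: sum_distrib_left sum_negf[symmetric] mult_minus_right minus_minus mult.left_commute)
  qed
  then have "(LINT t|lborel. indicator {\<tau>..1} t *\<^sub>R ?f t) = ?F 1 - ?F \<tau>"
    using \<tau> cc_form_scale_continuous[OF euler_lie_cc[OF \<omega>] \<tau>(1)]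
    by (intro integral_FTC_atLeastAtMost)
      (auto simp: has_real_derivative_iff_has_vector_derivative[symmetric] wedge_eq_sum intro!: continuous_intros)
  then show ?thesis by simp
qed

text \<open>Since \<theta> cannot be differentiated, t first enters through \<omega>(x / t), where
  \<open>homotopy_pointwise\<close> applies. Fubini over the interval from \<tau> to 1 and the
  substitution x -> t x then transfer the dilation to \<theta>.\<close>

lemma homotopy_integrated:
  fixes \<theta> \<omega> :: "'n::finite form"
  assumes \<omega>: "test_form (Suc l) \<omega>" and \<tau>: "0 < \<tau>" "\<tau> \<le> 1"
    and \<theta>: "borel_form (Suc m) \<theta>" "loc_bounded_mass (Suc m) \<theta>" and n: "CARD('n) = Suc m + Suc l"
  defines "J t \<equiv> t ^ Suc m * (LINT x|lborel. wedge (Suc m) (Suc l) (\<theta> (t *\<^sub>R x)) (\<omega> x) std_frame)"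
    and "W t \<equiv> LINT x|lborel. wedge (Suc m) (Suc l) (\<theta> (t *\<^sub>R x)) (euler_lie l \<omega> x) std_frame"
  shows "J \<tau> - J 1 = (LINT t|lborel. indicator {\<tau>..1} t * (t ^ m * W t))"
proof -
  let ?w = "wedge (Suc m) (Suc l)"
  define f where "f x t = indicator {\<tau>..1} t * (inverse t ^ Suc (Suc l) * ?w (\<theta> x) (euler_lie l \<omega> (inverse t *\<^sub>R x)) std_frame)" for x t
  note alt = borel_formD(1)[OF \<theta>(1)]
  note [measurable] = borel_formD(2)[OF \<theta>(1)] cc_formD[OF euler_lie_cc[OF \<omega>]] cc_formD[OF test_form_cc[OF \<omega>]]
  have [measurable]: "cball (0::real^'n) r \<in> sets borel" for r by simp
  have cn[measurable]: "(\<lambda>x. comp_norm (Suc m) (\<theta> x)) \<in> borel_measurable borel"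
    by (rule comp_norm_measurable) measurable
  have fm[measurable]: "(\<lambda>(x, t). f x t) \<in> borel_measurable (lborel \<Otimes>\<^sub>M lborel)"
    unfolding f_def wedge_def by measurable
  obtain M R where M: "M \<ge> 0" "R > 0"
    "\<And>x \<alpha>. alternating (Suc m) \<alpha> \<Longrightarrow> \<bar>?w \<alpha> (euler_lie l \<omega> x) std_frame\<bar> \<le> M * (comp_norm (Suc m) \<alpha> * indicator (cball 0 R) x)"
    using wedge_cc_bound[OF euler_lie_cc[OF \<omega>], of "Suc m" "Suc l"] by metis
  define C where "C = inverse \<tau> ^ Suc (Suc l) * M"
  have C: "C \<ge> 0" using M \<tau> by (simp add: C_def)
  have fint: "integrable (lborel \<Otimes>\<^sub>M lborel) (\<lambda>(x, t). f x t)"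
  proof (rule integrableI_bounded[OF fm])
    have "(\<integral>\<^sup>+z. ennreal (norm (case z of (x, t) \<Rightarrow> f x t)) \<partial>(lborel \<Otimes>\<^sub>M lborel)) = (\<integral>\<^sup>+x. \<integral>\<^sup>+t. ennreal (norm (f x t)) \<partial>lborel \<partial>lborel)"
      by (subst lborel.nn_integral_fst[symmetric]) (auto intro: fm measurable_compose[OF fm])
    also have "\<dots> \<le> (\<integral>\<^sup>+x. \<integral>\<^sup>+t. (ennreal C * (ennreal (comp_norm (Suc m) (\<theta> x)) * indicator (cball 0 R) x)) * indicator {\<tau>..1} t \<partial>lborel \<partial>lborel)"
    proof (intro nn_integral_mono)
      fix x :: "real^'n" and t :: real
      show "ennreal (norm (f x t)) \<le> (ennreal C * (ennreal (comp_norm (Suc m) (\<theta> x)) * indicator (cball 0 R) x)) * indicator {\<tau>..1} t"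
      proof (cases "t \<in> {\<tau>..1}")
        case True
        then have t: "0 < t" "t \<le> 1" "\<tau> \<le> t" using \<tau> by auto
        have i: "inverse t ^ Suc (Suc l) \<le> inverse \<tau> ^ Suc (Suc l)"
          using t \<tau> by (intro power_mono) (auto simp: le_imp_inverse_le)
        \<comment> \<open>For t \<le> 1 the dilated form is supported in the same ball, so one
          majorant serves all t.\<close>
        have "indicator (cball 0 R) (inverse t *\<^sub>R x) \<le> (indicator (cball 0 R) x :: real)"
        proof -
          have "norm x \<le> inverse t * norm x" using t by (simp add: mult_le_cancel_right1 one_le_inverse)
          then show ?thesis using t by (auto simp: indicator_def)
        qed
        then have "\<bar>?w (\<theta> x) (euler_lie l \<omega> (inverse t *\<^sub>R x)) std_frame\<bar> \<le> M * (comp_norm (Suc m) (\<theta> x) * indicator (cball 0 R) x)"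
          using M(1) by (intro order_trans[OF M(3)[OF alt]] mult_left_mono comp_norm_nonneg)
        then have "inverse t ^ Suc (Suc l) * \<bar>?w (\<theta> x) (euler_lie l \<omega> (inverse t *\<^sub>R x)) std_frame\<bar>
            \<le> inverse \<tau> ^ Suc (Suc l) * (M * (comp_norm (Suc m) (\<theta> x) * indicator (cball 0 R) x))"
          using t \<tau> by (intro mult_mono[OF i]) auto
        moreover have "norm (f x t) = inverse t ^ Suc (Suc l) * \<bar>?w (\<theta> x) (euler_lie l \<omega> (inverse t *\<^sub>R x)) std_frame\<bar>"
          unfolding f_def using True t by (simp add: abs_mult)
        ultimately have "norm (f x t) \<le> C * (comp_norm (Suc m) (\<theta> x) * indicator (cball 0 R) x)"
          by (simp only: C_def mult.assoc)
        then have "ennreal (norm (f x t)) \<le> ennreal (C * (comp_norm (Suc m) (\<theta> x) * indicator (cball 0 R) x))"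
          by (rule ennreal_leI)
        also have "\<dots> = ennreal C * (ennreal (comp_norm (Suc m) (\<theta> x)) * indicator (cball 0 R) x)"
          using C by (cases "x \<in> cball 0 R") (simp_all add: ennreal_mult')
        finally show ?thesis using True by simp
      qed (simp add: f_def)
    qed
    also have "\<dots> \<le> (\<integral>\<^sup>+x. ennreal C * (ennreal (comp_norm (Suc m) (\<theta> x)) * indicator (cball 0 R) x) \<partial>lborel)"
      by (intro nn_integral_mono nn_integral_indicator_Icc \<tau>) simp
    also have "\<dots> = ennreal C * (\<integral>\<^sup>+x. ennreal (comp_norm (Suc m) (\<theta> x)) * indicator (cball 0 R) x \<partial>lborel)"
      by (rule nn_integral_cmult) measurable
    also have "\<dots> < \<infinity>" using \<theta>(2) by (auto simp: loc_bounded_mass_def ennreal_mult_less_top)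
    finally show "(\<integral>\<^sup>+z. ennreal (norm (case z of (x, t) \<Rightarrow> f x t)) \<partial>(lborel \<Otimes>\<^sub>M lborel)) < \<infinity>" .
  qed
  have int1: "integrable lborel (\<lambda>x. ?w (\<theta> x) (\<omega> (s *\<^sub>R x)) std_frame)" if "s > 0" for s
    by (rule wedge_integrable) (use alt \<theta> test_form_cc[OF test_form_scale_arg[OF \<omega>, of s]] that in auto)
  have scale: "(LINT x|lborel. ?w (\<theta> x) (\<eta> (inverse t *\<^sub>R x)) std_frame) = t ^ CARD('n) * (LINT x|lborel. ?w (\<theta> (t *\<^sub>R x)) (\<eta> x) std_frame)"
    if t: "t > 0" and \<eta>: "\<And>v. (\<lambda>x. \<eta> x v) \<in> borel_measurable borel" for t \<eta>
  proof -
    note [measurable] = \<eta>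
    have "(\<lambda>x. ?w (\<theta> x) (\<eta> (inverse t *\<^sub>R x)) std_frame) \<in> borel_measurable borel"
      unfolding wedge_def by measurable
    from integral_scaleR[OF this t] show ?thesis using t by simp
  qed
  \<comment> \<open>Here n = m + l + 2, so the Jacobian t^n exceeds the powers t^-(l+2) and t^-(l+1)
    by t^m and t^(m+1).\<close>
  have tn: "inverse t ^ Suc (Suc l) * t ^ CARD('n) = t ^ m" "inverse t ^ Suc l * t ^ CARD('n) = t ^ Suc m" if "t > 0" for t :: real
    using that unfolding n by (simp_all add: power_add power_inverse field_simps)
  have "(LINT t|lborel. indicator {\<tau>..1} t * (t ^ m * W t)) = (LINT t|lborel. LINT x|lborel. f x t)"
  proof (rule Bochner_Integration.integral_cong[OF refl])
    fix t :: real
    show "indicator {\<tau>..1} t * (t ^ m * W t) = (LINT x|lborel. f x t)"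
    proof (cases "t \<in> {\<tau>..1}")
      case True
      then have t: "t > 0" using \<tau> by simp
      have "(LINT x|lborel. f x t) = inverse t ^ Suc (Suc l) * (LINT x|lborel. ?w (\<theta> x) (euler_lie l \<omega> (inverse t *\<^sub>R x)) std_frame)"
        unfolding f_def using True by (simp only: indicator_simps mult_1 integral_mult_right_zero)
      also have "\<dots> = inverse t ^ Suc (Suc l) * (t ^ CARD('n) * W t)"
        unfolding W_def by (subst scale[OF t]) (auto intro: cc_formD[OF euler_lie_cc[OF \<omega>]])
      also have "\<dots> = t ^ m * W t" using tn(1)[OF t] by (metis mult.assoc)
      finally show ?thesis using True by simp
    qed (simp add: f_def)
  qed
  also have "\<dots> = (LINT x|lborel. LINT t|lborel. f x t)"
    by (rule lborel_pair.Fubini_integral[OF fint])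
  also have "\<dots> = (LINT x|lborel. inverse \<tau> ^ Suc l * ?w (\<theta> x) (\<omega> (inverse \<tau> *\<^sub>R x)) std_frame - ?w (\<theta> x) (\<omega> x) std_frame)"
    unfolding f_def homotopy_pointwise[OF \<omega> \<tau>] ..
  also have "\<dots> = inverse \<tau> ^ Suc l * (LINT x|lborel. ?w (\<theta> x) (\<omega> (inverse \<tau> *\<^sub>R x)) std_frame) - (LINT x|lborel. ?w (\<theta> x) (\<omega> x) std_frame)"
    using int1[of "inverse \<tau>"] int1[of 1] \<tau> by simp
  also have "\<dots> = J \<tau> - J 1"
    unfolding J_def scale[OF \<tau>(1) cc_formD[OF test_form_cc[OF \<omega>]]] using tn(2)[OF \<tau>(1)] by (simp flip: mult.assoc)
  finally show ?thesis by simp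
qed

text \<open>The weak equation d\<theta> = 0 for a Borel representative, freed of its sign and its
  vanishing left-hand side. It is used with k + l + 1 = n.\<close>

definition borel_closed :: "nat \<Rightarrow> nat \<Rightarrow> 'n::finite form \<Rightarrow> bool" where
  "borel_closed k l \<theta> \<longleftrightarrow>
     (\<forall>\<eta>. test_form l \<eta> \<longrightarrow> (LINT x|lborel. wedge k (Suc l) (\<theta> x) (ext_deriv l \<eta> x) std_frame) = 0)"

text \<open>Of the two terms of the Lie derivative, d \<iota> \<omega> integrates to 0 against
  \<theta>(t x): dilating the test form instead reduces this to the closedness of \<theta>. In
  \<iota> d\<omega> the contraction is moved to \<theta> by \<open>wedge_interior\<close>, which
  produces the sign (-1)^m and the integrand of the cone operator.\<close>

lemma closed_euler_lie:
  fixes \<theta> \<omega> :: "'n::finite form"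
  assumes \<omega>: "test_form (Suc l) \<omega>" and t: "t > 0"
    and \<theta>: "borel_form (Suc m) \<theta>" "loc_bounded_mass (Suc m) \<theta>" and n: "CARD('n) = Suc m + Suc l"
    and closed: "borel_closed (Suc m) l \<theta>"
  shows "(LINT x|lborel. wedge (Suc m) (Suc l) (\<theta> (t *\<^sub>R x)) (euler_lie l \<omega> x) std_frame)
     = (-1) ^ m * (LINT x|lborel. wedge m (Suc (Suc l)) (\<lambda>v. \<theta> (t *\<^sub>R x) (case_nat x v)) (ext_deriv (Suc l) \<omega> x) std_frame)"
proof -
  let ?w = "wedge (Suc m) (Suc l)"
  define \<iota> where "\<iota> = (\<lambda>x v. \<omega> x (case_nat x v))"
  have \<iota>: "test_form l \<iota>" unfolding \<iota>_def by (rule test_form_interior[OF \<omega>])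
  have sm\<iota>: "smooth (\<lambda>x. \<iota> x v)" for v using \<iota> unfolding test_form_def by blast
  have alt: "alternating (Suc l) (\<omega> x)" and sm: "smooth (\<lambda>x. \<omega> x v)" for x v
    using \<omega> unfolding test_form_def by auto
  have altd: "alternating (Suc (Suc l)) (ext_deriv (Suc l) \<omega> x)" for x by (rule alternating_ext_deriv[OF alt sm])
  note cc1 = test_form_ext_deriv_cc[OF \<iota>]
  have cc2: "cc_form (\<lambda>x v. ext_deriv (Suc l) \<omega> x (case_nat x v))"
    by (rule cc_form_interior[OF test_form_ext_deriv_cc[OF \<omega>] altd])
  have \<theta>m: "(\<lambda>x. \<theta> (t *\<^sub>R x) v) \<in> borel_measurable lborel" for v
    using measurable_compose[OF _ borel_formD(2)[OF \<theta>(1)], of "\<lambda>x. t *\<^sub>R x" borel v] by simp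
  note int = wedge_integrable[of "Suc m" "\<lambda>x. \<theta> (t *\<^sub>R x)", OF borel_formD(1)[OF \<theta>(1)] \<theta>m loc_bounded_mass_scale[OF \<theta> t]]
  have first: "(LINT x|lborel. ?w (\<theta> (t *\<^sub>R x)) (ext_deriv l \<iota> x) std_frame) = 0"
  proof -
    have ed: "ext_deriv l (\<lambda>x. \<iota> (inverse t *\<^sub>R x)) x = (\<lambda>v. inverse t * ext_deriv l \<iota> (inverse t *\<^sub>R x) v)" for x
      by (rule ext) (rule ext_deriv_scale_arg[OF sm\<iota>])
    have "test_form l (\<lambda>x. \<iota> (inverse t *\<^sub>R x))" using test_form_scale_arg[OF \<iota>, of "inverse t"] t by simp
    then have "(LINT x|lborel. ?w (\<theta> x) (ext_deriv l (\<lambda>x. \<iota> (inverse t *\<^sub>R x)) x) std_frame) = 0"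
      using closed unfolding borel_closed_def by blast
    then have 0: "(LINT x|lborel. ?w (\<theta> x) (ext_deriv l \<iota> (inverse t *\<^sub>R x)) std_frame) = 0"
      unfolding ed wedge_scale_right using t by simp
    note [measurable] = borel_formD(2)[OF \<theta>(1)] cc_formD[OF cc1]
    have "(\<lambda>x. ?w (\<theta> x) (ext_deriv l \<iota> (inverse t *\<^sub>R x)) std_frame) \<in> borel_measurable borel"
      unfolding wedge_def by measurable
    from integral_scaleR[OF this t] 0 show ?thesis using t by simp
  qed
  have "(LINT x|lborel. ?w (\<theta> (t *\<^sub>R x)) (euler_lie l \<omega> x) std_frame)
     = (LINT x|lborel. ?w (\<theta> (t *\<^sub>R x)) (ext_deriv l \<iota> x) std_frame + ?w (\<theta> (t *\<^sub>R x)) (\<lambda>v. ext_deriv (Suc l) \<omega> x (case_nat x v)) std_frame)"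
    unfolding euler_lie_def[abs_def] \<iota>_def wedge_add_right ..
  also have "\<dots> = (LINT x|lborel. ?w (\<theta> (t *\<^sub>R x)) (\<lambda>v. ext_deriv (Suc l) \<omega> x (case_nat x v)) std_frame)"
    using int[OF cc1] int[OF cc2] first by simp
  also have "\<dots> = (LINT x|lborel. (-1) ^ m * wedge m (Suc (Suc l)) (\<lambda>v. \<theta> (t *\<^sub>R x) (case_nat x v)) (ext_deriv (Suc l) \<omega> x) std_frame)"
    unfolding wedge_interior[OF borel_formD(1)[OF \<theta>(1)] altd n] by (simp flip: mult.assoc power_add mult_2)
  finally show ?thesis by simp
qed

text \<open>The support of \<eta> is bounded and \<open>cone_mass\<close> is integrable on balls,
  which justifies the exchange of the t- and x-integrals. The inner t-integral gives
  \<open>cone\<close> wherever the mass is finite, hence almost everywhere.\<close>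

lemma cone_fubini:
  fixes \<theta> \<eta> :: "'n::finite form" and m l :: nat
  assumes \<theta>: "borel_form (Suc m) \<theta>" and \<eta>: "cc_form \<eta>"
    and mass: "AE x in lborel. cone_mass m \<theta> x < \<infinity>"
    "\<And>R. (\<integral>\<^sup>+x. cone_mass m \<theta> x * indicator (cball 0 R) x \<partial>lborel) < \<infinity>"
  defines "U \<equiv> \<lambda>t. LINT x|lborel. wedge m l (\<lambda>v. \<theta> (t *\<^sub>R x) (case_nat x v)) (\<eta> x) std_frame"
  shows "integrable lborel (\<lambda>t. indicator {0<..1} t * (t ^ m * U t))"
    and "(LINT t|lborel. indicator {0<..1} t * (t ^ m * U t)) = (LINT x|lborel. wedge m l (cone m \<theta> x) (\<eta> x) std_frame)"
proof -
  define f where "f x t = indicator {0<..1} t * (t ^ m * wedge m l (\<lambda>v. \<theta> (t *\<^sub>R x) (case_nat x v)) (\<eta> x) std_frame)" for x t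
  have [measurable]: "(\<lambda>(x, t). \<theta> (t *\<^sub>R x) (case_nat x v)) \<in> borel_measurable (borel \<Otimes>\<^sub>M borel)" for v
    using measurable_pair_swap[OF ray_measurable[OF \<theta>]] by simp
  have [measurable]: "(\<lambda>(x, t). comp_norm m (\<lambda>v. \<theta> (t *\<^sub>R x) (case_nat x v))) \<in> borel_measurable (borel \<Otimes>\<^sub>M borel)"
    using measurable_pair_swap[OF ray_comp_norm_measurable[OF \<theta>]] by simp
  note [measurable] = cc_formD[OF \<eta>] cone_mass_measurable[OF \<theta>]
  have [measurable]: "cball (0::real^'n) r \<in> sets borel" for r by simp
  have fm[measurable]: "(\<lambda>(x, t). f x t) \<in> borel_measurable (lborel \<Otimes>\<^sub>M lborel)"
    unfolding f_def wedge_def by measurable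
  obtain M R where M: "M \<ge> 0" "R > 0"
    "\<And>x \<alpha>. alternating m \<alpha> \<Longrightarrow> \<bar>wedge m l \<alpha> (\<eta> x) std_frame\<bar> \<le> M * (comp_norm m \<alpha> * indicator (cball 0 R) x)"
    using wedge_cc_bound[OF \<eta>, of m l] by metis
  have fint: "integrable (lborel \<Otimes>\<^sub>M lborel) (\<lambda>(x, t). f x t)"
  proof (rule integrableI_bounded[OF fm])
    have "(\<integral>\<^sup>+z. ennreal (norm (case z of (x, t) \<Rightarrow> f x t)) \<partial>(lborel \<Otimes>\<^sub>M lborel)) = (\<integral>\<^sup>+x. \<integral>\<^sup>+t. ennreal (norm (f x t)) \<partial>lborel \<partial>lborel)"
      by (subst lborel.nn_integral_fst[symmetric]) (auto intro: fm measurable_compose[OF fm])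
    also have "\<dots> \<le> (\<integral>\<^sup>+x. \<integral>\<^sup>+t. (ennreal M * indicator (cball 0 R) x) *
        (ennreal (t ^ m * comp_norm m (\<lambda>v. \<theta> (t *\<^sub>R x) (case_nat x v))) * indicator {0<..1} t) \<partial>lborel \<partial>lborel)"
    proof (intro nn_integral_mono)
      fix x :: "real^'n" and t :: real
      show "ennreal (norm (f x t)) \<le> (ennreal M * indicator (cball 0 R) x) *
        (ennreal (t ^ m * comp_norm m (\<lambda>v. \<theta> (t *\<^sub>R x) (case_nat x v))) * indicator {0<..1} t)"
      proof (cases "t \<in> {0<..1}")
        case True
        have "norm (f x t) = t ^ m * \<bar>wedge m l (\<lambda>v. \<theta> (t *\<^sub>R x) (case_nat x v)) (\<eta> x) std_frame\<bar>"
          unfolding f_def using True by (simp add: abs_mult)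
        also have "\<dots> \<le> t ^ m * (M * (comp_norm m (\<lambda>v. \<theta> (t *\<^sub>R x) (case_nat x v)) * indicator (cball 0 R) x))"
          using True by (intro mult_left_mono M(3) alternating_interior[OF borel_formD(1)[OF \<theta>]]) auto
        also have "\<dots> = (M * indicator (cball 0 R) x) * (t ^ m * comp_norm m (\<lambda>v. \<theta> (t *\<^sub>R x) (case_nat x v)))"
          by (simp add: mult_ac)
        finally have "ennreal (norm (f x t)) \<le> ennreal ((M * indicator (cball 0 R) x) * (t ^ m * comp_norm m (\<lambda>v. \<theta> (t *\<^sub>R x) (case_nat x v))))"
          by (rule ennreal_leI)
        also have "\<dots> = (ennreal M * indicator (cball 0 R) x) * ennreal (t ^ m * comp_norm m (\<lambda>v. \<theta> (t *\<^sub>R x) (case_nat x v)))"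
          using M(1) by (cases "x \<in> cball 0 R") (simp_all add: ennreal_mult')
        finally show ?thesis using True by simp
      qed (simp add: f_def)
    qed
    also have "\<dots> = (\<integral>\<^sup>+x. (ennreal M * indicator (cball 0 R) x) * cone_mass m \<theta> x \<partial>lborel)"
      unfolding cone_mass_def by (intro nn_integral_cong nn_integral_cmult) measurable
    also have "\<dots> = (\<integral>\<^sup>+x. ennreal M * (cone_mass m \<theta> x * indicator (cball 0 R) x) \<partial>lborel)"
      by (simp add: mult_ac)
    also have "\<dots> = ennreal M * (\<integral>\<^sup>+x. cone_mass m \<theta> x * indicator (cball 0 R) x \<partial>lborel)"
      by (rule nn_integral_cmult) measurable
    also have "\<dots> < \<infinity>" using mass(2)[of R] by (auto simp: ennreal_mult_less_top)
    finally show "(\<integral>\<^sup>+z. ennreal (norm (case z of (x, t) \<Rightarrow> f x t)) \<partial>(lborel \<Otimes>\<^sub>M lborel)) < \<infinity>" .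
  qed
  have U: "(LINT x|lborel. f x t) = indicator {0<..1} t * (t ^ m * U t)" for t
    unfolding f_def U_def by (simp only: integral_mult_right_zero)
  show "integrable lborel (\<lambda>t. indicator {0<..1} t * (t ^ m * U t))"
    using lborel_pair.integrable_snd[OF fint] unfolding U .
  have "(LINT t|lborel. indicator {0<..1} t * (t ^ m * U t)) = (LINT x|lborel. LINT t|lborel. f x t)"
    unfolding U[symmetric] by (rule lborel_pair.Fubini_integral[OF fint])
  also have "\<dots> = (LINT x|lborel. wedge m l (cone m \<theta> x) (\<eta> x) std_frame)"
  proof (rule integral_cong_AE)
    show "(\<lambda>x. LINT t|lborel. f x t) \<in> borel_measurable lborel"
      by (rule sigma_finite_measure.borel_measurable_lebesgue_integral[OF sigma_finite_lborel fm])
    show "(\<lambda>x. wedge m l (cone m \<theta> x) (\<eta> x) std_frame) \<in> borel_measurable lborel"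
      by (rule wedge_measurable) (use cone_measurable[OF \<theta>] cc_formD[OF \<eta>] in auto)
    show "AE x in lborel. (LINT t|lborel. f x t) = wedge m l (cone m \<theta> x) (\<eta> x) std_frame"
      using mass(1)
    proof eventually_elim
      case (elim x)
      let ?c = "\<lambda>\<sigma>. of_int (sign \<sigma>) * \<eta> x (\<lambda>i. std_frame (\<sigma> (m + i))) / (fact m * fact l) :: real"
      let ?h = "\<lambda>\<sigma> t. indicator {0<..1} t * (t ^ m * \<theta> (t *\<^sub>R x) (case_nat x (\<lambda>i. std_frame (\<sigma> i))))"
      have "f x t = (\<Sum>\<sigma> | \<sigma> permutes {..<m + l}. ?c \<sigma> * ?h \<sigma> t)" for t
        unfolding f_def wedge_eq_sum_left sum_distrib_left by (rule sum.cong) auto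
      then have "(LINT t|lborel. f x t) = (\<Sum>\<sigma> | \<sigma> permutes {..<m + l}. ?c \<sigma> * (LINT t|lborel. ?h \<sigma> t))"
        using cone_integrable[OF \<theta> elim] by (simp only:) (subst Bochner_Integration.integral_sum, auto)
      also have "\<dots> = wedge m l (cone m \<theta> x) (\<eta> x) std_frame"
        unfolding wedge_eq_sum_left cone_def using elim by simp
      finally show ?case .
    qed
  qed
  finally show "(LINT t|lborel. indicator {0<..1} t * (t ^ m * U t)) = (LINT x|lborel. wedge m l (cone m \<theta> x) (\<eta> x) std_frame)" .
qed

text \<open>By scaling and Hoelder, the L^1 norm of \<theta>(\<tau> x) on a ball is at most a
  multiple of \<tau>^(-n/p), so its product with \<tau>^k tends to 0 when p > n / k. In place of
  Hoelder, \<open>young_crude\<close> is used with c a power of \<tau>.\<close>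

lemma dilation_vanishes:
  fixes \<theta> \<omega> :: "'n::finite form"
  assumes \<omega>: "cc_form \<omega>" and \<theta>: "borel_form k \<theta>"
    and p: "1 < p" "real CARD('n) < real k * p" "k \<le> CARD('n)"
    and fin: "\<And>R. (\<integral>\<^sup>+x. ennreal (comp_norm k (\<theta> x) powr p) * indicator (cball 0 R) x \<partial>lborel) < \<infinity>"
  shows "(\<lambda>j. inverse (real (Suc j)) ^ k * (LINT x|lborel. wedge k l (\<theta> (inverse (real (Suc j)) *\<^sub>R x)) (\<omega> x) std_frame)) \<longlonglongrightarrow> 0"
proof -
  let ?n = "CARD('n)"
  have [measurable]: "cball (0::real^'n) r \<in> sets borel" for r by simp
  have [measurable]: "(\<lambda>x. comp_norm k (\<theta> x)) \<in> borel_measurable borel"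
    by (rule comp_norm_measurable) (rule borel_formD(2)[OF \<theta>])
  obtain M R where M: "M \<ge> 0" "R > 0"
    "\<And>x \<alpha>. alternating k \<alpha> \<Longrightarrow> \<bar>wedge k l \<alpha> (\<omega> x) std_frame\<bar> \<le> M * (comp_norm k \<alpha> * indicator (cball 0 R) x)"
    using wedge_cc_bound[OF \<omega>, of k l] by metis
  define V where "V = measure lborel (cball (0::real^'n) R)"
  define Q where "Q = enn2real (\<integral>\<^sup>+x. ennreal (comp_norm k (\<theta> x) powr p) * indicator (cball 0 R) x \<partial>lborel)"
  have V: "emeasure lborel (cball (0::real^'n) R) = ennreal V"
    unfolding V_def by (rule emeasure_eq_ennreal_measure) (use emeasure_lborel_cball_finite[of "0::real^'n" R] in auto)
  have Q: "(\<integral>\<^sup>+x. ennreal (comp_norm k (\<theta> x) powr p) * indicator (cball 0 R) x \<partial>lborel) = ennreal Q" "Q \<ge> 0"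
    using fin[of R] by (auto simp: Q_def)
  \<comment> \<open>With c = \<tau>^(-\<mu>) the two terms of the bound carry the exponents k -
    \<mu> and k - n + \<mu> (p - 1). Both are positive when z < \<mu> < k, and z < k amounts to n <
    k p; \<mu> is the midpoint.\<close>
  define z where "z = (real ?n - real k) / (p - 1)"
  define \<mu> where "\<mu> = (z + real k) / 2"
  have "z < real k" using p by (simp add: z_def field_simps)
  then have \<mu>: "\<mu> < real k" "(real ?n - real k) / (p - 1) < \<mu>" unfolding z_def[symmetric] by (auto simp: \<mu>_def)
  then have \<mu>2: "real k - real ?n + \<mu> * (p - 1) > 0" using p by (simp add: field_simps)
  have bound: "\<bar>\<tau> ^ k * (LINT x|lborel. wedge k l (\<theta> (\<tau> *\<^sub>R x)) (\<omega> x) std_frame)\<bar>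
     \<le> M * V * \<tau> powr (real k - \<mu>) + M * Q * \<tau> powr (real k - real ?n + \<mu> * (p - 1))"
    if \<tau>: "0 < \<tau>" "\<tau> \<le> 1" for \<tau>
  proof -
    define c where "c = \<tau> powr (- \<mu>)"
    have c: "c > 0" using \<tau> by (simp add: c_def)
    let ?F = "\<lambda>x. wedge k l (\<theta> (\<tau> *\<^sub>R x)) (\<omega> x) std_frame"
    have sc: "(\<integral>\<^sup>+x. ennreal (comp_norm k (\<theta> (\<tau> *\<^sub>R x)) powr p) * indicator (cball 0 R) x \<partial>lborel) \<le> ennreal (inverse \<tau> ^ ?n * Q)"
    proof -
      have f: "(\<lambda>x. ennreal (comp_norm k (\<theta> (\<tau> *\<^sub>R x)) powr p) * indicator (cball 0 R) x) \<in> borel_measurable borel"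
        by measurable
      have "(\<integral>\<^sup>+x. ennreal (comp_norm k (\<theta> (\<tau> *\<^sub>R x)) powr p) * indicator (cball 0 R) x \<partial>lborel)
        = (\<integral>\<^sup>+x. ennreal (inverse \<tau> ^ ?n) * (ennreal (comp_norm k (\<theta> x) powr p) * indicator (cball 0 R) (inverse \<tau> *\<^sub>R x)) \<partial>lborel)"
        using \<tau> by (subst nn_integral_scaleR[OF f, of "inverse \<tau>"]) auto
      also have "\<dots> \<le> (\<integral>\<^sup>+x. ennreal (inverse \<tau> ^ ?n) * (ennreal (comp_norm k (\<theta> x) powr p) * indicator (cball 0 R) x) \<partial>lborel)"
      proof (intro nn_integral_mono mult_left_mono)
        fix x :: "real^'n"
        have "norm x \<le> inverse \<tau> * norm x" using \<tau> by (simp add: mult_le_cancel_right1 one_le_inverse)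
        then show "indicator (cball 0 R) (inverse \<tau> *\<^sub>R x) \<le> (indicator (cball 0 R) x :: ennreal)"
          using \<tau> by (auto simp: indicator_def)
      qed auto
      also have "\<dots> = ennreal (inverse \<tau> ^ ?n) * ennreal Q"
        unfolding Q(1)[symmetric] by (rule nn_integral_cmult) measurable
      finally show ?thesis using Q(2) by (simp add: ennreal_mult'')
    qed
    have "ennreal \<bar>LINT x|lborel. ?F x\<bar> \<le> (\<integral>\<^sup>+x. ennreal (norm (?F x)) \<partial>lborel)"
    proof (cases "integrable lborel ?F")
      case True
      then show ?thesis using integral_norm_bound_ennreal[OF True] by simp
    qed (simp add: not_integrable_integral_eq)
    also have "\<dots> \<le> (\<integral>\<^sup>+x. ennreal (M * c) * indicator (cball 0 R) x +
         ennreal (M * c powr (1 - p)) * (ennreal (comp_norm k (\<theta> (\<tau> *\<^sub>R x)) powr p) * indicator (cball 0 R) x) \<partial>lborel)"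
    proof (rule nn_integral_mono)
      fix x :: "real^'n"
      show "ennreal (norm (?F x)) \<le> ennreal (M * c) * indicator (cball 0 R) x +
         ennreal (M * c powr (1 - p)) * (ennreal (comp_norm k (\<theta> (\<tau> *\<^sub>R x)) powr p) * indicator (cball 0 R) x)"
      proof (cases "x \<in> cball 0 R")
        case True
        have "norm (?F x) \<le> M * comp_norm k (\<theta> (\<tau> *\<^sub>R x))"
          using M(3)[OF borel_formD(1)[OF \<theta>], of "\<tau> *\<^sub>R x" x] True by simp
        also have "\<dots> \<le> M * (c + c powr (1 - p) * comp_norm k (\<theta> (\<tau> *\<^sub>R x)) powr p)"
          using M(1) c p by (intro mult_left_mono young_crude comp_norm_nonneg) auto
        finally have "ennreal (norm (?F x)) \<le> ennreal (M * c + M * c powr (1 - p) * comp_norm k (\<theta> (\<tau> *\<^sub>R x)) powr p)"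
          by (intro ennreal_leI) (simp add: distrib_left mult.assoc)
        also have "\<dots> = ennreal (M * c) + ennreal (M * c powr (1 - p)) * ennreal (comp_norm k (\<theta> (\<tau> *\<^sub>R x)) powr p)"
          using M(1) c by (simp add: ennreal_plus ennreal_mult'')
        finally show ?thesis using True by simp
      next
        case False
        then show ?thesis using M(3)[OF borel_formD(1)[OF \<theta>], of "\<tau> *\<^sub>R x" x] by simp
      qed
    qed
    also have "\<dots> = ennreal (M * c) * ennreal V + ennreal (M * c powr (1 - p)) *
        (\<integral>\<^sup>+x. ennreal (comp_norm k (\<theta> (\<tau> *\<^sub>R x)) powr p) * indicator (cball 0 R) x \<partial>lborel)"
    proof -
      have "(\<integral>\<^sup>+x. ennreal (M * c powr (1 - p)) * (ennreal (comp_norm k (\<theta> (\<tau> *\<^sub>R x)) powr p) * indicator (cball 0 R) x) \<partial>lborel)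
        = ennreal (M * c powr (1 - p)) * (\<integral>\<^sup>+x. ennreal (comp_norm k (\<theta> (\<tau> *\<^sub>R x)) powr p) * indicator (cball 0 R) x \<partial>lborel)"
        by (rule nn_integral_cmult) measurable
      moreover have "(\<integral>\<^sup>+x. ennreal (M * c) * indicator (cball (0::real^'n) R) x \<partial>lborel) = ennreal (M * c) * ennreal V"
        by (simp add: nn_integral_cmult_indicator V)
      ultimately show ?thesis by (subst nn_integral_add) auto
    qed
    also have "\<dots> \<le> ennreal (M * c) * ennreal V + ennreal (M * c powr (1 - p)) * ennreal (inverse \<tau> ^ ?n * Q)"
      by (intro add_left_mono mult_left_mono sc) simp
    also have "\<dots> = ennreal (M * c * V + M * c powr (1 - p) * (inverse \<tau> ^ ?n * Q))"
      using M(1) c Q(2) \<tau> by (simp add: ennreal_plus ennreal_mult'' V_def)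
    finally have b: "\<bar>LINT x|lborel. ?F x\<bar> \<le> M * c * V + M * c powr (1 - p) * (inverse \<tau> ^ ?n * Q)"
      using M(1) c Q(2) \<tau> by (subst (asm) ennreal_le_iff) (auto simp: V_def intro!: add_nonneg_nonneg mult_nonneg_nonneg)
    have "\<bar>\<tau> ^ k * (LINT x|lborel. ?F x)\<bar> = \<tau> ^ k * \<bar>LINT x|lborel. ?F x\<bar>" using \<tau> by (simp add: abs_mult)
    also have "\<dots> \<le> \<tau> ^ k * (M * c * V + M * c powr (1 - p) * (inverse \<tau> ^ ?n * Q))"
      using b \<tau> by (intro mult_left_mono) auto
    also have "\<dots> = M * V * (\<tau> ^ k * c) + M * Q * (\<tau> ^ k * c powr (1 - p) * inverse \<tau> ^ ?n)"
      by (simp add: algebra_simps)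
    also have "\<tau> ^ k * c = \<tau> powr (real k - \<mu>)"
      unfolding c_def using \<tau> by (simp flip: powr_realpow powr_add)
    also have "\<tau> ^ k * c powr (1 - p) * inverse \<tau> ^ ?n = \<tau> powr (real k - real ?n + \<mu> * (p - 1))"
    proof -
      have "inverse \<tau> ^ ?n = \<tau> powr (- real ?n)" using \<tau> by (simp add: powr_minus powr_realpow power_inverse)
      moreover have "c powr (1 - p) = \<tau> powr (\<mu> * (p - 1))" unfolding c_def by (simp add: powr_powr algebra_simps)
      moreover have "\<tau> ^ k = \<tau> powr real k" using \<tau> by (simp add: powr_realpow)
      ultimately show ?thesis by (simp flip: powr_add add: algebra_simps)
    qed
    finally show ?thesis .
  qed
  have lim: "(\<lambda>j. inverse (real (Suc j)) powr a) \<longlonglongrightarrow> 0" if "a > 0" for a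
    using LIMSEQ_inverse_real_of_nat that by (intro tendsto_zero_powrI) auto
  show ?thesis
  proof (rule Lim_null_comparison)
    show "(\<lambda>j. M * V * inverse (real (Suc j)) powr (real k - \<mu>) +
        M * Q * inverse (real (Suc j)) powr (real k - real ?n + \<mu> * (p - 1))) \<longlonglongrightarrow> 0"
      using tendsto_add[OF tendsto_mult_right_zero[OF lim[of "real k - \<mu>"], of "M * V"]
          tendsto_mult_right_zero[OF lim[OF \<mu>2], of "M * Q"]] \<mu>(1) by simp
    show "eventually (\<lambda>j. norm (inverse (real (Suc j)) ^ k * (LINT x|lborel. wedge k l (\<theta> (inverse (real (Suc j)) *\<^sub>R x)) (\<omega> x) std_frame))
      \<le> M * V * inverse (real (Suc j)) powr (real k - \<mu>) +
        M * Q * inverse (real (Suc j)) powr (real k - real ?n + \<mu> * (p - 1))) sequentially"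
      unfolding real_norm_def by (intro always_eventually allI bound) (auto simp: inverse_le_1_iff)
  qed
qed

text \<open>
  Cartan's formula is integrated along the dilations. The closedness of \<open>\<theta>\<close> removes the term with
  \<open>d \<iota>\<^sub>E \<omega>\<close>, and the boundary term at the origin vanishes since \<open>p > n / k\<close>.
\<close>

lemma cone_weak_primitive:
  fixes \<theta> \<omega> :: "'n::finite form"
  assumes \<omega>: "test_form (Suc l) \<omega>"
    and \<theta>: "borel_form (Suc m) \<theta>" "loc_bounded_mass (Suc m) \<theta>" and n: "CARD('n) = Suc m + Suc l"
    and closed: "borel_closed (Suc m) l \<theta>"
    and mass: "AE x in lborel. cone_mass m \<theta> x < \<infinity>"
    "\<And>R. (\<integral>\<^sup>+x. cone_mass m \<theta> x * indicator (cball 0 R) x \<partial>lborel) < \<infinity>"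
    and p: "1 < p" "real CARD('n) < real (Suc m) * p"
    and fin: "\<And>R. (\<integral>\<^sup>+x. ennreal (comp_norm (Suc m) (\<theta> x) powr p) * indicator (cball 0 R) x \<partial>lborel) < \<infinity>"
  shows "(LINT x|lborel. wedge (Suc m) (Suc l) (\<theta> x) (\<omega> x) std_frame)
     = (-1) ^ Suc m * (LINT x|lborel. wedge m (Suc (Suc l)) (cone m \<theta> x) (ext_deriv (Suc l) \<omega> x) std_frame)"
proof -
  define J where "J t = t ^ Suc m * (LINT x|lborel. wedge (Suc m) (Suc l) (\<theta> (t *\<^sub>R x)) (\<omega> x) std_frame)" for t
  define W where "W t = (LINT x|lborel. wedge (Suc m) (Suc l) (\<theta> (t *\<^sub>R x)) (euler_lie l \<omega> x) std_frame)" for t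
  define U where "U t = (LINT x|lborel. wedge m (Suc (Suc l)) (\<lambda>v. \<theta> (t *\<^sub>R x) (case_nat x v)) (ext_deriv (Suc l) \<omega> x) std_frame)" for t
  note fub = cone_fubini[OF \<theta>(1) test_form_ext_deriv_cc[OF \<omega>] mass, of "Suc (Suc l)", folded U_def]
  let ?g = "\<lambda>t. indicator {0<..1} t * (t ^ m * W t)"
  have g: "?g = (\<lambda>t. (-1) ^ m * (indicator {0<..1} t * (t ^ m * U t)))"
  proof
    fix t :: real
    show "?g t = (-1) ^ m * (indicator {0<..1} t * (t ^ m * U t))"
      using closed_euler_lie[OF \<omega> _ \<theta> n closed, of t] by (cases "t \<in> {0<..1}") (simp_all add: W_def U_def)
  qed
  have gint: "integrable lborel ?g" unfolding g by (intro integrable_mult_right fub(1))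
  define \<tau> where "\<tau> j = inverse (real (Suc j))" for j
  have \<tau>: "0 < \<tau> j" "\<tau> j \<le> 1" for j by (auto simp: \<tau>_def inverse_le_1_iff)
  have \<tau>0: "\<tau> \<longlonglongrightarrow> 0" unfolding \<tau>_def by (rule LIMSEQ_inverse_real_of_nat)
  have eq: "indicator {\<tau> j..1} t * (t ^ m * W t) = indicator {\<tau> j..1} t * ?g t" for j t
    using \<tau>(1)[of j] by (auto simp: indicator_def)
  \<comment> \<open>The homotopy formula is available only away from t = 0. The integrand is
    integrable down to 0 by \<open>cone_fubini\<close>, so the lower limit can tend to 0 by
    dominated convergence.\<close>
  have "(\<lambda>j. LINT t|lborel. indicator {\<tau> j..1} t * ?g t) \<longlonglongrightarrow> (LINT t|lborel. ?g t)"
  proof (rule integral_dominated_convergence[where w="\<lambda>t. norm (?g t)"])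
    show "?g \<in> borel_measurable lborel" by (rule borel_measurable_integrable[OF gint])
    from borel_measurable_times[OF _ this]
    show "(\<lambda>t. indicator {\<tau> j..1} t * ?g t) \<in> borel_measurable lborel" for j by simp
    show "integrable lborel (\<lambda>t. norm (?g t))" using gint by (rule integrable_norm)
    show "AE t in lborel. (\<lambda>j. indicator {\<tau> j..1} t * ?g t) \<longlonglongrightarrow> ?g t"
    proof (rule AE_I2)
      fix t :: real
      show "(\<lambda>j. indicator {\<tau> j..1} t * ?g t) \<longlonglongrightarrow> ?g t"
      proof (cases "t \<in> {0<..1}")
        case True
        then have "eventually (\<lambda>j. \<tau> j < t) sequentially" using order_tendstoD(2)[OF \<tau>0] by simp
        then have "eventually (\<lambda>j. indicator {\<tau> j..1} t * ?g t = ?g t) sequentially"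
          by eventually_elim (use True in auto)
        then show ?thesis by (rule tendsto_eventually)
      qed simp
    qed
    show "AE t in lborel. norm (indicator {\<tau> j..1} t * ?g t) \<le> norm (?g t)" for j
      by (rule AE_I2) (auto simp: indicator_def)
  qed
  moreover have "(LINT t|lborel. indicator {\<tau> j..1} t * ?g t) = J (\<tau> j) - J 1" for j
  proof -
    have "J (\<tau> j) - J 1 = (LINT t|lborel. indicator {\<tau> j..1} t * (t ^ m * W t))"
      unfolding J_def W_def by (rule homotopy_integrated[OF \<omega> \<tau> \<theta> n])
    then show ?thesis by (simp only: eq)
  qed
  moreover have "(\<lambda>j. J (\<tau> j) - J 1) \<longlonglongrightarrow> 0 - J 1"
    unfolding J_def \<tau>_def
    by (intro tendsto_diff tendsto_const dilation_vanishes[OF test_form_cc[OF \<omega>] \<theta>(1) p]) (use fin n in auto)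
  ultimately have "(LINT t|lborel. ?g t) = 0 - J 1" using LIMSEQ_unique by simp
  moreover have "(LINT t|lborel. ?g t) = (-1) ^ m * (LINT x|lborel. wedge m (Suc (Suc l)) (cone m \<theta> x) (ext_deriv (Suc l) \<omega> x) std_frame)"
    unfolding g fub(2)[symmetric] by simp
  ultimately show ?thesis by (simp add: J_def)
qed

section \<open>Vanishing of the cohomology\<close>

lemma lebesgue_measurableI: "f \<in> borel_measurable lborel \<Longrightarrow> f \<in> borel_measurable lebesgue"
  by (auto intro: measurable_completion)

lemma AE_lebesgueI: "(AE x in lborel. P x) \<Longrightarrow> (AE x in lebesgue. P x)"
  by (rule AE_completion)

lemma loc_integrable_wedge_measurable:
  assumes "loc_integrable_form k \<theta>" "cc_form \<omega>"
  shows "(\<lambda>x. wedge k l (\<theta> x) (\<omega> x) e) \<in> borel_measurable lebesgue"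
  using loc_integrable_measurable[OF assms(1)] cc_formD[OF assms(2)]
  by (intro wedge_measurable) (auto intro: lebesgue_measurableI)

text \<open>Passage from the completed measure of the definitions to the Borel measure, where Fubini
  is available. The forms differ on a null set only.\<close>

lemma form_integral_version:
  fixes \<theta> \<omega> :: "'n::finite form"
  assumes \<theta>: "loc_integrable_form k \<theta>" and \<omega>: "cc_form \<omega>"
    and \<theta>': "borel_form k \<theta>'" "AE x in lborel. \<theta>' x = \<theta> x"
  shows "form_integral (\<lambda>x. wedge k l (\<theta> x) (\<omega> x)) = (LINT x|lborel. wedge k l (\<theta>' x) (\<omega> x) std_frame)"
proof -
  have m: "(\<lambda>x. wedge k l (\<theta>' x) (\<omega> x) std_frame) \<in> borel_measurable lborel"
    by (rule wedge_measurable) (use borel_formD(2)[OF \<theta>'(1)] cc_formD[OF \<omega>] in auto)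
  have "form_integral (\<lambda>x. wedge k l (\<theta> x) (\<omega> x)) = (LINT x|lebesgue. wedge k l (\<theta>' x) (\<omega> x) std_frame)"
    unfolding form_integral_def
  proof (rule integral_cong_AE[OF loc_integrable_wedge_measurable[OF \<theta> \<omega>] lebesgue_measurableI[OF m]])
    show "AE x in lebesgue. wedge k l (\<theta> x) (\<omega> x) std_frame = wedge k l (\<theta>' x) (\<omega> x) std_frame"
      using AE_lebesgueI[OF \<theta>'(2)] by eventually_elim simp
  qed
  then show ?thesis using integral_completion[OF m] by simp
qed

lemma loc_bounded_mass_version:
  assumes "AE x in lborel. \<theta>' x = \<theta> x" "loc_bounded_mass k \<theta>"
  shows "loc_bounded_mass k \<theta>'"
  unfolding loc_bounded_mass_def
proof
  fix R
  have "(\<integral>\<^sup>+x. ennreal (comp_norm k (\<theta>' x)) * indicator (cball 0 R) x \<partial>lborel)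
      = (\<integral>\<^sup>+x. ennreal (comp_norm k (\<theta> x)) * indicator (cball 0 R) x \<partial>lborel)"
    by (rule nn_integral_cong_AE) (use assms(1) in eventually_elim, simp)
  then show "(\<integral>\<^sup>+x. ennreal (comp_norm k (\<theta>' x)) * indicator (cball 0 R) x \<partial>lborel) < \<infinity>"
    using assms(2) unfolding loc_bounded_mass_def by simp
qed

lemma loc_integrable_wedge_integrable:
  fixes \<theta> \<omega> :: "'n::finite form"
  assumes \<theta>: "loc_integrable_form k \<theta>" and \<omega>: "cc_form \<omega>"
  shows "integrable lebesgue (\<lambda>x. wedge k l (\<theta> x) (\<omega> x) std_frame)"
proof -
  obtain \<theta>' where \<theta>': "borel_form k \<theta>'" "AE x in lborel. \<theta>' x = \<theta> x" using borel_version[OF \<theta>] by blast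
  have "integrable lborel (\<lambda>x. wedge k l (\<theta>' x) (\<omega> x) std_frame)"
    by (rule wedge_integrable[OF borel_formD(1)[OF \<theta>'(1)] _ loc_bounded_mass_version[OF \<theta>'(2) loc_integrable_mass[OF \<theta>]] \<omega>])
      (use borel_formD(2)[OF \<theta>'(1)] in simp)
  then have i: "integrable lebesgue (\<lambda>x. wedge k l (\<theta>' x) (\<omega> x) std_frame)"
    by (simp add: integrable_completion)
  show ?thesis
  proof (rule integrable_cong_AE_imp[OF i loc_integrable_wedge_measurable[OF \<theta> \<omega>]])
    show "AE x in lebesgue. wedge k l (\<theta>' x) (\<omega> x) std_frame = wedge k l (\<theta> x) (\<omega> x) std_frame"
      using AE_lebesgueI[OF \<theta>'(2)] by eventually_elim simp
  qed
qed

lemma loc_integrable_form_add_scale: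
  fixes \<alpha> \<beta> :: "'n::finite form"
  assumes "loc_integrable_form k \<alpha>" "loc_integrable_form k \<beta>"
  shows "loc_integrable_form k (\<lambda>x v. \<alpha> x v + c * \<beta> x v)"
proof -
  have "alternating k (\<lambda>v. 1 * \<alpha> x v + c * \<beta> x v)" for x
    by (rule alternating_linear_combination) (use assms in \<open>auto simp: loc_integrable_form_def\<close>)
  then show ?thesis using assms unfolding loc_integrable_form_def by (auto intro!: set_integral_add)
qed

lemma loc_integrable_form_zero: "loc_integrable_form k (\<lambda>x v. 0)"
  unfolding loc_integrable_form_def by (auto simp: alternating_zero)

lemma form_integral_add_scale:
  fixes \<alpha> \<beta> :: "'n::finite form"
  assumes "loc_integrable_form k \<alpha>" "loc_integrable_form k \<beta>" "cc_form \<omega>"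
  shows "form_integral (\<lambda>x. wedge k l (\<lambda>v. \<alpha> x v + c * \<beta> x v) (\<omega> x))
     = form_integral (\<lambda>x. wedge k l (\<alpha> x) (\<omega> x)) + c * form_integral (\<lambda>x. wedge k l (\<beta> x) (\<omega> x))"
  unfolding form_integral_def wedge_add_left wedge_scale_left
  using loc_integrable_wedge_integrable[OF assms(1,3)] loc_integrable_wedge_integrable[OF assms(2,3)] by simp

lemma weak_diff_add_scale:
  fixes \<phi>1 \<phi>2 :: "'n::finite form"
  assumes "weak_diff k \<phi>1 \<theta>1" "weak_diff k \<phi>2 \<theta>2"
  shows "weak_diff k (\<lambda>x v. \<phi>1 x v + c * \<phi>2 x v) (\<lambda>x v. \<theta>1 x v + c * \<theta>2 x v)"
proof -
  note d = assms[unfolded weak_diff_def]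
  show ?thesis
    unfolding weak_diff_def
  proof (intro conjI allI impI)
    show "loc_integrable_form (k - 1) (\<lambda>x v. \<phi>1 x v + c * \<phi>2 x v)" "loc_integrable_form k (\<lambda>x v. \<theta>1 x v + c * \<theta>2 x v)"
      using d loc_integrable_form_add_scale by auto
    fix l and \<omega> :: "'n form" assume \<omega>: "k + l = CARD('n) \<and> test_form l \<omega>"
    then have cc: "cc_form \<omega>" "cc_form (ext_deriv l \<omega>)" using test_form_cc test_form_ext_deriv_cc by auto
    have "form_integral (\<lambda>x. wedge k l (\<theta>1 x) (\<omega> x)) = (-1) ^ k * form_integral (\<lambda>x. wedge (k - 1) (l + 1) (\<phi>1 x) (ext_deriv l \<omega> x))"
      "form_integral (\<lambda>x. wedge k l (\<theta>2 x) (\<omega> x)) = (-1) ^ k * form_integral (\<lambda>x. wedge (k - 1) (l + 1) (\<phi>2 x) (ext_deriv l \<omega> x))"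
      using d \<omega> by blast+
    then show "form_integral (\<lambda>x. wedge k l (\<lambda>v. \<theta>1 x v + c * \<theta>2 x v) (\<omega> x)) =
        (-1) ^ k * form_integral (\<lambda>x. wedge (k - 1) (l + 1) (\<lambda>v. \<phi>1 x v + c * \<phi>2 x v) (ext_deriv l \<omega> x))"
      using d cc by (simp add: form_integral_add_scale algebra_simps)
  qed
qed

text \<open>The bound a + b \<le> 2 max a b works for every exponent p \<ge> 0, and a crude constant
  is enough to show that the spaces are closed under sums.\<close>

lemma powr_add_le:
  fixes a b p :: real
  assumes "0 \<le> a" "0 \<le> b" "0 \<le> p"
  shows "(a + b) powr p \<le> 2 powr p * (a powr p + b powr p)"
proof -
  have "(a + b) powr p \<le> (2 * max a b) powr p" using assms by (intro powr_mono2) auto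
  also have "\<dots> = 2 powr p * max a b powr p" using assms by (simp add: powr_mult)
  also have "\<dots> \<le> 2 powr p * (a powr p + b powr p)"
    by (intro mult_left_mono) (auto simp: max_def)
  finally show ?thesis .
qed

lemma vol_measurable:
  assumes "f \<in> borel_measurable lebesgue"
  shows "f \<in> borel_measurable (vol g)"
  using assms unfolding vol_def by simp

lemma Lp_forms_norm_measurable:
  assumes "riemannian_metric g" "loc_integrable_form k \<theta>"
  shows "(\<lambda>x. covector_norm g k x (\<theta> x)) \<in> borel_measurable (vol g)"
  by (intro vol_measurable covector_norm_measurable[OF assms(1)] loc_integrable_measurable[OF assms(2)])

lemma Lp_forms_add_scale:
  fixes g :: "'n::finite metric"
  assumes g: "riemannian_metric g" and \<alpha>: "\<alpha> \<in> Lp_forms g k p" and \<beta>: "\<beta> \<in> Lp_forms g k p"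
  shows "(\<lambda>x v. \<alpha> x v + c * \<beta> x v) \<in> Lp_forms g k p"
proof -
  have li: "loc_integrable_form k \<alpha>" "loc_integrable_form k \<beta>" using \<alpha> \<beta> unfolding Lp_forms_def by auto
  note s = loc_integrable_form_add_scale[OF li, of c]
  have alt: "alternating k (\<alpha> x)" "alternating k (\<beta> x)" for x using li unfolding loc_integrable_form_def by auto
  have alts: "alternating k (\<lambda>v. \<alpha> x v + c * \<beta> x v)" for x using s unfolding loc_integrable_form_def by auto
  note tri = covector_norm_triangle[OF g alt, of _ _ c]
  note nn = covector_norm_nonneg[OF g alt(1)] covector_norm_nonneg[OF g alt(2)] covector_norm_nonneg[OF g alts]
  show ?thesis
  proof (cases "p = \<infinity>")
    case True
    then obtain A B where "AE x in vol g. covector_norm g k x (\<alpha> x) \<le> A" "AE x in vol g. covector_norm g k x (\<beta> x) \<le> B"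
      using \<alpha> \<beta> unfolding Lp_forms_def by auto
    then have "AE x in vol g. covector_norm g k x (\<lambda>v. \<alpha> x v + c * \<beta> x v) \<le> A + \<bar>c\<bar> * B"
    proof eventually_elim
      case (elim x)
      have "covector_norm g k x (\<alpha> x) + \<bar>c\<bar> * covector_norm g k x (\<beta> x) \<le> A + \<bar>c\<bar> * B"
        using elim by (intro add_mono mult_left_mono) auto
      then show ?case by (rule order_trans[OF tri])
    qed
    then show ?thesis using s True unfolding Lp_forms_def by auto
  next
    case False
    define r where "r = enn2real p"
    have int: "integrable (vol g) (\<lambda>x. covector_norm g k x (\<alpha> x) powr r)" "integrable (vol g) (\<lambda>x. covector_norm g k x (\<beta> x) powr r)"
      using \<alpha> \<beta> False unfolding Lp_forms_def r_def by auto
    have [measurable]: "(\<lambda>x. covector_norm g k x (\<lambda>v. \<alpha> x v + c * \<beta> x v)) \<in> borel_measurable (vol g)"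
      by (rule Lp_forms_norm_measurable[OF g s])
    have "integrable (vol g) (\<lambda>x. covector_norm g k x (\<lambda>v. \<alpha> x v + c * \<beta> x v) powr r)"
    proof (rule Bochner_Integration.integrable_bound)
      show "integrable (vol g) (\<lambda>x. 2 powr r * (covector_norm g k x (\<alpha> x) powr r + \<bar>c\<bar> powr r * covector_norm g k x (\<beta> x) powr r))"
        using int by simp
      show "AE x in vol g. norm (covector_norm g k x (\<lambda>v. \<alpha> x v + c * \<beta> x v) powr r) \<le>
          norm (2 powr r * (covector_norm g k x (\<alpha> x) powr r + \<bar>c\<bar> powr r * covector_norm g k x (\<beta> x) powr r))"
      proof (rule AE_I2)
        fix x
        have "covector_norm g k x (\<lambda>v. \<alpha> x v + c * \<beta> x v) powr r \<le> (covector_norm g k x (\<alpha> x) + \<bar>c\<bar> * covector_norm g k x (\<beta> x)) powr r"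
          using tri nn by (intro powr_mono2) (auto simp: r_def)
        also have "\<dots> \<le> 2 powr r * (covector_norm g k x (\<alpha> x) powr r + (\<bar>c\<bar> * covector_norm g k x (\<beta> x)) powr r)"
          using nn by (intro powr_add_le) (auto simp: r_def)
        also have "(\<bar>c\<bar> * covector_norm g k x (\<beta> x)) powr r = \<bar>c\<bar> powr r * covector_norm g k x (\<beta> x) powr r"
          using nn by (simp add: powr_mult)
        finally show "norm (covector_norm g k x (\<lambda>v. \<alpha> x v + c * \<beta> x v) powr r) \<le>
          norm (2 powr r * (covector_norm g k x (\<alpha> x) powr r + \<bar>c\<bar> powr r * covector_norm g k x (\<beta> x) powr r))"
          by simp
      qed
    qed measurable
    then show ?thesis using s False unfolding Lp_forms_def r_def by simp
  qed
qed

lemma B_forms_add_scale: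
  assumes g: "riemannian_metric g" and "\<alpha> \<in> B_forms g k q p" "\<beta> \<in> B_forms g k q p"
  shows "(\<lambda>x v. \<alpha> x v + c * \<beta> x v) \<in> B_forms g k q p"
proof -
  from assms(2,3) obtain \<phi>1 \<phi>2 where "\<alpha> \<in> Lp_forms g k p" "\<beta> \<in> Lp_forms g k p"
    "\<phi>1 \<in> Lp_forms g (k - 1) q" "weak_diff k \<phi>1 \<alpha>" "\<phi>2 \<in> Lp_forms g (k - 1) q" "weak_diff k \<phi>2 \<beta>"
    unfolding B_forms_def by blast
  then show ?thesis
    unfolding B_forms_def
    using Lp_forms_add_scale[OF g, of \<alpha> k p \<beta> c] Lp_forms_add_scale[OF g, of \<phi>1 "k - 1" q \<phi>2 c]
      weak_diff_add_scale[of k \<phi>1 \<alpha> \<phi>2 \<beta> c] by blast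
qed

text \<open>Provides an element of \<open>Z_forms\<close>, so that \<open>cohomology\<close>
  contains the zero coset and is not the empty set.\<close>

lemma zero_in_Z_forms: "(\<lambda>x v. 0) \<in> Z_forms g k p"
proof -
  have "(\<lambda>x v. 0) \<in> Lp_forms g k p"
    unfolding Lp_forms_def by (auto simp: loc_integrable_form_zero covector_norm_zero)
  moreover have "weak_diff (k + 1) (\<lambda>x v. 0 :: real) (\<lambda>x v. 0)"
    unfolding weak_diff_def by (auto simp: loc_integrable_form_zero wedge_zero_left form_integral_def)
  ultimately show ?thesis unfolding Z_forms_def by simp
qed

lemma weak_closed_borel_closed:
  fixes \<theta> :: "'n::finite form"
  assumes \<theta>: "weak_diff (Suc k) \<theta> (\<lambda>x v. 0)" and \<theta>': "borel_form k \<theta>'" "AE x in lborel. \<theta>' x = \<theta> x"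
    and n: "CARD('n) = k + Suc l"
  shows "borel_closed k l \<theta>'"
  unfolding borel_closed_def
proof (intro allI impI)
  fix \<eta> :: "'n form" assume \<eta>: "test_form l \<eta>"
  have li: "loc_integrable_form k \<theta>" using \<theta> unfolding weak_diff_def by simp
  have "form_integral (\<lambda>x. wedge (Suc k) l (\<lambda>v. 0) (\<eta> x)) =
      (-1) ^ Suc k * form_integral (\<lambda>x. wedge (Suc k - 1) (l + 1) (\<theta> x) (ext_deriv l \<eta> x))"
    using \<theta> \<eta> n unfolding weak_diff_def by simp
  then have "form_integral (\<lambda>x. wedge k (Suc l) (\<theta> x) (ext_deriv l \<eta> x)) = 0"
    by (simp add: wedge_zero_left form_integral_def)
  then show "(LINT x|lborel. wedge k (Suc l) (\<theta>' x) (ext_deriv l \<eta> x) std_frame) = 0"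
    using form_integral_version[OF li test_form_ext_deriv_cc[OF \<eta>] \<theta>'] by metis
qed

text \<open>On a ball the density and the pointwise norm control the Euclidean quantities up to
  constants. This yields the local bound that \<open>cone_weak_primitive\<close> needs for the
  boundary term at the origin.\<close>

lemma comp_norm_power_loc_integrable:
  fixes g :: "'n::finite metric"
  assumes g: "riemannian_metric g" and \<theta>: "borel_form k \<theta>" and p: "0 \<le> p"
    and fin: "(\<integral>\<^sup>+x. ennreal (sqrt (det (gram g x))) * ennreal (covector_norm g k x (\<theta> x) powr p) \<partial>lborel) < \<infinity>"
  shows "(\<integral>\<^sup>+x. ennreal (comp_norm k (\<theta> x) powr p) * indicator (cball 0 R) x \<partial>lborel) < \<infinity>"
proof -
  obtain C where C: "0 < C"
    "\<And>x \<alpha> v. norm x \<le> R \<Longrightarrow> alternating k \<alpha> \<Longrightarrow> (\<And>a. a < k \<Longrightarrow> norm (v a) \<le> 1) \<Longrightarrow> \<bar>\<alpha> v\<bar> \<le> C * covector_norm g k x \<alpha>"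
    using covector_local_bounds[OF g, of R k] by metis
  obtain D where D: "0 < D" "\<And>x. norm x \<le> R \<Longrightarrow> 1 \<le> D * sqrt (det (gram g x))"
    using det_gram_local_bounds[OF g, of R] by metis
  let ?P = "{..<k} \<rightarrow>\<^sub>E (UNIV :: 'n set)"
  define K where "K = real (card ?P) * C"
  have K: "K \<ge> 0" using C by (simp add: K_def)
  define E where "E = K powr p * D"
  have E: "E \<ge> 0" using D by (simp add: E_def)
  have "(\<integral>\<^sup>+x. ennreal (comp_norm k (\<theta> x) powr p) * indicator (cball 0 R) x \<partial>lborel)
     \<le> (\<integral>\<^sup>+x. ennreal E * (ennreal (sqrt (det (gram g x))) * ennreal (covector_norm g k x (\<theta> x) powr p)) \<partial>lborel)"
  proof (rule nn_integral_mono)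
    fix x :: "real^'n"
    show "ennreal (comp_norm k (\<theta> x) powr p) * indicator (cball 0 R) x \<le>
        ennreal E * (ennreal (sqrt (det (gram g x))) * ennreal (covector_norm g k x (\<theta> x) powr p))"
    proof (cases "norm x \<le> R")
      case True
      note alt = borel_formD(1)[OF \<theta>, of x]
      let ?d = "sqrt (det (gram g x))" and ?N = "covector_norm g k x (\<theta> x)"
      have d: "?d > 0" using det_gram_pos[OF g, of x] by simp
      have N: "?N \<ge> 0" by (rule covector_norm_nonneg[OF g alt])
      have "comp_norm k (\<theta> x) \<le> (\<Sum>J\<in>?P. C * ?N)"
        unfolding comp_norm_def by (intro sum_mono C(2)[OF True alt]) simp
      also have "\<dots> = K * ?N" by (simp add: K_def)
      finally have "comp_norm k (\<theta> x) powr p \<le> (K * ?N) powr p"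
        using comp_norm_nonneg p by (intro powr_mono2) auto
      also have "\<dots> = K powr p * ?N powr p * 1" using K N by (simp add: powr_mult)
      also have "\<dots> \<le> K powr p * ?N powr p * (D * ?d)"
        using D(2)[OF True] by (intro mult_left_mono) auto
      finally have "ennreal (comp_norm k (\<theta> x) powr p) \<le> ennreal (E * (?d * ?N powr p))"
        by (intro ennreal_leI) (simp add: E_def mult_ac)
      then show ?thesis using True E d by (simp add: ennreal_mult'')
    qed simp
  qed
  also have "\<dots> < \<infinity>"
  proof -
    have [measurable]: "(\<lambda>x. covector_norm g k x (\<theta> x)) \<in> borel_measurable lebesgue"
      "(\<lambda>x. sqrt (det (gram g x))) \<in> borel_measurable lebesgue"
      using borel_formD(2)[OF \<theta>] by (auto intro!: covector_norm_measurable[OF g] vol_density_measurable[OF g] intro: measurable_completion)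
    have "(\<integral>\<^sup>+x. ennreal E * (ennreal (sqrt (det (gram g x))) * ennreal (covector_norm g k x (\<theta> x) powr p)) \<partial>lebesgue)
      = ennreal E * (\<integral>\<^sup>+x. ennreal (sqrt (det (gram g x))) * ennreal (covector_norm g k x (\<theta> x) powr p) \<partial>lebesgue)"
      by (rule nn_integral_cmult) measurable
    then show ?thesis using fin by (simp add: nn_integral_completion ennreal_mult_less_top)
  qed
  finally show ?thesis .
qed

text \<open>Up to a constant depending on v the cone is dominated by its mass, which is integrable
  on balls.\<close>

lemma cone_loc_integrable:
  fixes \<theta> :: "'n::finite form"
  assumes \<theta>: "borel_form (Suc m) \<theta>" and mass: "AE x in lborel. cone_mass m \<theta> x < \<infinity>"
    "\<And>R. (\<integral>\<^sup>+x. cone_mass m \<theta> x * indicator (cball 0 R) x \<partial>lborel) < \<infinity>"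
  shows "loc_integrable_form m (cone m \<theta>)"
  unfolding loc_integrable_form_def
proof (intro conjI allI impI)
  show "alternating m (cone m \<theta> x)" for x by (rule alternating_cone[OF \<theta>])
  fix v :: "nat \<Rightarrow> real^'n" and K :: "(real^'n) set" assume K: "compact K"
  obtain R where R: "\<And>x. x \<in> K \<Longrightarrow> norm x \<le> R"
    using compact_imp_bounded[OF K] unfolding bounded_iff by blast
  have [measurable]: "K \<in> sets borel" using K by (simp add: compact_imp_closed)
  note [measurable] = cone_measurable[OF \<theta>] cone_mass_measurable[OF \<theta>]
  have [measurable]: "cball (0::real^'n) r \<in> sets borel" for r by simp
  define c where "c = (1 + (\<Sum>a<m. norm (v a))) ^ m"
  have c: "c \<ge> 0" unfolding c_def by (intro zero_le_power add_nonneg_nonneg sum_nonneg) auto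
  have "integrable lborel (\<lambda>x. indicator K x *\<^sub>R cone m \<theta> x v)"
  proof (rule integrableI_bounded)
    have "(\<integral>\<^sup>+x. ennreal (norm (indicator K x *\<^sub>R cone m \<theta> x v)) \<partial>lborel)
      \<le> (\<integral>\<^sup>+x. ennreal c * (cone_mass m \<theta> x * indicator (cball 0 R) x) \<partial>lborel)"
    proof (rule nn_integral_mono_AE, use mass(1) in eventually_elim)
      case (elim x)
      show ?case
      proof (cases "x \<in> K")
        case True
        have "\<bar>cone m \<theta> x v\<bar> \<le> c * comp_norm m (cone m \<theta> x)"
          unfolding c_def by (rule abs_le_comp_norm_vectors[OF alternating_cone[OF \<theta>]])
        also have "\<dots> \<le> c * enn2real (cone_mass m \<theta> x)"
          using c by (intro mult_left_mono comp_norm_cone[OF \<theta> elim])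
        finally have "ennreal \<bar>cone m \<theta> x v\<bar> \<le> ennreal (c * enn2real (cone_mass m \<theta> x))" by (rule ennreal_leI)
        also have "\<dots> = ennreal c * cone_mass m \<theta> x" using c elim by (simp add: ennreal_mult)
        finally show ?thesis using True R[OF True] by simp
      qed simp
    qed
    also have "\<dots> = ennreal c * (\<integral>\<^sup>+x. cone_mass m \<theta> x * indicator (cball 0 R) x \<partial>lborel)"
      by (rule nn_integral_cmult) measurable
    also have "\<dots> < \<infinity>" using mass(2)[of R] by (auto simp: ennreal_mult_less_top)
    finally show "(\<integral>\<^sup>+x. ennreal (norm (indicator K x *\<^sub>R cone m \<theta> x v)) \<partial>lborel) < \<infinity>" .
  qed measurable
  then show "(\<lambda>x. cone m \<theta> x v) absolutely_integrable_on K"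
    unfolding set_integrable_def by (subst integrable_completion) auto
qed

text \<open>The primitive of \<theta> is the cone of a Borel representative of \<theta>. A single
  finite exponent p1 above the critical one serves both the estimates of the cone and the boundary
  term at the origin. The test forms have degree n - k \<ge> 1, written l + 1 so that they can be
  contracted.\<close>

lemma Z_forms_subset_B_forms:
  fixes g :: "'n::finite metric"
  assumes g: "riemannian_metric g" and cusp: "cusp_end g" and m: "1 \<le> m" "Suc m < CARD('n)"
    and q: "1 \<le> q" "q < ennreal ((real CARD('n) - 1) / real m)"
    and p: "ennreal ((real CARD('n) - 1) / real m) < p"
  shows "Z_forms g (Suc m) p \<subseteq> B_forms g (Suc m) q p"
proof
  fix \<theta> assume "\<theta> \<in> Z_forms g (Suc m) p"
  then have Lp: "\<theta> \<in> Lp_forms g (Suc m) p" and closed: "weak_diff (Suc (Suc m)) \<theta> (\<lambda>x v. 0)"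
    unfolding Z_forms_def by auto
  have li: "loc_integrable_form (Suc m) \<theta>" using Lp unfolding Lp_forms_def by blast
  obtain l where n: "CARD('n) = Suc m + Suc l"
    using less_imp_Suc_add[OF m(2)] by auto
  define p0 where "p0 = (real CARD('n) - 1) / real m"
  \<comment> \<open>As m < n - 1, the critical exponent exceeds 1; hence so does p1, as the Hardy
    inequality requires.\<close>
  have p0: "p0 > 1" using m by (simp add: p0_def)
  obtain p1 where p1: "p0 < p1"
    "(\<integral>\<^sup>+x. ennreal (sqrt (det (gram g x))) * ennreal (covector_norm g (Suc m) x (\<theta> x) powr p1) \<partial>lborel) < \<infinity>"
    using Lp_forms_real_exponent[OF _ g cusp Lp, of p0] p p0 m unfolding p0_def[symmetric] by auto
  have p1': "1 < p1" "real CARD('n) - 1 < real m * p1"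
    using less_trans[OF p0 p1(1)] p1(1) m by (auto simp: p0_def field_simps)
  \<comment> \<open>Adding 1 < p1 to n - 1 < m p1 gives n < (m + 1) p1: the condition at the origin
    follows from the one at infinity.\<close>
  then have p1n: "real CARD('n) < real (Suc m) * p1" by (simp add: distrib_right)
  obtain \<theta>' where \<theta>': "borel_form (Suc m) \<theta>'" "AE x in lborel. \<theta>' x = \<theta> x" using borel_version[OF li] by blast
  have fin: "(\<integral>\<^sup>+x. ennreal (sqrt (det (gram g x))) * ennreal (covector_norm g (Suc m) x (\<theta>' x) powr p1) \<partial>lborel) < \<infinity>"
  proof -
    have "(\<integral>\<^sup>+x. ennreal (sqrt (det (gram g x))) * ennreal (covector_norm g (Suc m) x (\<theta>' x) powr p1) \<partial>lborel)
      = (\<integral>\<^sup>+x. ennreal (sqrt (det (gram g x))) * ennreal (covector_norm g (Suc m) x (\<theta> x) powr p1) \<partial>lborel)"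
      by (rule nn_integral_cong_AE) (use \<theta>'(2) in eventually_elim, simp)
    then show ?thesis using p1(2) by simp
  qed
  have "m \<le> CARD('n) - 1" using m by simp
  note cone = cone_bounds[OF g cusp \<theta>'(1) p1' this fin]
  note lic = cone_loc_integrable[OF \<theta>'(1) cone(1,2)]
  note bm = loc_bounded_mass_version[OF \<theta>'(2) loc_integrable_mass[OF li]]
  note bc = weak_closed_borel_closed[OF closed \<theta>' n]
  have weak: "weak_diff (Suc m) (cone m \<theta>') \<theta>"
    unfolding weak_diff_def
  proof (intro conjI allI impI)
    show "loc_integrable_form (Suc m - 1) (cone m \<theta>')" "loc_integrable_form (Suc m) \<theta>" using lic li by auto
    fix l' and \<omega> :: "'n form" assume "Suc m + l' = CARD('n) \<and> test_form l' \<omega>"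
    then have l': "l' = Suc l" and \<omega>: "test_form (Suc l) \<omega>" using n by auto
    have bfc: "borel_form m (cone m \<theta>')"
      unfolding borel_form_def using alternating_cone[OF \<theta>'(1)] cone_measurable[OF \<theta>'(1)] by blast
    show "form_integral (\<lambda>x. wedge (Suc m) l' (\<theta> x) (\<omega> x)) =
        (-1) ^ Suc m * form_integral (\<lambda>x. wedge (Suc m - 1) (l' + 1) (cone m \<theta>' x) (ext_deriv l' \<omega> x))"
      unfolding l' form_integral_version[OF li test_form_cc[OF \<omega>] \<theta>']
      using form_integral_version[OF lic test_form_ext_deriv_cc[OF \<omega>] bfc, of "Suc (Suc l)"]
        cone_weak_primitive[OF \<omega> \<theta>'(1) bm n bc cone(1,2) p1'(1) p1n comp_norm_power_loc_integrable[OF g \<theta>'(1) _ fin]] p1'(1)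
      by simp
  qed
  have "cone m \<theta>' \<in> Lp_forms g m q"
  proof -
    have qf: "q \<noteq> \<infinity>" using q(2) by auto
    define r where "r = enn2real q"
    have qr: "q = ennreal r" using qf by (simp add: r_def less_top)
    have r: "1 \<le> r" "r < p0"
    proof -
      have "0 \<le> r" by (simp add: r_def)
      then show "1 \<le> r" "r < p0"
        using q unfolding qr p0_def[symmetric] ennreal_1[symmetric]
        by (simp_all only: ennreal_le_iff ennreal_less_iff)
    qed
    then have "real m * r < real CARD('n) - 1" using m by (simp add: p0_def field_simps)
    then have "(\<integral>\<^sup>+x. ennreal (sqrt (det (gram g x))) * ennreal (covector_norm g m x (cone m \<theta>' x) powr r) \<partial>lborel) < \<infinity>"
      using r p1(1) by (intro cone(3)) auto
    moreover have meas: "(\<lambda>x. covector_norm g m x (cone m \<theta>' x)) \<in> borel_measurable lebesgue"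
      by (rule covector_norm_measurable[OF g loc_integrable_measurable[OF lic]])
    ultimately have "(\<integral>\<^sup>+x. ennreal (norm (covector_norm g m x (cone m \<theta>' x) powr r)) \<partial>vol g) < \<infinity>"
      by (subst nn_integral_vol[OF g]) (auto simp: nn_integral_completion)
    then have "integrable (vol g) (\<lambda>x. covector_norm g m x (cone m \<theta>' x) powr r)"
      using vol_measurable[OF meas] by (intro integrableI_bounded) auto
    then show ?thesis using qf lic unfolding Lp_forms_def r_def by simp
  qed
  then show "\<theta> \<in> B_forms g (Suc m) q p"
    unfolding B_forms_def using Lp weak by auto
qed

theorem corollary7p2:
  fixes g :: "real^'n::finite \<Rightarrow> real^'n \<Rightarrow> real^'n \<Rightarrow> real"
    and k :: nat and p q :: ennreal
  assumes "2 \<le> CARD('n)" and "2 \<le> k" and "k \<le> CARD('n)"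
    and "riemannian_metric g" and "cusp_end g"
    and "1 \<le> q" and "1 \<le> p"
    and "q < ennreal ((real CARD('n) - 1) / (real k - 1))"
    and "ennreal ((real CARD('n) - 1) / (real k - 1)) < p"
  shows "cohomology g k q p = {B_forms g k q p}"
proof -
  define m where "m = k - 1"
  have k: "k = Suc m" "1 \<le> m" "real k - 1 = real m" using assms(2) by (auto simp: m_def)
  have "k \<noteq> CARD('n)"
  proof
    assume "k = CARD('n)"
    then have "q < 1" using assms(8) assms(2) by simp
    with assms(6) show False by simp
  qed
  then have "Suc m < CARD('n)" using assms(3) k by simp
  then have ZB: "Z_forms g k p \<subseteq> B_forms g k q p"
    using Z_forms_subset_B_forms[OF assms(4,5) k(2) _ assms(6)] assms(8,9)[unfolded k(3)] unfolding k(1) by blast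
  have "{(\<lambda>x v. \<alpha> x v + \<beta> x v) | \<beta>. \<beta> \<in> B_forms g k q p} = B_forms g k q p" if "\<alpha> \<in> Z_forms g k p" for \<alpha>
  proof (intro subset_antisym subsetI)
    have \<alpha>: "\<alpha> \<in> B_forms g k q p" using ZB that by blast
    fix \<gamma>
    show "\<gamma> \<in> B_forms g k q p" if "\<gamma> \<in> {(\<lambda>x v. \<alpha> x v + \<beta> x v) | \<beta>. \<beta> \<in> B_forms g k q p}"
      using that B_forms_add_scale[OF assms(4) \<alpha>, of _ 1] by auto
    \<comment> \<open>Since \<alpha> itself lies in \<open>B_forms\<close>, the witness for \<gamma>
      in the coset of \<alpha> is the difference \<gamma> - \<alpha>.\<close>
    assume "\<gamma> \<in> B_forms g k q p"
    from B_forms_add_scale[OF assms(4) this \<alpha>, of "-1"]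
    have "(\<lambda>x v. \<gamma> x v - \<alpha> x v) \<in> B_forms g k q p" by simp
    then show "\<gamma> \<in> {(\<lambda>x v. \<alpha> x v + \<beta> x v) | \<beta>. \<beta> \<in> B_forms g k q p}"
      by (intro CollectI exI[of _ "\<lambda>x v. \<gamma> x v - \<alpha> x v"]) simp
  qed
  then have "cohomology g k q p = (\<lambda>\<alpha>. B_forms g k q p) ` Z_forms g k p"
    unfolding cohomology_def by (rule image_cong[OF refl])
  then show ?thesis using zero_in_Z_forms by blast
qed

end
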